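(* Let $f\in C_{\lambda}(\mathbb{S}^1)$ be a piecewise monotone and piecewise $C^2$ map with slope strictly greater than $2$. Put $$E(f):=\{(\alpha,\beta)\in[0,1)^2: T_{\alpha,\beta}(f)\text{ has a periodic arc}\},$$ $$E_1(f):=\{\alpha\in[0,1): T_{\alpha,0}(f)\text{ has a periodic arc}\},\qquad E_2(f):=\{\beta\in[0,1): T_{0,\beta}(f)\text{ has a periodic arc}\}.$$ Then: (1) $E_1(f)=E_2(f)$ are finite sets. (2) $E(f)=\{(\alpha,0)+(\gamma,-\gamma)\pmod 1:\ \alpha\in E_1(f)\text{ and }\gamma\in[0,1)\}$, i.e., $E(f)$ is a finite union of pairwise disjoint topological circles (in the torus $[0,1)^2$). (3) For $(\alpha,\beta)\in[0,1)^2$ the following three conditions are equivalent: (3a) $T_{\alpha,\beta}(f)$ is leo; (3b) $(\alpha,\beta)\notin E(f)$; (3c) $T_{\alpha,\beta}(f)$ is measure-theoretically exact with respect to $\lambda$.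
   Context: The circle $\mathbb{S}^1$ is identified with $[0,1)$ (i.e. $\mathbb{R}/\mathbb{Z}$), $[0,1)^2$ is identified with the torus, $\lambda$ denotes normalized Lebesgue measure on $\mathbb{S}^1$ and $\mathcal{B}$ the Borel sets of $\mathbb{S}^1$. $C_{\lambda}(\mathbb{S}^1)$ is the set of all continuous maps $f:\mathbb{S}^1\to\mathbb{S}^1$ that preserve $\lambda$. For $\alpha\in[0,1)$, $r_\alpha(x)=x+\alpha\pmod 1$, and $T_{\alpha,\beta}(f)=r_\alpha\circ f\circ r_\beta$ for $(\alpha,\beta)\in[0,1)^2$. Piecewise $C^2$ has its usual meaning: there is a finite partition of $\mathbb{S}^1$ into arcs such that the restriction of $f$ to the interior of each arc extends to a $C^2$ function on the closed arc. Piecewise monotone means that there is a finite partition of $\mathbb{S}^1$ into arcs on each of which $f$ is monotone. A piecewise monotone map $f$ has slope $>s$ if $\left|\frac{f(x)-f(y)}{x-y}\right|>s$ whenever $x\neq y$ are points of an arc of monotonicity of $f$ (differences being computed in a lifting of $f$ to $\mathbb{R}$). An arc is a subset of $\mathbb{S}^1$ homeomorphic to $[0,1]$. A map $g$ has a periodic arc $A$ of minimal period $n\in\mathbb{N}$ if $A$ is an arc with $g^i(A)\ne g^j(A)$ for $0\le i<j<n$ and $g^n(A)=A$; $g$ has a periodic arc if it has one of some minimal period $n\in\mathbb{N}$. $g$ is leo if for every nonempty open $U\subset\mathbb{S}^1$ there is $n\in\mathbb{N}$ with $g^n(U)=\mathbb{S}^1$. $g$ is measure-theoretically exact with respect to $\lambda$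 if every $A\in\bigcap_{n\ge0}g^{-n}(\mathcal{B})$ satisfies $\lambda(A)\lambda(A^c)=0$. *)

theory Defs
  imports "HOL-Analysis.Analysis"
begin

text \<open>
  The circle is the unit circle of the complex plane, with the subspace topology. The point
  \<open>t\<close> of \<open>\<real>/\<int>\<close>, in particular of \<open>[0,1)\<close>, is \<open>circ_e t\<close>. A circle map is a function on
  \<open>complex\<close> of which only the values on \<open>circ\<close> matter.
\<close>

definition circ :: "complex set" where
  "circ = sphere 0 1"

definition circ_e :: "real \<Rightarrow> complex" where
  "circ_e t = cis (2 * pi * t)"

definition circ_leb :: "complex measure" where
  "circ_leb = distr (restrict_space lborel {0..<1}) (restrict_space borel circ) circ_e"

definition C_lambda :: "(complex \<Rightarrow> complex) set" where
  "C_lambda = {f. continuous_on circ f \<and> f \<in> circ \<rightarrow> circ \<and>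
     (\<forall>A\<in>sets circ_leb. emeasure circ_leb (f -` A \<inter> circ) = emeasure circ_leb A)}"

definition rot :: "real \<Rightarrow> complex \<Rightarrow> complex" where
  "rot \<alpha> z = circ_e \<alpha> * z"

definition T :: "real \<Rightarrow> real \<Rightarrow> (complex \<Rightarrow> complex) \<Rightarrow> complex \<Rightarrow> complex" where
  "T \<alpha> \<beta> f = rot \<alpha> \<circ> f \<circ> rot \<beta>"

definition is_arc :: "complex set \<Rightarrow> bool" where
  "is_arc A \<longleftrightarrow> A \<subseteq> circ \<and> A homeomorphic {0..1::real}"

text \<open>
  A partition of the circle into arcs is, as usual, taken modulo endpoints: closed arcs covering
  the circle, with pairwise disjoint interiors.
\<close>

definition arc_partition :: "complex set set \<Rightarrow> bool" where
  "arc_partition P \<longleftrightarrow> finite P \<and> (\<forall>A\<in>P. is_arc A) \<and> \<Union>P = circ \<and>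
     pairwise (\<lambda>A B. disjnt (top_of_set circ interior_of A) (top_of_set circ interior_of B)) P"

text \<open>The parametrisations of an arc by an interval of the universal cover.\<close>

definition arc_param :: "complex set \<Rightarrow> real \<Rightarrow> real \<Rightarrow> bool" where
  "arc_param A a b \<longleftrightarrow> a < b \<and> b < a + 1 \<and> A = circ_e ` {a..b}"

definition circ_lift :: "(complex \<Rightarrow> complex) \<Rightarrow> (real \<Rightarrow> real) \<Rightarrow> bool" where
  "circ_lift f F \<longleftrightarrow> continuous_on UNIV F \<and> (\<forall>t. circ_e (F t) = f (circ_e t))"

definition mono_or_antimono_on :: "real set \<Rightarrow> (real \<Rightarrow> real) \<Rightarrow> bool" where
  "mono_or_antimono_on S F \<longleftrightarrow> mono_on S F \<or> antimono_on S F"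

definition piecewise_monotone :: "(complex \<Rightarrow> complex) \<Rightarrow> bool" where
  "piecewise_monotone f \<longleftrightarrow> (\<exists>P. arc_partition P \<and>
     (\<forall>A\<in>P. \<exists>a b F. arc_param A a b \<and> circ_lift f F \<and> mono_or_antimono_on {a..b} F))"

text \<open>The variables \<open>a\<close>, \<open>b\<close> range over the endpoints of all arcs of monotonicity.\<close>

definition slope_greater :: "(complex \<Rightarrow> complex) \<Rightarrow> real \<Rightarrow> bool" where
  "slope_greater f s \<longleftrightarrow> (\<forall>F a b.
     circ_lift f F \<and> a < b \<and> b < a + 1 \<and> mono_or_antimono_on {a..b} F \<longrightarrow>
     (\<forall>x\<in>{a..b}. \<forall>y\<in>{a..b}. x \<noteq> y \<longrightarrow> \<bar>(F x - F y) / (x - y)\<bar> > s))"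

text \<open>Derivatives at the endpoints are one-sided.\<close>

definition C2_on_interval :: "real \<Rightarrow> real \<Rightarrow> (real \<Rightarrow> real) \<Rightarrow> bool" where
  "C2_on_interval a b G \<longleftrightarrow> (\<exists>G' G''.
     (\<forall>t\<in>{a..b}. (G has_real_derivative G' t) (at t within {a..b})) \<and>
     (\<forall>t\<in>{a..b}. (G' has_real_derivative G'' t) (at t within {a..b})) \<and>
     continuous_on {a..b} G'')"

definition piecewise_C2 :: "(complex \<Rightarrow> complex) \<Rightarrow> bool" where
  "piecewise_C2 f \<longleftrightarrow> (\<exists>P. arc_partition P \<and>
     (\<forall>A\<in>P. \<exists>a b G. arc_param A a b \<and> C2_on_interval a b G \<and>
        (\<forall>t\<in>{a<..<b}. circ_e (G t) = f (circ_e t))))"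

definition periodic_arc :: "(complex \<Rightarrow> complex) \<Rightarrow> complex set \<Rightarrow> nat \<Rightarrow> bool" where
  "periodic_arc g A n \<longleftrightarrow> is_arc A \<and> n \<ge> 1 \<and>
     (\<forall>i j. i < j \<and> j < n \<longrightarrow> (g ^^ i) ` A \<noteq> (g ^^ j) ` A) \<and> (g ^^ n) ` A = A"

definition has_periodic_arc :: "(complex \<Rightarrow> complex) \<Rightarrow> bool" where
  "has_periodic_arc g \<longleftrightarrow> (\<exists>A n. periodic_arc g A n)"

definition leo :: "(complex \<Rightarrow> complex) \<Rightarrow> bool" where
  "leo g \<longleftrightarrow> (\<forall>U. openin (top_of_set circ) U \<and> U \<noteq> {} \<longrightarrow> (\<exists>n\<ge>1. (g ^^ n) ` U = circ))"

definition exact :: "(complex \<Rightarrow> complex) \<Rightarrow> bool" where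
  "exact g \<longleftrightarrow> (\<forall>A \<in> (\<Inter>n. {(g ^^ n) -` B \<inter> circ | B. B \<in> sets circ_leb}).
     measure circ_leb A * measure circ_leb (circ - A) = 0)"

definition E :: "(complex \<Rightarrow> complex) \<Rightarrow> (real \<times> real) set" where
  "E f = {(\<alpha>, \<beta>) \<in> {0..<1} \<times> {0..<1}. has_periodic_arc (T \<alpha> \<beta> f)}"

definition E1 :: "(complex \<Rightarrow> complex) \<Rightarrow> real set" where
  "E1 f = {\<alpha> \<in> {0..<1}. has_periodic_arc (T \<alpha> 0 f)}"

definition E2 :: "(complex \<Rightarrow> complex) \<Rightarrow> real set" where
  "E2 f = {\<beta> \<in> {0..<1}. has_periodic_arc (T 0 \<beta> f)}"

text \<open>
  The identification of \<open>[0,1)\<^sup>2\<close> with the torus \<open>circ \<times> circ\<close>; topological statements about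
  subsets of \<open>[0,1)\<^sup>2\<close> refer to their images.
\<close>

definition torus_e :: "real \<times> real \<Rightarrow> complex \<times> complex" where
  "torus_e = map_prod circ_e circ_e"

definition topological_circle :: "(complex \<times> complex) set \<Rightarrow> bool" where
  "topological_circle C \<longleftrightarrow> C homeomorphic circ"

end

theory Submission
  imports Defs
begin

text \<open>
  Let \<open>g = T \<alpha> \<beta> f\<close>. The rotation by \<open>\<beta>\<close> conjugates \<open>g\<close> to \<open>T (\<alpha> + \<beta>) 0 f\<close>, so the existence of
  a periodic arc depends only on \<open>\<alpha> + \<beta>\<close> modulo \<open>1\<close>. This gives \<open>E1 f = E2 f\<close> and the
  description of \<open>E f\<close> as a union of antidiagonal circles. It remains to compare periodic arcs
  with the two mixing properties of \<open>g\<close>, and to show that \<open>E1 f\<close> is finite.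

  Since \<open>g\<close> preserves the measure, the image of a compact set is at least as large as the set.
  Call an arc tight if its image is no larger. Then the preimage of the image is the arc itself
  up to a null set, and for this reason complements and intersections of tight arcs are tight
  (\<open>tight_complement\<close>, \<open>tight_Int\<close>). If \<open>g\<close> is not leo, the images of some short arc converge to
  an arc that is tight for all iterates. A slope greater than \<open>2\<close> outweighs the folding at a
  single breakpoint, so short arcs grow (\<open>short_arc_grows\<close>), and among the arcs that are tight
  for all iterates there is a shortest one. Its length is at most \<open>1/2\<close> because one may pass to
  complements, and two shortest ones that overlap are equal because one may pass to
  intersections. The images of a shortest one cannot be pairwise disjoint, so it leads to a
  periodic arc (\<open>no_periodic_arc_imp_leo\<close>). Conversely the images of the interior of a periodic
  arc do not cover the circle.

  An endpoint of the image of a tight arc is the image of a breakpoint: otherwise its only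
  preimages would be the two endpoints of the arc, and the slope condition at these two points
  would make the preimage of a small neighbourhood too small. Hence there are finitely many
  tight arcs (\<open>finite_tight_arcs\<close>). A periodic arc \<open>A\<close> of \<open>T \<alpha> 0 f\<close> is tight for \<open>f\<close>, and so is
  the rotation of \<open>f ` A\<close> by \<open>\<alpha>\<close>. As two arcs of the same length determine the rotation between
  them, \<open>E1 f\<close> is finite.

  A periodic arc contradicts exactness, because the union of its preimages under the multiples
  of the period is a tail set of the same measure. For the converse let \<open>h\<close> be the interval map
  that represents \<open>g\<close>. A dual form of the Lasota-Yorke inequality, for test functions that are
  derivatives of bounded functions, shows that iteration of \<open>h \<circ> h\<close> forgets the variation of the
  initial set (\<open>lasota_yorke_iterate\<close>). If \<open>A\<close> is a tail set, the preimage of \<open>B n\<close> under the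
  \<open>n\<close>-th iterate, then the sets \<open>B n\<close> with large even \<open>n\<close> have variation bounded independently
  of \<open>n\<close>, up to small errors. A set of bounded variation is nearly full or nearly empty in all
  but a bounded number of cells of a grid, and as all \<open>B n\<close> have the measure of \<open>A\<close>, some cell
  of a fixed grid is nearly full (\<open>tail_set_nearly_full_cell\<close>). If \<open>g\<close> is leo, a fixed number of
  steps spreads this cell over the circle, and the lift being Lipschitz, \<open>B n\<close> nearly fills the
  circle for some \<open>n\<close>. So \<open>A\<close> has measure \<open>1\<close> (\<open>leo_imp_exact\<close>).
\<close>

section \<open>The circle as a quotient of the line\<close>

lemma circ_e_add: "circ_e (s + t) = circ_e s * circ_e t"
  by (simp add: circ_e_def cis_mult algebra_simps)

lemma circ_e_in_circ [simp]: "circ_e t \<in> circ"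
  by (simp add: circ_e_def circ_def)

lemma circ_e_nonzero [simp]: "circ_e t \<noteq> 0"
  by (simp add: circ_e_def)

lemma continuous_circ_e [continuous_intros]: "continuous_on S f \<Longrightarrow> continuous_on S (\<lambda>t. circ_e (f t))"
  unfolding circ_e_def by (intro continuous_intros)

lemma circ_e_eq_iff: "circ_e s = circ_e t \<longleftrightarrow> (\<exists>k. t = s + of_int k)"
proof -
  have "circ_e s = circ_e t \<longleftrightarrow> cis (2 * pi * t) / cis (2 * pi * s) = 1"
    by (auto simp: circ_e_def field_simps)
  also have "\<dots> \<longleftrightarrow> cis (2 * pi * t - 2 * pi * s) = 1"
    by (simp add: cis_divide)
  also have "\<dots> \<longleftrightarrow> (\<exists>k::int. 2 * pi * t - 2 * pi * s = of_int (2 * k) * pi)"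
    unfolding cis_conv_exp exp_eq_1 by (auto simp: algebra_simps)
  also have "\<dots> \<longleftrightarrow> (\<exists>k::int. t - s = of_int k)"
  proof -
    have "2 * pi * t - 2 * pi * s = of_int (2 * k) * pi \<longleftrightarrow> t - s = of_int k" for k :: int
    proof -
      have "2 * pi * t - 2 * pi * s - of_int (2 * k) * pi = (2 * pi) * (t - s - of_int k)"
        by (simp add: algebra_simps)
      then show ?thesis
        by (smt (verit) mult_eq_0_iff pi_gt_zero)
    qed
    then show ?thesis by simp
  qed
  also have "\<dots> \<longleftrightarrow> (\<exists>k. t = s + of_int k)"
    by (intro ex_cong1) linarith
  finally show ?thesis .
qed

lemma circ_e_of_int [simp]: "circ_e (of_int k) = 1"
  using circ_e_eq_iff [of 0 "of_int k"] by (auto simp: circ_e_def)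

lemma circ_e_0 [simp]: "circ_e 0 = 1"
  using circ_e_of_int [of 0] by simp

lemma circ_e_add_int [simp]: "circ_e (t + of_int k) = circ_e t"
  by (simp add: circ_e_add)

lemma circ_e_add_1 [simp]: "circ_e (t + 1) = circ_e t"
  using circ_e_add_int [of t 1] by simp

lemma circ_e_minus: "circ_e (- t) = inverse (circ_e t)"
  by (metis circ_e_0 circ_e_add circ_e_nonzero inverse_unique add.right_inverse)

lemma circ_e_frac [simp]: "circ_e (frac t) = circ_e t"
  using circ_e_add_int [of "frac t" "floor t"] by (simp add: frac_def)

lemma circ_e_surj:
  assumes "z \<in> circ" obtains t where "0 \<le> t" "t < 1" "z = circ_e t"
proof -
  from assms have "cmod z = 1" by (simp add: circ_def)
  then have "z = cis (Arg z)"
    using rcis_cmod_Arg [of z] by (simp add: rcis_def)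
  then obtain t where "z = cis t" by blast
  then have "z = circ_e (t / (2 * pi))" by (simp add: circ_e_def)
  then have "z = circ_e (frac (t / (2 * pi)))" by simp
  then show thesis using that frac_ge_0 frac_lt_1 by blast
qed

lemma circ_e_surj_from:
  assumes "z \<in> circ" obtains t where "x \<le> t" "t < x + 1" "z = circ_e t"
proof -
  obtain s where s: "z = circ_e s" using circ_e_surj assms by blast
  define k where "k = \<lfloor>s - x\<rfloor>"
  have "z = circ_e (s - of_int k)" using circ_e_add_int [of s "-k"] s by simp
  moreover have "x \<le> s - of_int k" "s - of_int k < x + 1" unfolding k_def by linarith+
  ultimately show thesis using that by blast
qed

lemma circ_e_inj: "x \<le> s \<Longrightarrow> s < x + 1 \<Longrightarrow> x \<le> t \<Longrightarrow> t < x + 1 \<Longrightarrow> circ_e s = circ_e t \<Longrightarrow> s = t"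
proof -
  assume a: "x \<le> s" "s < x + 1" "x \<le> t" "t < x + 1" "circ_e s = circ_e t"
  then obtain k where k: "t = s + of_int k" using circ_e_eq_iff by blast
  then have "k < 1" "k > -1" using a by linarith+
  then show "s = t" using k by simp
qed

lemma circ_e_image_period: "x + 1 \<le> y \<Longrightarrow> circ_e ` {x..y} = circ"
proof safe
  fix z assume "x + 1 \<le> y" "z \<in> circ"
  then show "z \<in> circ_e ` {x..y}"
    by (metis atLeastAtMost_iff circ_e_surj_from image_eqI less_eq_real_def order.strict_trans2)
qed auto

lemma compact_circ [simp]: "compact circ" by (simp add: circ_def)

lemma closed_circ [simp]: "closed circ" by (simp add: compact_imp_closed)

lemma circ_e_borel [measurable]: "circ_e \<in> borel_measurable borel"
  by (intro borel_measurable_continuous_onI continuous_intros)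

lemma sets_circ_leb: "A \<in> sets circ_leb \<longleftrightarrow> A \<in> sets borel \<and> A \<subseteq> circ"
  by (auto simp: circ_leb_def sets_restrict_space_iff)

lemma space_circ_leb [simp]: "space circ_leb = circ"
  by (simp add: circ_leb_def space_restrict_space)

lemma compact_sets_circ_leb: "compact A \<Longrightarrow> A \<subseteq> circ \<Longrightarrow> A \<in> sets circ_leb"
  by (simp add: sets_circ_leb borel_compact)

lemma circ_sets_circ_leb [simp]: "circ \<in> sets circ_leb"
  by (simp add: compact_sets_circ_leb)

lemma emeasure_circ_leb:
  assumes "A \<in> sets circ_leb"
  shows "emeasure circ_leb A = emeasure lborel (circ_e -` A \<inter> {0..<1})"
proof -
  have "circ_e \<in> measurable (restrict_space lborel {0..<1}) (restrict_space borel circ)"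
    by (intro measurable_restrict_space1 measurable_restrict_space2) auto
  then have "emeasure circ_leb A
      = emeasure (restrict_space lborel {0..<1}) (circ_e -` A \<inter> space (restrict_space lborel {0..<1}))"
    unfolding circ_leb_def using assms by (intro emeasure_distr) (auto simp: circ_leb_def)
  also have "\<dots> = emeasure lborel (circ_e -` A \<inter> {0..<1})"
    by (subst emeasure_restrict_space) (auto simp: space_restrict_space)
  finally show ?thesis .
qed

lemma circ_e_vimage_sets: "A \<in> sets circ_leb \<Longrightarrow> circ_e -` A \<in> sets borel"
  using measurable_sets_borel [OF circ_e_borel] by (auto simp: sets_circ_leb)

text \<open>
  The preimage of \<open>A\<close> under \<open>circ_e\<close> is invariant under integer translations, so the part of a
  period that sticks out on one side can be moved to the other side. Free choice of the starting
  point allows every arc to be measured in a period that begins at its left end.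
\<close>

lemma emeasure_circ_leb_period:
  assumes A: "A \<in> sets circ_leb"
  shows "emeasure circ_leb A = emeasure lborel (circ_e -` A \<inter> {x..<x+1})"
proof -
  define P where "P = circ_e -` A"
  have Pm [measurable]: "P \<in> sets borel" using circ_e_vimage_sets [OF A] by (simp add: P_def)
  have per: "t + of_int k \<in> P \<longleftrightarrow> t \<in> P" for t k by (simp add: P_def)
  have shift: "emeasure lborel (P \<inter> {a + of_int k..<b + of_int k}) = emeasure lborel (P \<inter> {a..<b})" for a b k
  proof -
    have "emeasure lborel (P \<inter> {a + of_int k..<b + of_int k})
        = emeasure (distr lborel borel ((+) (of_int k))) (P \<inter> {a + of_int k..<b + of_int k})"
      using lborel_distr_plus [of "of_int k :: real"] by simp
    also have "\<dots> = emeasure lborel ((+) (of_int k) -` (P \<inter> {a + of_int k..<b + of_int k}))"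
      by (subst emeasure_distr) auto
    also have "(+) (of_int k) -` (P \<inter> {a + of_int k..<b + of_int k}) = P \<inter> {a..<b}"
      using per by (auto simp: add.commute)
    finally show ?thesis .
  qed
  define k where "k = \<lfloor>x\<rfloor>"
  define y where "y = x - of_int k"
  have y: "0 \<le> y" "y < 1" unfolding y_def k_def by linarith+
  have "P \<inter> {x..<x+1} = P \<inter> {y + of_int k..<(y + 1) + of_int k}"
    by (simp add: y_def algebra_simps)
  then have "emeasure lborel (P \<inter> {x..<x+1}) = emeasure lborel (P \<inter> {y..<y+1})"
    using shift by metis
  also have "P \<inter> {y..<y+1} = (P \<inter> {y..<1}) \<union> (P \<inter> {1..<y+1})" using y by auto
  also have "emeasure lborel \<dots> = emeasure lborel (P \<inter> {y..<1}) + emeasure lborel (P \<inter> {1..<y+1})"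
    by (intro plus_emeasure [symmetric]) auto
  also have "emeasure lborel (P \<inter> {1..<y+1}) = emeasure lborel (P \<inter> {0..<y})"
    using shift [of 0 1 y] by simp
  also have "emeasure lborel (P \<inter> {y..<1}) + emeasure lborel (P \<inter> {0..<y})
      = emeasure lborel ((P \<inter> {y..<1}) \<union> (P \<inter> {0..<y}))"
    by (intro plus_emeasure) auto
  also have "(P \<inter> {y..<1}) \<union> (P \<inter> {0..<y}) = P \<inter> {0..<1}" using y by auto
  finally show ?thesis using emeasure_circ_leb [OF A] by (simp add: P_def)
qed

lemma measure_circ_leb_period:
  "A \<in> sets circ_leb \<Longrightarrow> measure circ_leb A = measure lborel (circ_e -` A \<inter> {x..<x+1})"
  using emeasure_circ_leb_period by (simp add: measure_def)

lemma measure_circ [simp]: "measure circ_leb circ = 1"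
  using measure_circ_leb_period [of circ 0] by (simp add: vimage_def)

interpretation circ_leb: finite_measure circ_leb
proof
  show "emeasure circ_leb (space circ_leb) \<noteq> \<infinity>"
    using emeasure_circ_leb [of circ] by (simp add: vimage_def)
qed

lemma measure_circ_le_1: "measure circ_leb A \<le> 1"
  using circ_leb.bounded_measure [of A] by simp

lemma arc_compact [simp]: "compact (circ_e ` {a..b})"
  by (intro compact_continuous_image continuous_circ_e) auto

lemma arc_sets [simp]: "circ_e ` {a..b} \<in> sets circ_leb"
  by (intro compact_sets_circ_leb) auto

lemma arc_closed [simp]: "closed (circ_e ` {a..b})"
  by (intro compact_imp_closed) simp

lemma measure_arc:
  assumes "a \<le> b" "b \<le> a + 1" shows "measure circ_leb (circ_e ` {a..b}) = b - a"
proof (cases "b = a + 1")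
  case True
  then show ?thesis using circ_e_image_period [of a b] by simp
next
  case False
  have "t \<in> {a..b}" if "circ_e t = circ_e s" "s \<in> {a..b}" "t \<in> {a..<a+1}" for s t
    using circ_e_inj [of a t s] that False assms by auto
  then have "circ_e -` (circ_e ` {a..b}) \<inter> {a..<a+1} = {a..b}"
    using assms False by auto
  then show ?thesis using measure_circ_leb_period [of "circ_e ` {a..b}" a] assms by simp
qed

lemma measure_arc_eq:
  assumes "a \<le> b" shows "measure circ_leb (circ_e ` {a..b}) = min 1 (b - a)"
proof (cases "b \<le> a + 1")
  case True then show ?thesis using measure_arc assms by auto
next
  case False then show ?thesis using circ_e_image_period [of a b] by simp
qed

lemma measure_point [simp]: "measure circ_leb {circ_e a} = 0"
  using measure_arc [of a a] by simp

lemma measure_finite_null: "finite S \<Longrightarrow> S \<subseteq> circ \<Longrightarrow> S \<in> sets circ_leb \<and> measure circ_leb S = 0"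
proof (induction rule: finite_induct)
  case (insert z S)
  then obtain t where t: "z = circ_e t" using circ_e_surj by blast
  have "{z} \<in> sets circ_leb" using insert by (intro compact_sets_circ_leb) auto
  moreover have "measure circ_leb ({z} \<union> S) \<le> measure circ_leb {z} + measure circ_leb S"
    using insert calculation by (intro measure_Un_le) auto
  moreover have "{z} \<union> S \<in> sets circ_leb" using insert calculation by (intro sets.Un) auto
  ultimately show ?case using insert t by (auto simp: measure_le_0_iff)
qed auto

lemma open_image_arc_contains:
  assumes "openin (top_of_set circ) U" "z \<in> U"
  obtains t r where "z = circ_e t" "0 < r" "r < 1/4" "circ_e ` {t-r..t+r} \<subseteq> U"
proof -
  from assms obtain V where V: "open V" "U = circ \<inter> V" by (auto simp: openin_open)
  obtain t where t: "z = circ_e t" using assms V circ_e_surj by blast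
  have "open (circ_e -` V)" using V by (intro open_vimage) (auto intro: continuous_intros)
  moreover have "t \<in> circ_e -` V" using t V assms by auto
  ultimately obtain e where e: "e > 0" "cball t e \<subseteq> circ_e -` V" by (meson open_contains_cball)
  define r where "r = min e (1/8)"
  have "circ_e ` {t-r..t+r} \<subseteq> U" using e V by (force simp: r_def dist_real_def mem_cball)
  then show thesis using that [of t r] t e by (auto simp: r_def)
qed

lemma measure_open_pos:
  assumes "openin (top_of_set circ) U" "U \<noteq> {}"
  shows "U \<in> sets circ_leb" "measure circ_leb U > 0"
proof -
  show U: "U \<in> sets circ_leb" using assms
    by (auto simp: sets_circ_leb openin_open)
  obtain z where "z \<in> U" using assms by auto
  then obtain t r where r: "0 < r" "r < 1/4" "circ_e ` {t-r..t+r} \<subseteq> U"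
    using open_image_arc_contains assms by metis
  then have "measure circ_leb (circ_e ` {t-r..t+r}) \<le> measure circ_leb U"
    using U by (intro circ_leb.finite_measure_mono) auto
  moreover have "measure circ_leb (circ_e ` {t-r..t+r}) = 2 * r" using r by (subst measure_arc) auto
  ultimately show "measure circ_leb U > 0" using r by linarith
qed

text \<open>
  The complement of the image is the image of the compact set of those points of \<open>{0..1}\<close> that
  lie in no integer translate of \<open>V\<close>, hence closed.
\<close>

lemma openin_circ_e_image:
  assumes "open V" shows "openin (top_of_set circ) (circ_e ` V)"
proof -
  define W where "W = (\<Union>k::int. (+) (of_int k) ` V)"
  have W: "t \<in> W \<longleftrightarrow> circ_e t \<in> circ_e ` V" for t
  proof
    assume "t \<in> W"
    then show "circ_e t \<in> circ_e ` V"
      by (auto simp: W_def circ_e_add)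
  next
    assume "circ_e t \<in> circ_e ` V"
    then obtain v where v: "v \<in> V" "circ_e v = circ_e t" by force
    then obtain k where "t = v + of_int k" by (auto simp: circ_e_eq_iff)
    then have "t \<in> (+) (of_int k) ` V" using v by (simp add: add.commute)
    then show "t \<in> W" by (auto simp: W_def)
  qed
  have "open W" using assms by (auto simp: W_def intro: open_translation)
  then have "compact ({0..1} \<inter> - W)" by (intro compact_Int_closed) auto
  then have "compact (circ_e ` ({0..1} \<inter> - W))"
    by (intro compact_continuous_image continuous_circ_e continuous_on_id)
  then have "open (- (circ_e ` ({0..1} \<inter> - W)))" by (intro open_Compl compact_imp_closed)
  moreover have "circ_e ` V = circ \<inter> - (circ_e ` ({0..1} \<inter> - W))"
  proof (intro equalityI subsetI)
    fix z assume "z \<in> circ_e ` V"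
    then obtain v where v: "v \<in> V" "z = circ_e v" by auto
    then have "t \<in> W" if "circ_e t = z" for t using W that by blast
    then show "z \<in> circ \<inter> - (circ_e ` ({0..1} \<inter> - W))" using v by auto
  next
    fix z assume z: "z \<in> circ \<inter> - (circ_e ` ({0..1} \<inter> - W))"
    then obtain t where t: "0 \<le> t" "t < 1" "z = circ_e t" using circ_e_surj by blast
    then have "t \<in> W" using z by auto
    then show "z \<in> circ_e ` V" using W t by simp
  qed
  ultimately show ?thesis unfolding openin_open by blast
qed

text \<open>
  A continuous logarithm lifts a homeomorphic image of \<open>{0..1}\<close> to the line, where its range is
  an interval \<open>{m..M}\<close>. The interval is shorter than a period because the circle is not
  contractible.
\<close>

lemma is_arc_iff_param: "is_arc A \<longleftrightarrow> (\<exists>a b. arc_param A a b)"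
proof
  assume A: "is_arc A"
  then obtain \<gamma> \<delta> where hom: "homeomorphism {0..1::real} A \<gamma> \<delta>"
    unfolding is_arc_def by (meson homeomorphic_def homeomorphic_sym)
  have cont: "continuous_on {0..1} \<gamma>" and img: "\<gamma> ` {0..1} = A"
    using hom by (auto simp: homeomorphism_def)
  have nz: "\<gamma> t \<noteq> 0" "cmod (\<gamma> t) = 1" if "t \<in> {0..1}" for t
  proof -
    have "\<gamma> t \<in> sphere 0 1" using A img that unfolding is_arc_def circ_def by blast
    then show "cmod (\<gamma> t) = 1" by simp
    then show "\<gamma> t \<noteq> 0" by auto
  qed
  obtain l where l: "continuous_on {0..1} l" "\<And>t. t \<in> {0..1} \<Longrightarrow> \<gamma> t = exp (l t)"
    using continuous_logarithm_on_contractible [OF cont _ nz(1)] convex_imp_contractible by auto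
  define u where "u = (\<lambda>t. Im (l t) / (2 * pi))"
  have u: "\<gamma> t = circ_e (u t)" if "t \<in> {0..1}" for t
  proof -
    have "Re (l t) = 0" using nz(2) [OF that] l(2) [OF that] by simp
    then show ?thesis using l(2) [OF that] by (simp add: u_def circ_e_def exp_eq_polar)
  qed
  have "continuous_on {0..1} u" unfolding u_def using l by (intro continuous_intros) auto
  then obtain m M where mM: "u ` {0..1} = {m..M}" "m \<le> M"
    using continuous_image_closed_interval [of 0 1 u] by auto
  have A_eq: "A = circ_e ` {m..M}"
  proof -
    have "A = (\<lambda>t. circ_e (u t)) ` {0..1}" using img u by force
    then show ?thesis using mM(1) by (metis image_image)
  qed
  have "m \<noteq> M"
  proof
    assume "m = M"
    moreover have "\<gamma> 0 \<in> A" "\<gamma> 1 \<in> A" using img by auto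
    ultimately have "\<gamma> 0 = \<gamma> 1" using A_eq by simp
    moreover have "inj_on \<gamma> {0..1}" using hom unfolding homeomorphism_def by (metis inj_on_inverseI)
    ultimately show False by (auto dest: inj_onD)
  qed
  moreover have "M < m + 1"
  proof (rule ccontr)
    assume "\<not> M < m + 1"
    then have "A = circ" using A_eq circ_e_image_period by simp
    then have "contractible circ"
      using A convex_imp_contractible [of "{0..1::real}"] homeomorphic_contractible homeomorphic_sym
      unfolding is_arc_def by blast
    then show False using contractible_sphere [of "0::complex" 1] by (simp add: circ_def)
  qed
  ultimately have "arc_param A m M" using A_eq mM by (simp add: arc_param_def)
  then show "\<exists>a b. arc_param A a b" by blast
next
  assume "\<exists>a b. arc_param A a b"
  then obtain a b where ab: "a < b" "b < a + 1" "A = circ_e ` {a..b}" by (auto simp: arc_param_def)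
  have "inj_on circ_e {a..b}"
    using ab by (auto intro!: inj_onI circ_e_inj [of a])
  then have "{a..b} homeomorphic A"
    using ab by (intro homeomorphic_compact) (auto intro: continuous_intros)
  then have "A homeomorphic {0..1::real}"
    by (meson ab(1) homeomorphic_closed_intervals_real homeomorphic_sym homeomorphic_trans zero_less_one)
  then show "is_arc A" using ab by (auto simp: is_arc_def)
qed

section \<open>Lifts and expanding circle maps\<close>

text \<open>The difference of two lifts is a continuous function with integer values.\<close>

lemma circ_e_lifts_differ_by_int:
  fixes F G :: "real \<Rightarrow> real"
  assumes "connected S" "continuous_on S F" "continuous_on S G" "\<And>t. t \<in> S \<Longrightarrow> circ_e (F t) = circ_e (G t)"
  obtains k where "\<And>t. t \<in> S \<Longrightarrow> G t = F t + of_int k"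
proof -
  have int: "\<exists>k::int. G t - F t = of_int k" if "t \<in> S" for t
    using assms(4) [OF that] circ_e_eq_iff by fastforce
  have "(\<lambda>t. G t - F t) constant_on S"
  proof (rule continuous_discrete_range_constant [OF assms(1)])
    show "continuous_on S (\<lambda>t. G t - F t)" using assms by (intro continuous_intros)
    fix x assume x: "x \<in> S"
    have "1 \<le> norm (G y - F y - (G x - F x))" if y: "y \<in> S" "G y - F y \<noteq> G x - F x" for y
    proof -
      obtain k l :: int where "G x - F x = of_int k" "G y - F y = of_int l" using int x y by meson
      moreover from this have "1 \<le> \<bar>l - k\<bar>" using y by auto
      then have "1 \<le> \<bar>real_of_int l - real_of_int k\<bar>" by linarith
      ultimately show ?thesis by simp
    qed
    then show "\<exists>e>0. \<forall>y. y \<in> S \<and> G y - F y \<noteq> G x - F x \<longrightarrow> e \<le> norm (G y - F y - (G x - F x))"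
      by (intro exI [of _ 1]) auto
  qed
  then obtain c where c: "\<And>t. t \<in> S \<Longrightarrow> G t - F t = c" by (auto simp: constant_on_def)
  show thesis
  proof (cases "S = {}")
    case True then show thesis using that by auto
  next
    case False
    then obtain k :: int where "c = of_int k" using int c by (metis ex_in_conv)
    then have "G t = F t + of_int k" if "t \<in> S" for t using c [OF that] by simp
    then show thesis using that by blast
  qed
qed

lemma circ_lift_shift:
  assumes "circ_lift f F" obtains n :: int where "\<And>t. F (t + of_int k) = F t + of_int n"
proof -
  have c: "continuous_on UNIV F" "\<And>t. circ_e (F t) = f (circ_e t)" using assms by (auto simp: circ_lift_def)
  have "continuous_on UNIV (\<lambda>t. F (t + of_int k))"
    by (rule continuous_on_compose2 [OF c(1)]) (auto intro!: continuous_intros)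
  then show thesis
    using circ_e_lifts_differ_by_int [of UNIV F "\<lambda>t. F (t + of_int k)"] c that by auto
qed

text \<open>
  Translating the argument by an integer and the value by a constant passes between different
  lifts and different parametrisations of an arc. The regularity of a circle map is given for
  unrelated choices of these, one for each arc, and has to be transferred to a single lift.
\<close>

lemma mono_or_antimono_on_translate:
  assumes "mono_or_antimono_on S F" "\<And>t. t \<in> S' \<Longrightarrow> t + k \<in> S \<and> G t = F (t + k) + c"
  shows "mono_or_antimono_on S' (G :: real \<Rightarrow> real)"
  using assms unfolding mono_or_antimono_on_def monotone_on_def by (smt (verit))

lemma C2_on_interval_subset:
  assumes "C2_on_interval a b G" "{x..y} \<subseteq> {a..b}" shows "C2_on_interval x y G"
  using assms unfolding C2_on_interval_def
  by (meson has_field_derivative_subset continuous_on_subset subsetD)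

lemma C2_on_interval_translate:
  assumes "C2_on_interval a b G" "\<And>t. t \<in> {x..y} \<Longrightarrow> H t = G (t + k) + c" "x + k = a" "y + k = b"
  shows "C2_on_interval x y H"
proof -
  obtain G' G'' where G: "\<And>t. t \<in> {a..b} \<Longrightarrow> (G has_real_derivative G' t) (at t within {a..b})"
     "\<And>t. t \<in> {a..b} \<Longrightarrow> (G' has_real_derivative G'' t) (at t within {a..b})" "continuous_on {a..b} G''"
    using assms(1) unfolding C2_on_interval_def by blast
  have im: "(\<lambda>t. t + k) ` {x..y} = {a..b}" using assms(3,4) by auto
  have sh: "((\<lambda>t. t + k) has_real_derivative 1) (at t within {x..y})" for t
    by (auto intro!: derivative_eq_intros)
  have *: "((\<lambda>t. u (t + k)) has_real_derivative u' (t + k)) (at t within {x..y})"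
    if "\<And>t. t \<in> {a..b} \<Longrightarrow> (u has_real_derivative u' t) (at t within {a..b})" "t \<in> {x..y}" for u u' t
  proof -
    have "(u has_real_derivative u' (t + k)) (at (t + k) within (\<lambda>t. t + k) ` {x..y})"
      unfolding im using that im by blast
    from DERIV_image_chain [OF this sh] show ?thesis by (simp add: o_def)
  qed
  show ?thesis unfolding C2_on_interval_def
  proof (intro exI conjI ballI)
    fix t assume t: "t \<in> {x..y}"
    have "((\<lambda>t. G (t + k) + c) has_real_derivative G' (t + k)) (at t within {x..y})"
      using *[OF G(1) t] by (auto intro!: derivative_eq_intros)
    then show "(H has_real_derivative G' (t + k)) (at t within {x..y})"
      by (rule has_field_derivative_transform_within [OF _ zero_less_one t]) (use assms(2) in auto)
    show "((\<lambda>t. G' (t + k)) has_real_derivative G'' (t + k)) (at t within {x..y})"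
      using *[OF G(2) t] .
  next
    show "continuous_on {x..y} (\<lambda>t. G'' (t + k))"
      by (rule continuous_on_compose2 [OF G(3)]) (use assms(3,4) in \<open>auto intro!: continuous_intros\<close>)
  qed
qed

text \<open>
  The arc containing the midpoint contains the whole interval, because its endpoints are not
  met.
\<close>

lemma interval_in_partition_arc:
  assumes "\<And>A. A \<in> P \<Longrightarrow> A = circ_e ` {a A..b A}" "\<And>A. A \<in> P \<Longrightarrow> circ_e (a A) \<in> Z \<and> circ_e (b A) \<in> Z"
    "\<Union>P = circ" "x < y" "circ_e ` {x<..<y} \<inter> Z = {}"
  obtains A k where "A \<in> P" "a A \<le> x + of_int k" "y + of_int k \<le> b A"
proof -
  define m where "m = (x + y) / 2"
  have m: "x < m" "m < y" using assms(4) by (auto simp: m_def)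
  obtain A where A: "A \<in> P" "circ_e m \<in> A" using assms(3) circ_e_in_circ by blast
  then obtain u where u: "u \<in> {a A..b A}" "circ_e m = circ_e u" using assms(1) by blast
  then obtain k where k: "u = m + of_int k" using circ_e_eq_iff by blast
  have no: "circ_e s \<notin> Z" if "x + of_int k < s" "s < y + of_int k" for s
  proof -
    have "circ_e (s + of_int (-k)) \<in> circ_e ` {x<..<y}" using that by (intro imageI) auto
    then show ?thesis using assms(5) circ_e_add_int [of s "-k"] by auto
  qed
  have "a A \<le> x + of_int k"
  proof (rule ccontr)
    assume "\<not> ?thesis"
    then have "circ_e (a A) \<notin> Z" using no u k m by auto
    then show False using assms(2) A by auto
  qed
  moreover have "y + of_int k \<le> b A"
  proof (rule ccontr)
    assume "\<not> ?thesis"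
    then have "circ_e (b A) \<notin> Z" using no u k m by auto
    then show False using assms(2) A by auto
  qed
  ultimately show thesis using that A by blast
qed

lemma C_lambda_preserves:
  assumes "g \<in> C_lambda" "A \<in> sets circ_leb"
  shows "g -` A \<inter> circ \<in> sets circ_leb" "measure circ_leb (g -` A \<inter> circ) = measure circ_leb A"
proof -
  have "continuous_on circ g" using assms by (simp add: C_lambda_def)
  then have "g \<in> borel_measurable (restrict_space borel circ)"
    by (rule borel_measurable_continuous_on_restrict)
  then have "g -` A \<inter> space (restrict_space borel circ) \<in> sets (restrict_space borel circ)"
    using assms(2) by (intro measurable_sets) (auto simp: sets_circ_leb)
  then show "g -` A \<inter> circ \<in> sets circ_leb"
    by (simp add: space_restrict_space sets_restrict_space_iff sets_circ_leb)
  show "measure circ_leb (g -` A \<inter> circ) = measure circ_leb A"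
    using assms by (simp add: C_lambda_def measure_def)
qed

lemma rot_circ_e: "rot \<alpha> (circ_e t) = circ_e (t + \<alpha>)"
  by (simp add: rot_def circ_e_add)

lemma rot_circ: "z \<in> circ \<Longrightarrow> rot \<alpha> z \<in> circ"
  by (auto simp: rot_def circ_def norm_mult circ_e_def)

lemma rot_sets: "B \<in> sets circ_leb \<Longrightarrow> rot \<alpha> -` B \<inter> circ \<in> sets circ_leb"
proof -
  assume "B \<in> sets circ_leb"
  moreover have "rot \<alpha> \<in> borel_measurable borel"
    unfolding rot_def by (intro borel_measurable_continuous_onI continuous_intros)
  ultimately show ?thesis using measurable_sets_borel [of "rot \<alpha>" borel B] by (auto simp: sets_circ_leb)
qed

lemma emeasure_rot:
  assumes "B \<in> sets circ_leb" shows "emeasure circ_leb (rot \<alpha> -` B \<inter> circ) = emeasure circ_leb B"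
proof -
  have [measurable]: "circ_e -` B \<in> sets borel" using assms by (rule circ_e_vimage_sets)
  have "emeasure circ_leb B = emeasure lborel (circ_e -` B \<inter> {\<alpha>..<\<alpha>+1})"
    by (rule emeasure_circ_leb_period [OF assms])
  also have "\<dots> = emeasure (distr lborel borel ((+) \<alpha>)) (circ_e -` B \<inter> {\<alpha>..<\<alpha>+1})"
    using lborel_distr_plus [of \<alpha>] by simp
  also have "\<dots> = emeasure lborel ((+) \<alpha> -` (circ_e -` B \<inter> {\<alpha>..<\<alpha>+1}))"
    by (subst emeasure_distr) auto
  also have "(+) \<alpha> -` (circ_e -` B \<inter> {\<alpha>..<\<alpha>+1}) = circ_e -` (rot \<alpha> -` B \<inter> circ) \<inter> {0..<1}"
    by (auto simp: rot_circ_e add.commute)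
  finally show ?thesis using emeasure_circ_leb [OF rot_sets [OF assms]] by simp
qed

lemma continuous_rot: "continuous_on S (rot \<alpha>)"
  unfolding rot_def by (intro continuous_intros)

lemma T_in_C_lambda: assumes "f \<in> C_lambda" shows "T \<alpha> \<beta> f \<in> C_lambda"
proof -
  have f: "continuous_on circ f" "f \<in> circ \<rightarrow> circ" using assms by (auto simp: C_lambda_def)
  have "emeasure circ_leb (T \<alpha> \<beta> f -` A \<inter> circ) = emeasure circ_leb A" if A: "A \<in> sets circ_leb" for A
  proof -
    have "T \<alpha> \<beta> f -` A \<inter> circ = rot \<beta> -` (f -` (rot \<alpha> -` A \<inter> circ) \<inter> circ) \<inter> circ"
      using f rot_circ by (auto simp: T_def Pi_iff)
    also have "emeasure circ_leb \<dots> = emeasure circ_leb (f -` (rot \<alpha> -` A \<inter> circ) \<inter> circ)"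
      by (intro emeasure_rot C_lambda_preserves(1) [OF assms] rot_sets A)
    also have "\<dots> = emeasure circ_leb (rot \<alpha> -` A \<inter> circ)"
      using assms rot_sets [OF A] unfolding C_lambda_def by blast
    finally show ?thesis using emeasure_rot [OF A] by simp
  qed
  moreover have "continuous_on circ (T \<alpha> \<beta> f)"
    unfolding T_def using rot_circ f
    by (intro continuous_on_compose continuous_rot continuous_on_subset [OF f(1)]) auto
  moreover have "T \<alpha> \<beta> f \<in> circ \<rightarrow> circ" using f rot_circ by (auto simp: T_def Pi_iff)
  ultimately show ?thesis by (simp add: C_lambda_def)
qed

text \<open>
  One lift \<open>F\<close> and one finite set \<open>Z\<close> of breakpoints serve both kinds of pieces. Everything is
  stated for those intervals of the universal cover whose interiors avoid \<open>Z\<close>. In this form the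
  conditions pass to \<open>T \<alpha> \<beta> f\<close> by a translation.
\<close>

locale expanding_circle_map =
  fixes g :: "complex \<Rightarrow> complex" and F :: "real \<Rightarrow> real" and Z :: "complex set"
  assumes C_lambda: "g \<in> C_lambda"
    and lift: "circ_lift g F"
    and finite_Z: "finite Z"
    and mono_piece: "\<And>x y. x < y \<Longrightarrow> circ_e ` {x<..<y} \<inter> Z = {} \<Longrightarrow> mono_or_antimono_on {x..y} F"
    and slope_piece: "\<And>x y s t. x < y \<Longrightarrow> circ_e ` {x<..<y} \<inter> Z = {} \<Longrightarrow> s \<in> {x..y} \<Longrightarrow> t \<in> {x..y} \<Longrightarrow> s < t
        \<Longrightarrow> 2 * (t - s) < \<bar>F t - F s\<bar>"
    and C2_piece: "\<And>x y. x < y \<Longrightarrow> circ_e ` {x<..<y} \<inter> Z = {} \<Longrightarrow> C2_on_interval x y F"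

text \<open>
  The set \<open>Z\<close> consists of the endpoints of the arcs of both partitions. The lifts that come with
  the arcs of monotonicity differ from a fixed lift by integers, and a smooth extension differs
  from it by an integer on the open interval, hence by continuity also at its endpoints.
\<close>

lemma expanding_circle_map_exists:
  assumes "f \<in> C_lambda" "piecewise_monotone f" "piecewise_C2 f" "slope_greater f 2"
  obtains F Z where "expanding_circle_map f F Z"
proof -
  obtain P1 where P1: "arc_partition P1"
      "\<forall>A\<in>P1. \<exists>a b F. arc_param A a b \<and> circ_lift f F \<and> mono_or_antimono_on {a..b} F"
    using assms(2) by (auto simp: piecewise_monotone_def)
  then obtain a1 b1 F1 where 1: "\<And>A. A \<in> P1 \<Longrightarrow> arc_param A (a1 A) (b1 A) \<and> circ_lift f (F1 A) \<and>
      mono_or_antimono_on {a1 A..b1 A} (F1 A)" by metis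
  obtain P2 where P2: "arc_partition P2"
      "\<forall>A\<in>P2. \<exists>a b G. arc_param A a b \<and> C2_on_interval a b G \<and> (\<forall>t\<in>{a<..<b}. circ_e (G t) = f (circ_e t))"
    using assms(3) by (auto simp: piecewise_C2_def)
  then obtain a2 b2 G where 2: "\<And>A. A \<in> P2 \<Longrightarrow> arc_param A (a2 A) (b2 A) \<and> C2_on_interval (a2 A) (b2 A) (G A) \<and>
      (\<forall>t\<in>{a2 A<..<b2 A}. circ_e (G A t) = f (circ_e t))" by metis
  have fin: "finite P1" "finite P2" "\<Union>P1 = circ" "\<Union>P2 = circ" using P1 P2 by (auto simp: arc_partition_def)
  define Z where "Z = (\<lambda>A. circ_e (a1 A)) ` P1 \<union> (\<lambda>A. circ_e (b1 A)) ` P1 \<union>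
     ((\<lambda>A. circ_e (a2 A)) ` P2 \<union> (\<lambda>A. circ_e (b2 A)) ` P2)"
  obtain A0 where "A0 \<in> P1" using fin circ_e_in_circ [of 0] by blast
  define F where "F = F1 A0"
  have lift: "circ_lift f F" using 1 \<open>A0 \<in> P1\<close> F_def by auto
  have contF: "continuous_on S F" for S using lift continuous_on_subset by (auto simp: circ_lift_def)
  have eF: "circ_e (F t) = f (circ_e t)" for t using lift by (auto simp: circ_lift_def)
  have piece1: "\<exists>A\<in>P1. \<exists>k. a1 A \<le> x + of_int k \<and> y + of_int k \<le> b1 A"
    if "x < y" "circ_e ` {x<..<y} \<inter> Z = {}" for x y
    using that fin 1 by (elim interval_in_partition_arc [where P=P1 and a=a1 and b=b1 and Z=Z, rotated 3])
      (auto simp: arc_param_def Z_def)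
  have piece2: "\<exists>A\<in>P2. \<exists>k. a2 A \<le> x + of_int k \<and> y + of_int k \<le> b2 A"
    if "x < y" "circ_e ` {x<..<y} \<inter> Z = {}" for x y
    using that fin 2 by (elim interval_in_partition_arc [where P=P2 and a=a2 and b=b2 and Z=Z, rotated 3])
      (auto simp: arc_param_def Z_def)
  have mono: "mono_or_antimono_on {x..y} F \<and> y < x + 1" if xy: "x < y" "circ_e ` {x<..<y} \<inter> Z = {}" for x y
  proof -
    obtain A k where A: "A \<in> P1" "a1 A \<le> x + of_int k" "y + of_int k \<le> b1 A" using piece1 [OF xy] by blast
    have F1: "continuous_on UNIV (F1 A)" "\<And>t. circ_e (F1 A t) = f (circ_e t)"
      using 1 [OF A(1)] by (auto simp: circ_lift_def)
    obtain m where m: "\<And>t. F t = F1 A t + of_int m"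
      using circ_e_lifts_differ_by_int [of UNIV "F1 A" F] F1 eF contF by auto
    obtain n where n: "\<And>t. F (t + of_int k) = F t + of_int n" using circ_lift_shift [OF lift] by blast
    have Ft: "F t = F1 A (t + of_int k) + (of_int m - of_int n)" for t
      using m [of "t + of_int k"] n [of t] by linarith
    have "mono_or_antimono_on {a1 A..b1 A} (F1 A)" using 1 [OF A(1)] by simp
    then have "mono_or_antimono_on {x..y} F"
    proof (rule mono_or_antimono_on_translate [where k = "of_int k" and c = "of_int m - of_int n"])
      show "t + of_int k \<in> {a1 A..b1 A} \<and> F t = F1 A (t + of_int k) + (of_int m - of_int n)"
        if "t \<in> {x..y}" for t using Ft A that by auto
    qed
    moreover have "b1 A < a1 A + 1" using 1 [OF A(1)] by (auto simp: arc_param_def)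
    ultimately show ?thesis using A by linarith
  qed
  have "expanding_circle_map f F Z"
  proof
    show "f \<in> C_lambda" "circ_lift f F" by (fact assms(1) lift)+
    show "finite Z" using fin by (simp add: Z_def)
    fix x y :: real assume xy: "x < y" "circ_e ` {x<..<y} \<inter> Z = {}"
    show "mono_or_antimono_on {x..y} F" using mono [OF xy] by simp
    show "2 * (t - s) < \<bar>F t - F s\<bar>" if "s \<in> {x..y}" "t \<in> {x..y}" "s < t" for s t
    proof -
      have "2 < \<bar>(F t - F s) / (t - s)\<bar>"
        using assms(4)[unfolded slope_greater_def, rule_format, of F x y t s] lift mono [OF xy] xy that
        by auto
      then show ?thesis using that by (simp add: abs_divide field_simps)
    qed
    obtain A k where A: "A \<in> P2" "a2 A \<le> x + of_int k" "y + of_int k \<le> b2 A" using piece2 [OF xy] by blast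
    have A2: "a2 A < b2 A" "C2_on_interval (a2 A) (b2 A) (G A)"
      "\<And>t. t \<in> {a2 A<..<b2 A} \<Longrightarrow> circ_e (G A t) = f (circ_e t)" using 2 [OF A(1)] by (auto simp: arc_param_def)
    have contG: "continuous_on {a2 A..b2 A} (G A)"
      using A2(2) unfolding C2_on_interval_def by (meson DERIV_continuous_on)
    have "connected {a2 A<..<b2 A}" by simp
    then obtain m where m: "\<And>t. t \<in> {a2 A<..<b2 A} \<Longrightarrow> F t = G A t + of_int m"
      using circ_e_lifts_differ_by_int [of "{a2 A<..<b2 A}" "G A" F] contF eF A2(3)
        continuous_on_subset [OF contG, of "{a2 A<..<b2 A}"] by force
    have cl: "F t = G A t + of_int m" if "t \<in> {a2 A..b2 A}" for t
    proof -
      have clo: "closure {a2 A<..<b2 A} = {a2 A..b2 A}" using A2(1) by simp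
      have "F t - (G A t + of_int m) = 0"
      proof (rule continuous_constant_on_closure [where S="{a2 A<..<b2 A}" and f="\<lambda>t. F t - (G A t + of_int m)" and a=0])
        show "continuous_on (closure {a2 A<..<b2 A}) (\<lambda>t. F t - (G A t + of_int m))"
          unfolding clo by (intro continuous_intros contG contF)
      qed (use m that clo in auto)
      then show ?thesis by simp
    qed
    obtain n where n: "\<And>t. F (t + of_int k) = F t + of_int n" using circ_lift_shift [OF lift] by blast
    have "C2_on_interval (x + of_int k) (y + of_int k) (G A)"
      using A2(2) A by (intro C2_on_interval_subset [OF A2(2)]) auto
    moreover have "F t = G A (t + of_int k) + (of_int m - of_int n)" if "t \<in> {x..y}" for t
      using cl [of "t + of_int k"] n [of t] that A by auto
    ultimately show "C2_on_interval x y F" by (rule C2_on_interval_translate) auto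
  qed
  then show thesis using that by blast
qed

lemma expanding_circle_map_T:
  assumes "expanding_circle_map f F Z"
  shows "expanding_circle_map (T \<alpha> \<beta> f) (\<lambda>t. F (t + \<beta>) + \<alpha>) (rot \<beta> -` Z)"
proof -
  interpret expanding_circle_map f F Z by fact
  have sh: "circ_e ` {x + \<beta><..<y + \<beta>} \<inter> Z = {}" if "circ_e ` {x<..<y} \<inter> rot \<beta> -` Z = {}" for x y
  proof -
    have False if "t \<in> {x + \<beta><..<y + \<beta>}" "circ_e t \<in> Z" for t
    proof -
      have "circ_e (t - \<beta>) \<in> circ_e ` {x<..<y} \<inter> rot \<beta> -` Z" using that by (auto simp: rot_circ_e)
      then show False using \<open>circ_e ` {x<..<y} \<inter> rot \<beta> -` Z = {}\<close> by blast
    qed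
    then show ?thesis by blast
  qed
  show ?thesis
  proof
    show "T \<alpha> \<beta> f \<in> C_lambda" by (rule T_in_C_lambda [OF C_lambda])
    have "continuous_on UNIV (\<lambda>t. F (t + \<beta>))"
      by (rule continuous_on_compose2 [where t=UNIV and g=F]) (use lift in \<open>auto simp: circ_lift_def intro!: continuous_intros\<close>)
    then show "circ_lift (T \<alpha> \<beta> f) (\<lambda>t. F (t + \<beta>) + \<alpha>)"
      using lift by (auto simp: circ_lift_def T_def rot_circ_e intro!: continuous_intros)
        (simp flip: rot_circ_e)
    have "inj (rot \<beta>)" by (auto simp: inj_on_def rot_def)
    then show "finite (rot \<beta> -` Z)" using finite_Z by (simp add: finite_vimageI)
    fix x y :: real assume xy: "x < y" "circ_e ` {x<..<y} \<inter> rot \<beta> -` Z = {}"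
    show "mono_or_antimono_on {x..y} (\<lambda>t. F (t + \<beta>) + \<alpha>)"
      by (rule mono_or_antimono_on_translate [OF mono_piece [OF _ sh [OF xy(2)]]]) (use xy in auto)
    show "2 * (t - s) < \<bar>F (t + \<beta>) + \<alpha> - (F (s + \<beta>) + \<alpha>)\<bar>" if "s \<in> {x..y}" "t \<in> {x..y}" "s < t" for s t
      using slope_piece [OF _ sh [OF xy(2)], of "s + \<beta>" "t + \<beta>"] xy that by simp
    show "C2_on_interval x y (\<lambda>t. F (t + \<beta>) + \<alpha>)"
      by (rule C2_on_interval_translate [OF C2_piece [OF _ sh [OF xy(2)]]]) (use xy in auto)
  qed
qed

section \<open>Tight arcs\<close>

abbreviation carc :: "real \<Rightarrow> real \<Rightarrow> complex set" where
  "carc a l \<equiv> circ_e ` {a..a + l}"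

abbreviation leb :: "complex set \<Rightarrow> real" where
  "leb A \<equiv> measure circ_leb A"

lemma carc_shift: "carc (a + of_int k) l = carc a l"
proof -
  have "(\<lambda>t. t + of_int k) ` {a..a + l} = {a + of_int k..a + of_int k + l}"
    by (simp add: add_ac)
  then have "carc (a + of_int k) l = (\<lambda>t. circ_e (t + of_int k)) ` {a..a + l}"
    by (metis image_image)
  then show ?thesis by simp
qed

lemma carc_subset_circ: "circ_e ` S \<subseteq> circ" by auto

lemma leb_mono: "A \<subseteq> B \<Longrightarrow> B \<in> sets circ_leb \<Longrightarrow> leb A \<le> leb B"
proof -
  assume "A \<subseteq> B" "B \<in> sets circ_leb"
  then show ?thesis
    by (cases "A \<in> sets circ_leb") (auto intro: circ_leb.finite_measure_mono simp: measure_notin_sets)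
qed

lemma C_lambdaD:
  assumes "\<phi> \<in> C_lambda"
  shows "continuous_on circ \<phi>" "z \<in> circ \<Longrightarrow> \<phi> z \<in> circ"
  using assms by (auto simp: C_lambda_def)

lemma C_lambda_funpow: assumes "g \<in> C_lambda" shows "g ^^ m \<in> C_lambda"
proof (induction m)
  case 0
  have "{z. z \<in> circ \<and> z \<in> A} = A" if "A \<in> sets circ_leb" for A
    using that by (auto simp: sets_circ_leb)
  then show ?case by (auto simp: C_lambda_def vimage_def Int_def conj_commute)
next
  case (Suc m)
  have "continuous_on circ (g \<circ> g ^^ m)"
    using C_lambdaD[OF assms] C_lambdaD[OF Suc]
    by (intro continuous_on_compose continuous_on_subset [OF C_lambdaD(1)[OF assms]]) auto
  moreover have "(g \<circ> g ^^ m) \<in> circ \<rightarrow> circ" using C_lambdaD[OF assms] C_lambdaD[OF Suc] by auto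
  moreover have "emeasure circ_leb ((g \<circ> g ^^ m) -` A \<inter> circ) = emeasure circ_leb A" if "A \<in> sets circ_leb" for A
  proof -
    have "(g \<circ> g ^^ m) -` A \<inter> circ = (g ^^ m) -` (g -` A \<inter> circ) \<inter> circ"
      using C_lambdaD(2)[OF Suc] by auto
    also have "emeasure circ_leb \<dots> = emeasure circ_leb (g -` A \<inter> circ)"
      using Suc C_lambda_preserves(1) [OF assms that] unfolding C_lambda_def by blast
    also have "\<dots> = emeasure circ_leb A" using assms that unfolding C_lambda_def by blast
    finally show ?thesis .
  qed
  ultimately show ?case unfolding C_lambda_def funpow.simps by blast
qed

lemma circ_lift_funpow: assumes "circ_lift g F" shows "circ_lift (g ^^ m) (F ^^ m)"
proof (induction m)
  case 0 then show ?case by (simp add: circ_lift_def)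
next
  case (Suc m)
  have "continuous_on UNIV (F \<circ> F ^^ m)"
    using Suc assms continuous_on_subset [of UNIV F] unfolding circ_lift_def
    by (intro continuous_on_compose) simp_all
  then show ?case using Suc assms by (auto simp: circ_lift_def)
qed

lemma compact_full_measure: assumes "compact X" "X \<subseteq> circ" "leb X = 1" shows "X = circ"
proof (rule ccontr)
  assume "X \<noteq> circ"
  moreover have "circ - X = circ \<inter> - X" by auto
  then have "openin (top_of_set circ) (circ - X)"
    using assms by (auto simp: openin_open compact_imp_closed intro!: exI [of _ "- X"])
  ultimately have "leb (circ - X) > 0" using assms by (intro measure_open_pos) auto
  moreover have "leb (circ - X) = leb circ - leb X"
    using assms by (intro circ_leb.finite_measure_Diff compact_sets_circ_leb) auto
  ultimately show False using assms by simp
qed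

context
  fixes \<phi> :: "complex \<Rightarrow> complex"
  assumes \<phi>: "\<phi> \<in> C_lambda"
begin

lemma image_compact:
  shows "compact X \<Longrightarrow> X \<subseteq> circ \<Longrightarrow> compact (\<phi> ` X)" and image_subset_circ: "X \<subseteq> circ \<Longrightarrow> \<phi> ` X \<subseteq> circ"
proof -
  show "X \<subseteq> circ \<Longrightarrow> \<phi> ` X \<subseteq> circ" using C_lambdaD(2) [OF \<phi>] by auto
  show "compact (\<phi> ` X)" if "compact X" "X \<subseteq> circ"
    by (rule compact_continuous_image [OF continuous_on_subset [OF C_lambdaD(1) [OF \<phi>]]]) (use that in auto)
qed

lemma image_sets: "compact X \<Longrightarrow> X \<subseteq> circ \<Longrightarrow> \<phi> ` X \<in> sets circ_leb"
  by (intro compact_sets_circ_leb image_compact image_subset_circ)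

lemma leb_vimage_image: "compact X \<Longrightarrow> X \<subseteq> circ \<Longrightarrow> leb (\<phi> -` (\<phi> ` X) \<inter> circ) = leb (\<phi> ` X)"
  by (intro C_lambda_preserves(2) [OF \<phi>] image_sets)

text \<open>The preimage of \<open>\<phi> ` X\<close> contains \<open>X\<close> and has the measure of \<open>\<phi> ` X\<close>.\<close>

lemma leb_image_ge: assumes "compact X" "X \<subseteq> circ" shows "leb X \<le> leb (\<phi> ` X)"
proof -
  have "leb X \<le> leb (\<phi> -` (\<phi> ` X) \<inter> circ)"
    using assms C_lambda_preserves(1) [OF \<phi> image_sets [OF assms]] by (intro leb_mono) auto
  then show ?thesis using leb_vimage_image assms by simp
qed

lemma image_circ: "\<phi> ` circ = circ"
proof (rule compact_full_measure)
  show "leb (\<phi> ` circ) = 1" using leb_image_ge [of circ] measure_circ_le_1 [of "\<phi> ` circ"] by auto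
qed (auto intro: image_compact dest: C_lambdaD(2) [OF \<phi>])

text \<open>
  Call a compact set \<open>X\<close> tight if \<open>\<phi>\<close> does not increase its measure. Preservation of the measure
  then is rigid: the preimage of \<open>\<phi> ` X\<close> has the measure of \<open>\<phi> ` X\<close>, which leaves no room
  outside \<open>X\<close>.
\<close>

lemma tight_image_vimage_null:
  assumes "compact X" "X \<subseteq> circ" "leb (\<phi> ` X) \<le> leb X"
  shows "leb (\<phi> -` (\<phi> ` X) \<inter> circ - X) = 0"
proof -
  have "leb (\<phi> -` (\<phi> ` X) \<inter> circ - X) = leb (\<phi> -` (\<phi> ` X) \<inter> circ) - leb X"
    using assms C_lambda_preserves(1) [OF \<phi> image_sets [OF assms(1,2)]] compact_sets_circ_leb
    by (intro circ_leb.finite_measure_Diff) auto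
  also have "\<dots> \<le> 0" using leb_vimage_image assms by simp
  finally show ?thesis by (simp add: measure_le_0_iff)
qed

text \<open>A nonempty such \<open>U\<close> would give positive measure to a null set.\<close>

lemma tight_open_disjoint:
  assumes "compact X" "X \<subseteq> circ" "leb (\<phi> ` X) \<le> leb X"
    and "openin (top_of_set circ) U" "U \<inter> X = {}" "\<phi> ` U \<subseteq> \<phi> ` X"
  shows "U = {}"
proof (rule ccontr)
  assume "U \<noteq> {}"
  then have pos: "leb U > 0" using measure_open_pos assms by blast
  have "U \<subseteq> circ" using assms(4) by (auto simp: openin_open)
  then have "U \<subseteq> \<phi> -` (\<phi> ` X) \<inter> circ - X" using assms by auto
  then have "leb U \<le> leb (\<phi> -` (\<phi> ` X) \<inter> circ - X)"
    using assms by (intro leb_mono sets.Diff C_lambda_preserves(1) [OF \<phi>] image_sets compact_sets_circ_leb)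
  then show False using pos tight_image_vimage_null assms by simp
qed

text \<open>Up to a null set, a point that is mapped into \<open>\<phi> ` (X \<inter> Y)\<close> lies in \<open>X\<close> and in \<open>Y\<close>.\<close>

lemma tight_Int:
  assumes X: "compact X" "X \<subseteq> circ" "leb (\<phi> ` X) \<le> leb X"
    and Y: "compact Y" "Y \<subseteq> circ" "leb (\<phi> ` Y) \<le> leb Y"
  shows "leb (\<phi> ` (X \<inter> Y)) \<le> leb (X \<inter> Y)"
proof -
  define N where "N = (\<phi> -` (\<phi> ` X) \<inter> circ - X) \<union> (\<phi> -` (\<phi> ` Y) \<inter> circ - Y)"
  have c: "compact (X \<inter> Y)" "X \<inter> Y \<subseteq> circ" using X Y by (auto intro: compact_Int)
  have s: "\<phi> -` (\<phi> ` X) \<inter> circ - X \<in> sets circ_leb" "\<phi> -` (\<phi> ` Y) \<inter> circ - Y \<in> sets circ_leb"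
    using X Y by (intro sets.Diff C_lambda_preserves(1) [OF \<phi>] image_sets compact_sets_circ_leb; simp)+
  have "leb N \<le> 0" unfolding N_def
    using measure_Un_le [OF s] tight_image_vimage_null [OF X] tight_image_vimage_null [OF Y] by simp
  moreover have "leb (\<phi> -` (\<phi> ` (X \<inter> Y)) \<inter> circ) \<le> leb ((X \<inter> Y) \<union> N)"
    using s compact_sets_circ_leb [OF c] unfolding N_def by (intro leb_mono sets.Un) auto
  moreover have "leb ((X \<inter> Y) \<union> N) \<le> leb (X \<inter> Y) + leb N"
    using s c compact_sets_circ_leb by (intro measure_Un_le) (auto simp: N_def)
  ultimately show ?thesis using leb_vimage_image [OF c] by simp
qed

text \<open>
  The lift maps the interval onto an interval, which is cut down to one period if it is longer.
  It is at least as long as the arc because images do not lose measure.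
\<close>

lemma image_arc:
  assumes "circ_lift \<phi> \<Phi>" "0 < l" "l \<le> 1"
  obtains a' l' where "l \<le> l'" "l' \<le> 1" "\<phi> ` carc a l = carc a' l'"
proof -
  have "continuous_on {a..a + l} \<Phi>" using assms(1) continuous_on_subset by (auto simp: circ_lift_def)
  then obtain c d where cd: "\<Phi> ` {a..a + l} = {c..d}" "c \<le> d"
    using continuous_image_closed_interval [of a "a + l" \<Phi>] assms by auto
  have im: "\<phi> ` carc a l = circ_e ` {c..d}"
    using assms(1) cd(1) by (simp add: circ_lift_def image_image flip: cd(1))
  have "l = leb (carc a l)" using assms by (simp add: measure_arc)
  also have "\<dots> \<le> leb (\<phi> ` carc a l)" by (intro leb_image_ge) auto
  finally have "l \<le> min 1 (d - c)" using im measure_arc_eq cd by simp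
  moreover have "\<phi> ` carc a l = carc c (min 1 (d - c))"
    using im circ_e_image_period [of c d] circ_e_image_period [of c "c + 1"] by (auto simp: min_def)
  ultimately show thesis using that [of "min 1 (d - c)" c] by simp
qed

lemma tight_image_arc:
  assumes "circ_lift \<phi> \<Phi>" "0 < l" "l \<le> 1" "leb (\<phi> ` carc a l) \<le> l"
  obtains a' where "\<phi> ` carc a l = carc a' l"
proof -
  obtain a' l' where "l \<le> l'" "l' \<le> 1" "\<phi> ` carc a l = carc a' l'" using image_arc assms by metis
  moreover from this have "l' = l" using measure_arc [of a' "a' + l'"] assms by auto
  ultimately show thesis using that by blast
qed

text \<open>
  No open part of the complementary arc can be mapped into the image of the tight arc. Hence, up
  to its endpoints, the complementary arc is mapped into the complement of the interior of that
  image.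
\<close>

lemma tight_complement:
  assumes "circ_lift \<phi> \<Phi>" "0 < l" "l < 1" "leb (\<phi> ` carc a l) \<le> l"
  shows "leb (\<phi> ` carc (a + l) (1 - l)) \<le> 1 - l"
proof -
  obtain c where c: "\<phi> ` carc a l = carc c l"
    using tight_image_arc assms by (metis less_imp_le)
  define U where "U = circ_e ` {a + l<..<a + 1}"
  define V where "V = circ_e ` {c<..<c + l}"
  have oU: "openin (top_of_set circ) U" and oV: "openin (top_of_set circ) V"
    unfolding U_def V_def by (intro openin_circ_e_image; simp)+
  have disj: "U \<inter> carc a l = {}"
  proof -
    have "circ_e s \<noteq> circ_e t" if "s \<in> {a + l<..<a + 1}" "t \<in> {a..a + l}" for s t
      using circ_e_inj [of a s t] that assms by auto
    then show ?thesis unfolding U_def disjoint_iff image_iff by metis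
  qed
  have "openin (top_of_set circ) (circ \<inter> \<phi> -` V)"
    using C_lambdaD [OF \<phi>] oV by (intro continuous_openin_preimage) auto
  then have "openin (top_of_set circ) (U \<inter> (circ \<inter> \<phi> -` V))" using oU by (rule openin_Int [rotated])
  then have "U \<inter> (circ \<inter> \<phi> -` V) = {}"
  proof (rule tight_open_disjoint [of "carc a l", rotated -3])
    show "leb (\<phi> ` carc a l) \<le> leb (carc a l)" using assms measure_arc [of a "a + l"] by simp
    have "V \<subseteq> carc c l" unfolding V_def by (intro image_mono) auto
    then show "\<phi> ` (U \<inter> (circ \<inter> \<phi> -` V)) \<subseteq> \<phi> ` carc a l" using c by auto
  qed (use disj in auto)
  moreover have "U \<subseteq> circ" by (auto simp: U_def)
  ultimately have "\<phi> ` U \<subseteq> circ - V" using C_lambdaD [OF \<phi>] by auto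
  also have "circ - V \<subseteq> carc (c + l) (1 - l)"
  proof
    fix z assume z: "z \<in> circ - V"
    then obtain t where t: "c \<le> t" "t < c + 1" "z = circ_e t" using circ_e_surj_from by blast
    show "z \<in> carc (c + l) (1 - l)"
    proof (cases "t = c")
      case True
      then have "z = circ_e (c + 1)" using t by simp
      moreover have "c + 1 \<in> {c + l..c + l + (1 - l)}" using assms by auto
      ultimately show ?thesis by blast
    next
      case False
      have "\<not> t < c + l"
      proof
        assume "t < c + l"
        then have "z \<in> V" unfolding V_def t(3) using False t by (intro imageI) auto
        then show False using z by simp
      qed
      then have "t \<in> {c + l..c + l + (1 - l)}" using t by auto
      then show ?thesis unfolding t(3) by (rule imageI)
    qed
  qed
  finally have "\<phi> ` U \<subseteq> carc (c + l) (1 - l)" .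
  moreover have "carc (a + l) (1 - l) = U \<union> {circ_e (a + l), circ_e (a + 1)}"
  proof -
    have "{a + l..a + l + (1 - l)} = {a + l<..<a + 1} \<union> {a + l, a + 1}" using assms by auto
    then show ?thesis unfolding U_def by auto
  qed
  ultimately have "\<phi> ` carc (a + l) (1 - l) \<subseteq> carc (c + l) (1 - l) \<union> {\<phi> (circ_e (a + l)), \<phi> (circ_e (a + 1))}"
    by auto
  moreover have n: "{\<phi> (circ_e (a + l)), \<phi> (circ_e (a + 1))} \<in> sets circ_leb \<and> leb {\<phi> (circ_e (a + l)), \<phi> (circ_e (a + 1))} = 0"
    using C_lambdaD [OF \<phi>] by (intro measure_finite_null) auto
  ultimately have "leb (\<phi> ` carc (a + l) (1 - l)) \<le> leb (carc (c + l) (1 - l) \<union> {\<phi> (circ_e (a + l)), \<phi> (circ_e (a + 1))})"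
    by (intro leb_mono sets.Un arc_sets conjunct1 [OF n])
  also have "\<dots> \<le> leb (carc (c + l) (1 - l)) + 0"
    using n measure_Un_le [of "carc (c + l) (1 - l)" circ_leb "{\<phi> (circ_e (a + l)), \<phi> (circ_e (a + 1))}"] by auto
  also have "\<dots> = 1 - l" using assms by (simp add: measure_arc)
  finally show ?thesis .
qed

end

text \<open>For longer arcs the intersection could consist of two arcs.\<close>

lemma carc_Int:
  assumes "0 < l" "l \<le> 1/2" "a \<le> a'" "a' < a + l"
  shows "carc a l \<inter> carc a' l = carc a' (a + l - a')"
proof (intro equalityI subsetI)
  fix z assume "z \<in> carc a l \<inter> carc a' l"
  then obtain u v where uv: "u \<in> {a..a + l}" "v \<in> {a'..a' + l}" "z = circ_e u" "z = circ_e v" by blast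
  then have "u = v" using assms by (intro circ_e_inj [of a]) auto
  then show "z \<in> carc a' (a + l - a')" using uv by auto
qed (use assms in auto)

text \<open>
  Since measures of images never decrease, all iterated images of such an arc have the length of
  the arc.
\<close>

definition orbit_tight_arc :: "(complex \<Rightarrow> complex) \<Rightarrow> real \<Rightarrow> real \<Rightarrow> bool" where
  "orbit_tight_arc g a l \<longleftrightarrow> 0 < l \<and> l < 1 \<and> (\<forall>m. leb ((g ^^ m) ` carc a l) \<le> l)"

text \<open>
  Along a subsequence the starting points converge, modulo integers. An arc in the interior of
  the limit arc is contained in almost all arcs of the sequence, so the measures of its images
  are at most \<open>L\<close>. These smaller arcs exhaust the limit arc up to its endpoints, whose images
  are null.
\<close>

lemma orbit_tight_arc_limit:
  assumes g: "g \<in> C_lambda" and L: "0 < L" "L < 1" and l: "l \<longlonglongrightarrow> L" and u: "u \<longlonglongrightarrow> L"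
    and le: "\<And>m j. leb ((g ^^ m) ` carc (a j) (l j)) \<le> u j"
  shows "\<exists>a. orbit_tight_arc g a L"
proof -
  define b where "b = (\<lambda>j::nat. frac (a j))"
  have b: "carc (a j) (l j) = carc (b j) (l j)" for j
    using carc_shift [of "b j" "\<lfloor>a j\<rfloor>" "l j"] by (simp add: b_def frac_def)
  have "\<forall>j. b j \<in> {0..1}" by (auto simp: b_def frac_lt_1 less_imp_le)
  then obtain c r where r: "strict_mono r" "(b \<circ> r) \<longlonglongrightarrow> c"
    using compact_Icc [of 0 "1::real"] unfolding compact_def by meson
  have l': "(\<lambda>j. b (r j) + l (r j)) \<longlonglongrightarrow> c + L"
    using r LIMSEQ_subseq_LIMSEQ [OF l r(1)] by (intro tendsto_add) (auto simp: o_def)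
  have u': "(\<lambda>j. u (r j)) \<longlonglongrightarrow> L" using LIMSEQ_subseq_LIMSEQ [OF u r(1)] by (simp add: o_def)
  have "leb ((g ^^ m) ` carc c L) \<le> L" for m
  proof -
    define \<phi> where "\<phi> = g ^^ m"
    have \<phi>: "\<phi> \<in> C_lambda" using C_lambda_funpow g by (simp add: \<phi>_def)
    define K where "K = (\<lambda>i::nat. \<phi> ` (circ_e ` {c + 1 / Suc i .. c + L - 1 / Suc i}))"
    have Ks: "K i \<in> sets circ_leb" for i unfolding K_def by (intro image_sets [OF \<phi>]) auto
    have KL: "leb (K i) \<le> L" for i
    proof (rule tendsto_lowerbound [OF u'])
      have "\<forall>\<^sub>F j in sequentially. b (r j) < c + 1 / Suc i"
        using r(2) by (intro order_tendstoD(2)) (auto simp: o_def)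
      moreover have "\<forall>\<^sub>F j in sequentially. c + L - 1 / Suc i < b (r j) + l (r j)"
        using l' by (intro order_tendstoD(1)) auto
      ultimately show "\<forall>\<^sub>F j in sequentially. leb (K i) \<le> u (r j)"
      proof eventually_elim
        case (elim j)
        have "K i \<subseteq> \<phi> ` carc (b (r j)) (l (r j))"
          unfolding K_def using elim by (intro image_mono) auto
        then have "leb (K i) \<le> leb (\<phi> ` carc (b (r j)) (l (r j)))"
          by (intro leb_mono image_sets [OF \<phi>]) auto
        also have "\<dots> \<le> u (r j)" using le [of m "r j"] b by (simp add: \<phi>_def)
        finally show ?case .
      qed
    qed simp
    have "incseq K"
    proof (rule incseq_SucI)
      fix i
      have "1 / real (Suc (Suc i)) \<le> 1 / real (Suc i)" by (simp add: field_simps)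
      then show "K i \<le> K (Suc i)" unfolding K_def by (intro image_mono) auto
    qed
    then have "(\<lambda>i. leb (K i)) \<longlonglongrightarrow> leb (\<Union>i. K i)"
      using Ks by (intro circ_leb.finite_Lim_measure_incseq) auto
    then have UL: "leb (\<Union>i. K i) \<le> L" using KL by (intro LIMSEQ_le_const2) auto
    define N where "N = {\<phi> (circ_e c), \<phi> (circ_e (c + L))}"
    have N: "N \<in> sets circ_leb \<and> leb N = 0"
      unfolding N_def using C_lambdaD [OF \<phi>] by (intro measure_finite_null) auto
    have "\<phi> ` carc c L \<subseteq> (\<Union>i. K i) \<union> N"
    proof
      fix z assume "z \<in> \<phi> ` carc c L"
      then obtain t where t: "t \<in> {c..c + L}" "z = \<phi> (circ_e t)" by auto
      show "z \<in> (\<Union>i. K i) \<union> N"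
      proof (cases "t = c \<or> t = c + L")
        case True then show ?thesis using t by (auto simp: N_def)
      next
        case False
        then have "min (t - c) (c + L - t) > 0" using t by auto
        then obtain i where "1 / real (Suc i) < min (t - c) (c + L - t)"
          using nat_approx_posE by blast
        then have "t \<in> {c + 1 / Suc i .. c + L - 1 / Suc i}" by auto
        then have "z \<in> K i" unfolding K_def t(2) by (intro imageI)
        then show ?thesis by blast
      qed
    qed
    then have "leb (\<phi> ` carc c L) \<le> leb ((\<Union>i. K i) \<union> N)" using Ks N by (intro leb_mono) auto
    also have "\<dots> \<le> leb (\<Union>i. K i) + leb N" using Ks N by (intro measure_Un_le) auto
    finally show ?thesis using UL N by (simp add: \<phi>_def)
  qed
  then show ?thesis using L by (auto simp: orbit_tight_arc_def)
qed

section \<open>Growth of short arcs\<close>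

lemma finite_circ_e_vimage: assumes "finite Z" shows "finite {t \<in> {u..v}. circ_e t \<in> Z}"
proof -
  have fin: "finite {t \<in> {x..<x+1}. circ_e t \<in> Z}" for x
  proof (rule finite_imageD [of circ_e])
    show "finite (circ_e ` {t \<in> {x..<x+1}. circ_e t \<in> Z})"
      by (rule finite_subset [OF _ assms]) auto
    show "inj_on circ_e {t \<in> {x..<x+1}. circ_e t \<in> Z}"
      by (auto intro!: inj_onI circ_e_inj [of x])
  qed
  have "{t \<in> {u..v}. circ_e t \<in> Z} \<subseteq> (\<Union>k\<in>{\<lfloor>u\<rfloor>..\<lfloor>v\<rfloor>}. {t \<in> {of_int k..<of_int k+1}. circ_e t \<in> Z})"
  proof
    fix t assume t: "t \<in> {t \<in> {u..v}. circ_e t \<in> Z}"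
    then have "\<lfloor>t\<rfloor> \<in> {\<lfloor>u\<rfloor>..\<lfloor>v\<rfloor>}" by (auto intro: floor_mono)
    moreover have "t \<in> {t \<in> {of_int \<lfloor>t\<rfloor>..<of_int \<lfloor>t\<rfloor>+1}. circ_e t \<in> Z}" using t by auto
    ultimately show "t \<in> (\<Union>k\<in>{\<lfloor>u\<rfloor>..\<lfloor>v\<rfloor>}. {t \<in> {of_int k..<of_int k+1}. circ_e t \<in> Z})" by blast
  qed
  then show ?thesis by (rule finite_subset) (use fin in auto)
qed

context expanding_circle_map
begin

lemma lift_continuous: "continuous_on S F"
  using lift continuous_on_subset by (auto simp: circ_lift_def)

lemma lift_eq: "circ_e (F t) = g (circ_e t)"
  using lift by (auto simp: circ_lift_def)

lemma lift_image: "circ_e ` F ` S = g ` circ_e ` S"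
  by (auto simp: lift_eq image_image)

lemma finite_breakpoints: "finite {t \<in> {u..v}. circ_e t \<in> Z}"
  by (rule finite_circ_e_vimage [OF finite_Z])

text \<open>
  Arcs of length at most \<open>\<delta>\<close> are cut by a breakpoint into at most two monotone pieces. The lift
  does not wind around the circle on such an arc, so that distances in the image can be compared
  on the line.
\<close>

lemma small_scale:
  obtains \<delta> where "0 < \<delta>" "\<delta> \<le> 1/2"
    "\<And>x y. x \<le> y \<Longrightarrow> y - x \<le> \<delta> \<Longrightarrow> \<exists>c\<in>{x..y}. circ_e ` {x<..<c} \<inter> Z = {} \<and> circ_e ` {c<..<y} \<inter> Z = {}"
    "\<And>s t. \<bar>s - t\<bar> \<le> \<delta> \<Longrightarrow> \<bar>F s - F t\<bar> < 1/2"
proof -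
  define D where "D = {t \<in> {0..2}. circ_e t \<in> Z}"
  have finD: "finite D" using finite_breakpoints by (simp add: D_def)
  \<comment> \<open>The minimum of \<open>R\<close> is at most the distance of distinct breakpoints; the element \<open>1\<close> makes \<open>R\<close> nonempty.\<close>
  define R where "R = insert 1 ((\<lambda>(s, t). t - s) ` {(s, t) \<in> D \<times> D. s < t})"
  have "finite R" using finD by (auto simp: R_def intro!: finite_imageI intro: finite_subset [of _ "D \<times> D"])
  then have "Min R > 0" by (subst Min_gr_iff) (auto simp: R_def)
  have Rle: "Min R \<le> t - s" if "s \<in> D" "t \<in> D" "s < t" for s t
    using \<open>finite R\<close> that by (intro Min_le) (auto simp: R_def)
  have "uniformly_continuous_on {0..2} F"
    by (intro compact_uniformly_continuous lift_continuous) auto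
  then obtain d where d: "d > 0" "\<And>s t. s \<in> {0..2} \<Longrightarrow> t \<in> {0..2} \<Longrightarrow> \<bar>s - t\<bar> < d \<Longrightarrow> \<bar>F s - F t\<bar> < 1/2"
    unfolding uniformly_continuous_on_def dist_real_def by (metis half_gt_zero_iff zero_less_one)
  define \<delta> where "\<delta> = min (1/2) (min (Min R / 2) (d / 2))"
  have \<delta>: "0 < \<delta>" "\<delta> \<le> 1/2" "\<delta> < Min R" "\<delta> < d"
    using \<open>Min R > 0\<close> d(1) by (auto simp: \<delta>_def)
  have ex: "\<exists>c\<in>{x..y}. circ_e ` {x<..<c} \<inter> Z = {} \<and> circ_e ` {c<..<y} \<inter> Z = {}"
    if xy: "x \<le> y" "y - x \<le> \<delta>" for x y
  proof (cases "\<exists>c\<in>{x<..<y}. circ_e c \<in> Z")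
    case True
    then obtain c where c: "c \<in> {x<..<y}" "circ_e c \<in> Z" by blast
    have uniq: "t = c" if t: "t \<in> {x<..<y}" "circ_e t \<in> Z" for t
    proof (rule ccontr)
      assume "t \<noteq> c"
      define k where "k = \<lfloor>x\<rfloor>"
      have "0 \<le> x - of_int k" "x - of_int k < 1" unfolding k_def by linarith+
      then have "c - of_int k \<in> D" "t - of_int k \<in> D"
        using c t xy \<delta> circ_e_add_int [of c "-k"] circ_e_add_int [of t "-k"] by (auto simp: D_def)
      then have "Min R \<le> \<bar>t - c\<bar>"
        using Rle [of "c - of_int k" "t - of_int k"] Rle [of "t - of_int k" "c - of_int k"] \<open>t \<noteq> c\<close>
        by (cases "t < c") auto
      then show False using c t xy \<delta> by auto
    qed
    have "circ_e t \<notin> Z" if "t \<in> {x<..<c} \<union> {c<..<y}" for t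
      using uniq [of t] c that by auto
    then have "circ_e ` {x<..<c} \<inter> Z = {} \<and> circ_e ` {c<..<y} \<inter> Z = {}" by blast
    then show ?thesis using c by (intro bexI [of _ c]) auto
  next
    case False
    then show ?thesis using xy by (intro bexI [of _ x]) auto
  qed
  have "\<bar>F s - F t\<bar> < 1/2" if "\<bar>s - t\<bar> \<le> \<delta>" for s t
  proof -
    define k where "k = \<lfloor>min s t\<rfloor>"
    have k: "0 \<le> min s t - of_int k" "min s t - of_int k < 1" unfolding k_def by linarith+
    obtain n where n: "\<And>t. F (t + of_int k) = F t + of_int n" using circ_lift_shift [OF lift] by blast
    have "\<bar>F (s - of_int k) - F (t - of_int k)\<bar> < 1/2"
    proof (rule d(2))
      show "s - of_int k \<in> {0..2}" "t - of_int k \<in> {0..2}" using k that \<delta>(2) by (auto simp: min_def split: if_splits)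
      show "\<bar>s - of_int k - (t - of_int k)\<bar> < d" using that \<delta> by simp
    qed
    then show ?thesis using n [of "s - of_int k"] n [of "t - of_int k"] by simp
  qed
  then show thesis using that [of \<delta>] \<delta> ex by blast
qed

text \<open>
  The points of a monotone piece that are mapped into an arc of length \<open>w\<close> are less than \<open>w / 2\<close>
  apart, since the slope exceeds \<open>2\<close>. The bound on the oscillation ensures that their lifted
  images lie in the same translate of that arc.
\<close>

lemma thin_preimage:
  assumes "x \<le> y" "circ_e ` {x<..<y} \<inter> Z = {}" "0 < w" "w < 1/2"
    and osc: "\<And>s t. s \<in> {x..y} \<Longrightarrow> t \<in> {x..y} \<Longrightarrow> \<bar>F s - F t\<bar> < 1/2"
  obtains S where "S \<in> sets circ_leb" "{z \<in> circ_e ` {x..y}. g z \<in> carc c w} \<subseteq> S" "leb S < w / 2"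
proof -
  define S where "S = {x..y} \<inter> (\<lambda>t. circ_e (F t)) -` carc c w"
  have sub: "{z \<in> circ_e ` {x..y}. g z \<in> carc c w} \<subseteq> circ_e ` S"
    by (auto simp: S_def simp flip: lift_eq)
  show thesis
  proof (cases "S = {}")
    case True
    then have "{z \<in> circ_e ` {x..y}. g z \<in> carc c w} \<subseteq> {}" using sub by auto
    then show thesis using that [of "{}"] assms by simp
  next
    case False
    have "continuous_on UNIV (\<lambda>t. circ_e (F t))" by (intro continuous_circ_e lift_continuous)
    then have "compact S" unfolding S_def
      by (intro compact_Int_closed closed_vimage) auto
    then obtain s t where st: "s \<in> S" "t \<in> S" "\<And>r. r \<in> S \<Longrightarrow> s \<le> r \<and> r \<le> t"
      using compact_attains_inf [OF _ False] compact_attains_sup [OF _ False] by metis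
    obtain u v where uv: "u \<in> {c..c + w}" "v \<in> {c..c + w}" "circ_e (F s) = circ_e u" "circ_e (F t) = circ_e v"
      using st by (auto simp: S_def)
    then obtain k l where kl: "u = F s + of_int k" "v = F t + of_int l" by (auto simp: circ_e_eq_iff)
    have in_xy: "s \<in> {x..y}" "t \<in> {x..y}" using st by (auto simp: S_def)
    have "\<bar>F s - F t\<bar> < 1/2" using osc in_xy by blast
    moreover have "\<bar>u - v\<bar> \<le> w" using uv by auto
    ultimately have "\<bar>real_of_int (k - l)\<bar> < 1" using kl assms by linarith
    then have "k = l" by linarith
    then have Fst: "\<bar>F t - F s\<bar> \<le> w" using kl uv by auto
    have le: "s \<le> t" using st by auto
    have "t - s < w / 2"
    proof (cases "s < t")
      case True
      then have "x < y" using in_xy by auto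
      then show ?thesis using slope_piece [OF _ assms(2) in_xy True] Fst by auto
    next
      case False then show ?thesis using assms by auto
    qed
    moreover have "leb (circ_e ` {s..t}) \<le> t - s" using measure_arc_eq [OF le] by simp
    moreover have "circ_e ` S \<subseteq> circ_e ` {s..t}" using st by (intro image_mono) auto
    ultimately show thesis using that [of "circ_e ` {s..t}"] sub by auto
  qed
qed

text \<open>
  A short arc has at most one breakpoint in its interior. One of the two pieces has at least
  half of its length, and a slope greater than \<open>2\<close> more than makes up for the loss of the other
  half. Dually, suppose that the image of an arc of length close to \<open>1\<close> missed an arc \<open>W\<close>. The
  preimage of \<open>W\<close> would lie in the short complementary arc, and each of its two monotone pieces
  contributes less than half of the measure of \<open>W\<close>.
\<close>

lemma short_arc_grows:
  obtains \<delta> where "0 < \<delta>" "\<delta> \<le> 1/2"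
    "\<And>a l. 0 < l \<Longrightarrow> l \<le> \<delta> \<Longrightarrow> leb (g ` carc a l) > l"
    "\<And>a l. 1 - \<delta> \<le> l \<Longrightarrow> l \<le> 1 \<Longrightarrow> g ` carc a l = circ"
proof -
  obtain \<delta> where \<delta>: "0 < \<delta>" "\<delta> \<le> 1/2"
    "\<And>x y. x \<le> y \<Longrightarrow> y - x \<le> \<delta> \<Longrightarrow> \<exists>c\<in>{x..y}. circ_e ` {x<..<c} \<inter> Z = {} \<and> circ_e ` {c<..<y} \<inter> Z = {}"
    "\<And>s t. \<bar>s - t\<bar> \<le> \<delta> \<Longrightarrow> \<bar>F s - F t\<bar> < 1/2" using small_scale by blast
  have grow: "leb (g ` carc a l) > l" if l: "0 < l" "l \<le> \<delta>" for a l
  proof -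
    obtain c where c: "c \<in> {a..a + l}" "circ_e ` {a<..<c} \<inter> Z = {}" "circ_e ` {c<..<a + l} \<inter> Z = {}"
      using \<delta>(3) [of a "a + l"] l by auto
    \<comment> \<open>One of the two pieces into which \<open>c\<close> divides the arc, of at least half its length.\<close>
    obtain x y where xy: "a \<le> x" "x < y" "y \<le> a + l" "y - x \<ge> l / 2" "circ_e ` {x<..<y} \<inter> Z = {}"
    proof (cases "c - a \<ge> l / 2")
      case True then show thesis using that [of a c] c l by auto
    next
      case False then show thesis using that [of c "a + l"] c l by auto
    qed
    define p q where "p = min (F x) (F y)" and "q = max (F x) (F y)"
    have pq: "p \<le> q" "q - p > 2 * (y - x)"
      using slope_piece [OF xy(2,5), of x y] xy by (auto simp: p_def q_def)
    have "connected (F ` {x..y})" by (intro connected_continuous_image lift_continuous) simp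
    then have "{p..q} \<subseteq> F ` {x..y}"
      using xy by (intro connected_contains_Icc) (auto simp: p_def q_def min_def max_def)
    also have "\<dots> \<subseteq> F ` {a..a + l}" using xy by (intro image_mono) auto
    finally have "circ_e ` {p..q} \<subseteq> g ` carc a l" by (metis lift_image image_mono)
    then have "leb (circ_e ` {p..q}) \<le> leb (g ` carc a l)"
      by (intro leb_mono image_sets [OF C_lambda]) auto
    then show ?thesis using measure_arc_eq [OF pq(1)] pq xy l \<delta> by auto
  qed
  have cover: "g ` carc a l = circ" if l: "1 - \<delta> \<le> l" "l \<le> 1" for a l
  proof (rule ccontr)
    assume neq: "g ` carc a l \<noteq> circ"
    have cl: "compact (g ` carc a l)" "g ` carc a l \<subseteq> circ"
      by (intro image_compact [OF C_lambda] image_subset_circ [OF C_lambda] arc_compact carc_subset_circ)+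
    have "circ - g ` carc a l = circ \<inter> - g ` carc a l" by auto
    then have "openin (top_of_set circ) (circ - g ` carc a l)"
      using cl by (auto simp: openin_open compact_imp_closed intro!: exI [of _ "- g ` carc a l"])
    moreover obtain z where "z \<in> circ - g ` carc a l" using neq cl(2) by blast
    ultimately obtain t r where r: "0 < r" "r < 1/4" "circ_e ` {t-r..t+r} \<subseteq> circ - g ` carc a l"
      using open_image_arc_contains by metis
    define W where "W = carc (t - r) (2 * r)"
    have W: "W \<in> sets circ_leb" "leb W = 2 * r" "W \<inter> g ` carc a l = {}"
    proof -
      have "W = circ_e ` {t-r..t+r}" by (simp add: W_def add.commute)
      then show "W \<inter> g ` carc a l = {}" using r(3) by blast
    qed (use r in \<open>auto simp: W_def measure_arc\<close>)
    obtain c where c: "c \<in> {a + l..a + 1}" "circ_e ` {a + l<..<c} \<inter> Z = {}" "circ_e ` {c<..<a + 1} \<inter> Z = {}"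
      using \<delta>(3) [of "a + l" "a + 1"] l by auto
    obtain S1 where S1: "S1 \<in> sets circ_leb" "{z \<in> circ_e ` {a + l..c}. g z \<in> carc (t - r) (2 * r)} \<subseteq> S1" "leb S1 < (2 * r) / 2"
    proof (rule thin_preimage [of "a + l" c "2 * r" "t - r"])
      show "\<bar>F s - F u\<bar> < 1/2" if "s \<in> {a + l..c}" "u \<in> {a + l..c}" for s u
        using that c l by (intro \<delta>(4)) auto
    qed (use c r in auto)
    obtain S2 where S2: "S2 \<in> sets circ_leb" "{z \<in> circ_e ` {c..a + 1}. g z \<in> carc (t - r) (2 * r)} \<subseteq> S2" "leb S2 < (2 * r) / 2"
    proof (rule thin_preimage [of c "a + 1" "2 * r" "t - r"])
      show "\<bar>F s - F u\<bar> < 1/2" if "s \<in> {c..a + 1}" "u \<in> {c..a + 1}" for s u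
        using that c l by (intro \<delta>(4)) auto
    qed (use c r in auto)
    have "g -` W \<inter> circ \<subseteq> S1 \<union> S2"
    proof
      fix z assume z: "z \<in> g -` W \<inter> circ"
      then obtain u where u: "a \<le> u" "u < a + 1" "z = circ_e u" using circ_e_surj_from by blast
      have "\<not> u \<le> a + l"
      proof
        assume "u \<le> a + l"
        then have "g z \<in> g ` carc a l" using u by auto
        then show False using W z by auto
      qed
      then have "z \<in> circ_e ` {a + l..c} \<or> z \<in> circ_e ` {c..a + 1}"
        using u c by (cases "u \<le> c") auto
      then show "z \<in> S1 \<union> S2" using S1 S2 z W_def by auto
    qed
    then have "leb (g -` W \<inter> circ) \<le> leb (S1 \<union> S2)" using S1 S2 by (intro leb_mono) auto
    also have "\<dots> \<le> leb S1 + leb S2" using S1 S2 by (intro measure_Un_le)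
    finally show False using C_lambda_preserves(2) [OF C_lambda W(1)] W S1 S2 by simp
  qed
  show thesis by (rule that [OF \<delta>(1,2) grow cover])
qed

end

section \<open>Periodic arcs of maps that are not leo\<close>

context expanding_circle_map
begin

lemma funpow_C_lambda: "g ^^ m \<in> C_lambda"
  by (rule C_lambda_funpow [OF C_lambda])

lemma funpow_lift: "circ_lift (g ^^ m) (F ^^ m)"
  by (rule circ_lift_funpow [OF lift])

lemma funpow_image: "(g ^^ (m + n)) ` X = (g ^^ m) ` ((g ^^ n) ` X)"
  by (simp add: funpow_add image_comp)

lemma funpow_circ: "(g ^^ m) ` circ = circ"
  by (rule image_circ [OF funpow_C_lambda])

text \<open>
  The images of the interior of a periodic arc under the multiples of the period stay inside the
  arc, and once an image is the whole circle all later ones are.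
\<close>

lemma leo_imp_no_periodic_arc: assumes "leo g" shows "\<not> has_periodic_arc g"
proof
  assume "has_periodic_arc g"
  then obtain A n where A: "is_arc A" "n \<ge> 1" "(g ^^ n) ` A = A"
    by (auto simp: has_periodic_arc_def periodic_arc_def)
  then obtain a b where ab: "a < b" "b < a + 1" "A = circ_e ` {a..b}"
    by (auto simp: is_arc_iff_param arc_param_def)
  have it: "(g ^^ (n * k)) ` A = A" for k
    by (induction k) (use A in \<open>auto simp: funpow_image add.commute\<close>)
  define U where "U = circ_e ` {a<..<b}"
  have "openin (top_of_set circ) U" "U \<noteq> {}" using ab by (auto simp: U_def intro: openin_circ_e_image)
  then obtain m where m: "m \<ge> 1" "(g ^^ m) ` U = circ" using assms unfolding leo_def by blast
  have "U \<subseteq> A" unfolding U_def ab by (intro image_mono) auto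
  have "m \<le> n * m" using A by simp
  then have "(g ^^ (n * m)) ` U = (g ^^ (n * m - m)) ` ((g ^^ m) ` U)"
    by (simp flip: funpow_image)
  also have "\<dots> = circ" using m funpow_circ by simp
  finally have "circ \<subseteq> A" using it [of m] \<open>U \<subseteq> A\<close> by blast
  then have "A = circ" using A by (auto simp: is_arc_def)
  then have "leb A = 1" by simp
  then show False using ab measure_arc [of a b] by simp
qed

lemma tight_image_arc_funpow:
  assumes "orbit_tight_arc g a l" obtains a' where "(g ^^ m) ` carc a l = carc a' l" "orbit_tight_arc g a' l"
proof -
  obtain a' where a': "(g ^^ m) ` carc a l = carc a' l"
    using assms tight_image_arc [OF funpow_C_lambda funpow_lift] unfolding orbit_tight_arc_def by (metis less_imp_le)
  moreover have "orbit_tight_arc g a' l"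
    unfolding orbit_tight_arc_def
  proof (intro conjI allI)
    show "leb ((g ^^ k) ` carc a' l) \<le> l" for k
      using assms unfolding orbit_tight_arc_def by (metis a' funpow_image)
  qed (use assms in \<open>auto simp: orbit_tight_arc_def\<close>)
  ultimately show thesis using that by blast
qed

lemma orbit_tight_arc_complement: assumes "orbit_tight_arc g a l" shows "orbit_tight_arc g (a + l) (1 - l)"
  using assms tight_complement [OF funpow_C_lambda funpow_lift] by (auto simp: orbit_tight_arc_def)

text \<open>
  The images of a short arc inside \<open>U\<close> are arcs of nondecreasing lengths with a limit \<open>L\<close>. Since
  none of them is close to the whole circle, \<open>L < 1\<close>. They accumulate at an arc of length \<open>L\<close>,
  whose images cannot be longer than \<open>L\<close>.
\<close>

lemma not_leo_imp_orbit_tight_arc: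
  assumes "\<not> leo g" obtains a l where "orbit_tight_arc g a l"
proof -
  obtain U where U: "openin (top_of_set circ) U" "U \<noteq> {}" "\<And>n. n \<ge> 1 \<Longrightarrow> (g ^^ n) ` U \<noteq> circ"
    using assms by (auto simp: leo_def)
  then obtain t r where r: "0 < r" "r < 1/4" "circ_e ` {t-r..t+r} \<subseteq> U"
    using open_image_arc_contains by (metis ex_in_conv)
  define J where "J = carc (t - r) (2 * r)"
  have JU: "J \<subseteq> U" using r by (simp add: J_def add.commute)
  have ncirc: "(g ^^ n) ` J \<noteq> circ" if "n \<ge> 1" for n
  proof
    assume "(g ^^ n) ` J = circ"
    moreover have "(g ^^ n) ` U \<subseteq> circ"
      using U(1) image_subset_circ [OF funpow_C_lambda] by (auto simp: openin_open)
    ultimately show False using U(3) [OF that] JU by blast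
  qed
  have "\<exists>a l. 2 * r \<le> l \<and> l \<le> 1 \<and> (g ^^ n) ` J = carc a l" for n
  proof -
    obtain a l where "2 * r \<le> l" "l \<le> 1" "(g ^^ n) ` carc (t - r) (2 * r) = carc a l"
      by (rule image_arc [OF funpow_C_lambda funpow_lift, of "2 * r" n "t - r"]) (use r in auto)
    then show ?thesis unfolding J_def by blast
  qed
  then obtain a l where al: "\<And>n. 2 * r \<le> l n" "\<And>n. l n \<le> 1" "\<And>n. (g ^^ n) ` J = carc (a n) (l n)"
    by metis
  have leb_l: "leb ((g ^^ n) ` J) = l n" for n
    using al [of n] r by (simp add: measure_arc)
  have "incseq l"
  proof (rule incseq_SucI)
    fix n
    have "leb ((g ^^ n) ` J) \<le> leb (g ` (g ^^ n) ` J)"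
      unfolding al(3) by (intro leb_image_ge [OF C_lambda]) auto
    then show "l n \<le> l (Suc n)" using leb_l [of n] leb_l [of "Suc n"] by (simp add: image_comp)
  qed
  then obtain L where L: "l \<longlonglongrightarrow> L" "\<And>n. l n \<le> L"
    using incseq_convergent [of l 1] al(2) by blast
  obtain \<delta> where \<delta>: "0 < \<delta>" "\<And>a l. 1 - \<delta> \<le> l \<Longrightarrow> l \<le> 1 \<Longrightarrow> g ` carc a l = circ"
    using short_arc_grows by metis
  have "l n \<le> 1 - \<delta>" for n
  proof (rule ccontr)
    assume "\<not> ?thesis"
    then have "g ` carc (a n) (l n) = circ" using \<delta> al(2) by simp
    moreover have "(g ^^ Suc n) ` J = g ` ((g ^^ n) ` J)" by (simp add: image_comp)
    ultimately have "(g ^^ Suc n) ` J = circ" unfolding al(3) by simp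
    then show False using ncirc [of "Suc n"] by (simp del: funpow.simps)
  qed
  then have "L \<le> 1 - \<delta>" by (intro LIMSEQ_le_const2 [OF L(1)]) blast
  then have "L < 1" using \<delta> by linarith
  have "L > 0" using al(1) [of 0] L(2) [of 0] r by linarith
  have "\<exists>a. orbit_tight_arc g a L"
  proof (rule orbit_tight_arc_limit [OF C_lambda \<open>L > 0\<close> \<open>L < 1\<close> L(1) tendsto_const])
    fix m j
    show "leb ((g ^^ m) ` carc (a j) (l j)) \<le> L"
      using leb_l [of "m + j"] L(2) [of "m + j"] unfolding funpow_image by (simp add: al(3))
  qed
  then show thesis using that by auto
qed

text \<open>
  The lengths are bounded away from \<open>0\<close> because short arcs grow, and the infimum is attained in
  the limit of a minimising sequence. Complements of orbit-tight arcs are orbit-tight, so the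
  infimum is at most \<open>1/2\<close>.
\<close>

lemma exists_minimal_orbit_tight_arc:
  assumes "orbit_tight_arc g a0 l0"
  obtains a l where "orbit_tight_arc g a l" "l \<le> 1/2" "\<And>a' l'. orbit_tight_arc g a' l' \<Longrightarrow> l \<le> l'"
proof -
  obtain \<delta> where \<delta>: "0 < \<delta>" "\<And>a l. 0 < l \<Longrightarrow> l \<le> \<delta> \<Longrightarrow> leb (g ` carc a l) > l"
    using short_arc_grows by metis
  define S where "S = {l. \<exists>a. orbit_tight_arc g a l}"
  have low: "\<delta> \<le> l" if lS: "l \<in> S" for l
  proof -
    obtain a where "orbit_tight_arc g a l" using lS unfolding S_def by blast
    then have "0 < l" "leb ((g ^^ 1) ` carc a l) \<le> l" unfolding orbit_tight_arc_def by blast+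
    then show ?thesis using \<delta>(2) [of l a] by force
  qed
  have S: "S \<noteq> {}" "bdd_below S" using assms low by (auto simp: S_def bdd_below_def)
  define L where "L = Inf S"
  have L: "\<delta> \<le> L" "\<And>l. l \<in> S \<Longrightarrow> L \<le> l"
    using S low by (auto simp: L_def intro: cInf_greatest cInf_lower)
  have half: "L \<le> 1/2"
  proof -
    have "l0 \<in> S" "1 - l0 \<in> S" using assms orbit_tight_arc_complement by (auto simp: S_def)
    then show ?thesis using L(2) [of l0] L(2) [of "1 - l0"] by linarith
  qed
  have "\<exists>l\<in>S. l < L + 1 / Suc j" for j
    using cInf_lessD [OF S(1), of "L + 1 / Suc j"] by (auto simp: L_def)
  then obtain l where l: "\<And>j. l j \<in> S" "\<And>j. l j < L + 1 / real (Suc j)" by metis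
  then obtain a where a: "\<And>j. orbit_tight_arc g (a j) (l j)" unfolding S_def by (auto; metis)
  have lim: "l \<longlonglongrightarrow> L"
  proof (rule tendsto_sandwich [of "\<lambda>_. L" _ _ "\<lambda>j. L + 1 / real (Suc j)"])
    show "(\<lambda>j. L + 1 / real (Suc j)) \<longlonglongrightarrow> L"
      using tendsto_add [OF tendsto_const LIMSEQ_inverse_real_of_nat, of L] by (simp add: inverse_eq_divide)
  qed (use l(2) L(2) [OF l(1)] in \<open>auto intro!: always_eventually less_imp_le simp del: of_nat_Suc\<close>)
  obtain b where b: "orbit_tight_arc g b L"
  proof (atomize_elim, rule orbit_tight_arc_limit [OF C_lambda _ _ lim lim])
    show "leb ((g ^^ m) ` carc (a j) (l j)) \<le> l j" for m j using a [of j] by (auto simp: orbit_tight_arc_def)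
  qed (use L \<delta> half in auto)
  show thesis by (rule that [OF b half L(2)]) (auto simp: S_def)
qed

text \<open>Otherwise the intersection would be a shorter orbit-tight arc.\<close>

lemma minimal_orbit_tight_arcs_meet_imp_eq:
  assumes "orbit_tight_arc g a l" "orbit_tight_arc g a' l" "l \<le> 1/2" "\<And>a' l'. orbit_tight_arc g a' l' \<Longrightarrow> l \<le> l'"
    and "s \<in> {a<..<a + l}" "s' \<in> {a'<..<a' + l}" "circ_e s = circ_e s'"
  shows "carc a l = carc a' l"
proof -
  have main: "carc a l = carc b l"
    if "orbit_tight_arc g a l" "orbit_tight_arc g b l" "s \<in> {a<..<a + l}" "s \<in> {b<..<b + l}" "a \<le> b" for a b s
  proof (rule ccontr)
    assume "carc a l \<noteq> carc b l"
    then have "a < b" using that(5) by (cases "a = b") auto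
    have "0 < l" using assms(1) by (simp add: orbit_tight_arc_def)
    have eq: "carc a l \<inter> carc b l = carc b (a + l - b)"
      using that assms(3) \<open>0 < l\<close> by (intro carc_Int) auto
    have "orbit_tight_arc g b (a + l - b)"
      unfolding orbit_tight_arc_def
    proof (intro conjI allI)
      fix m
      have "leb ((g ^^ m) ` (carc a l \<inter> carc b l)) \<le> leb (carc a l \<inter> carc b l)"
        using that assms(3) \<open>0 < l\<close> by (intro tight_Int [OF funpow_C_lambda]) (auto simp: orbit_tight_arc_def measure_arc)
      also have "\<dots> = a + l - b" unfolding eq using that assms(3) by (subst measure_arc) auto
      finally show "leb ((g ^^ m) ` carc b (a + l - b)) \<le> a + l - b" unfolding eq .
    qed (use that assms(3) in auto)
    then show False using assms(4) \<open>a < b\<close> by force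
  qed
  obtain k where k: "s' = s + of_int k" using assms(7) circ_e_eq_iff by blast
  define b where "b = a' + of_int (-k)"
  have c: "carc b l = carc a' l" unfolding b_def by (rule carc_shift)
  then have gb: "orbit_tight_arc g b l" using assms(2) by (simp add: orbit_tight_arc_def)
  have sb: "s \<in> {b<..<b + l}" using assms(6) k by (auto simp: b_def)
  have "carc a l = carc b l"
  proof (cases "a \<le> b")
    case True
    show ?thesis by (rule main [OF assms(1) gb assms(5) sb True])
  next
    case False
    then have "b \<le> a" by simp
    then show ?thesis by (rule main [OF gb assms(1) sb assms(5), symmetric])
  qed
  then show ?thesis using c by simp
qed

text \<open>
  All images of a minimal orbit-tight arc are again minimal, of the same length \<open>l\<close>. With
  \<open>1 / (N + 1) < l\<close> the interior of each of them contains one of the \<open>N + 1\<close> points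
  \<open>circ_e (j / (N + 1))\<close>, so two of them share a point and therefore are equal. The least period
  of that arc is a minimal period in the required sense.
\<close>

lemma no_periodic_arc_imp_leo: assumes "\<not> has_periodic_arc g" shows "leo g"
proof (rule ccontr)
  assume "\<not> leo g"
  then obtain a0 l0 where "orbit_tight_arc g a0 l0" using not_leo_imp_orbit_tight_arc by blast
  then obtain a l where al: "orbit_tight_arc g a l" "l \<le> 1/2" "\<And>a' l'. orbit_tight_arc g a' l' \<Longrightarrow> l \<le> l'"
    using exists_minimal_orbit_tight_arc by blast
  have l: "0 < l" "l < 1" using al(1) by (auto simp: orbit_tight_arc_def)
  have "\<exists>b. (g ^^ m) ` carc a l = carc b l \<and> orbit_tight_arc g b l" for m
    using tight_image_arc_funpow [OF al(1), of m] by metis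
  then obtain b where b: "\<And>m. (g ^^ m) ` carc a l = carc (b m) l" "\<And>m. orbit_tight_arc g (b m) l"
    by metis
  obtain N :: nat where N: "1 / real (Suc N) < l" using nat_approx_posE l by blast
  have "\<exists>j. j \<le> N \<and> (\<exists>s\<in>{b m<..<b m + l}. circ_e s = circ_e (real j / Suc N))" for m
  proof -
    \<comment> \<open>The first grid point after \<open>b m\<close> is \<open>i / (N + 1)\<close>, and \<open>j\<close> is its numerator modulo \<open>N + 1\<close>.\<close>
    define i where "i = \<lfloor>b m * Suc N\<rfloor> + 1"
    define j where "j = nat (i mod int (Suc N))"
    define s where "s = of_int i / real (Suc N)"
    have "b m * Suc N < of_int i" "of_int i \<le> b m * Suc N + 1" unfolding i_def by linarith+
    then have "b m < s" "s \<le> (b m * Suc N + 1) / Suc N"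
      unfolding s_def by (auto simp: pos_less_divide_eq intro!: divide_right_mono)
    moreover have "(b m * Suc N + 1) / Suc N = b m + 1 / Suc N" by (simp add: add_divide_distrib)
    ultimately have "b m < s" "s \<le> b m + 1 / Suc N" by simp_all
    then have "s \<in> {b m<..<b m + l}" using N by auto
    moreover have "j \<le> N" unfolding j_def
      by (metis nat_less_iff less_Suc_eq_le of_nat_0_less_iff pos_mod_bound pos_mod_sign zero_less_Suc nat_int)
    moreover have "circ_e s = circ_e (real j / Suc N)"
    proof -
      have "i = int j + int (Suc N) * (i div int (Suc N))" unfolding j_def
        by (simp add: mod_div_mult_eq mult.commute)
      then have "real_of_int i = real j + real (Suc N) * of_int (i div int (Suc N))"
        by (metis of_int_add of_int_mult of_int_of_nat_eq)
      then have "s = real j / Suc N + of_int (i div int (Suc N))"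
        unfolding s_def by (simp add: field_simps)
      then show ?thesis by simp
    qed
    ultimately show ?thesis by blast
  qed
  then obtain j where j: "\<And>m::nat. j m \<le> N" "\<And>m. \<exists>s\<in>{b m<..<b m + l}. circ_e s = circ_e (real (j m) / Suc N)"
    by metis
  have "\<not> inj j"
  proof
    assume "inj j"
    moreover have "finite (range j)" using j(1) finite_subset [of "range j" "{..N}"] by auto
    ultimately show False using finite_imageD by blast
  qed
  then obtain m m' where mm: "m < m'" "j m = j m'" unfolding inj_def by (metis linorder_neqE_nat)
  obtain s s' where s: "s \<in> {b m<..<b m + l}" "s' \<in> {b m'<..<b m' + l}" "circ_e s = circ_e s'"
    using j(2) [of m] j(2) [of m'] mm(2) by metis
  have eq: "carc (b m) l = carc (b m') l"
    by (rule minimal_orbit_tight_arcs_meet_imp_eq [OF b(2) b(2) al(2) _ s]) (rule al(3))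
  define A where "A = carc (b m) l"
  have "(g ^^ (m' - m)) ` A = A"
  proof -
    have "(g ^^ m') ` carc a l = (g ^^ (m' - m)) ` ((g ^^ m) ` carc a l)"
      using mm by (simp flip: funpow_image)
    then show ?thesis using b(1) eq by (simp add: A_def)
  qed
  then have ex: "\<exists>n\<ge>1. (g ^^ n) ` A = A" using mm by (intro exI [of _ "m' - m"]) auto
  define n where "n = (LEAST n. n \<ge> 1 \<and> (g ^^ n) ` A = A)"
  have n: "n \<ge> 1" "(g ^^ n) ` A = A" and n_le: "\<And>k. k \<ge> 1 \<Longrightarrow> (g ^^ k) ` A = A \<Longrightarrow> n \<le> k"
    using LeastI_ex [OF ex] unfolding n_def by (auto intro: Least_le)
  have "(g ^^ i) ` A \<noteq> (g ^^ k) ` A" if "i < k" "k < n" for i k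
  proof
    assume "(g ^^ i) ` A = (g ^^ k) ` A"
    then have "(g ^^ (n - k + i)) ` A = (g ^^ (n - k + k)) ` A" unfolding funpow_image by simp
    then have "(g ^^ (n - k + i)) ` A = A" using n that by simp
    then show False using n_le [of "n - k + i"] that by linarith
  qed
  moreover have "is_arc A" unfolding is_arc_iff_param A_def arc_param_def
    by (intro exI [of _ "b m"] exI [of _ "b m + l"]) (use l in auto)
  ultimately have "periodic_arc g A n" using n by (auto simp: periodic_arc_def)
  then show False using assms by (auto simp: has_periodic_arc_def)
qed

lemma leo_iff_no_periodic_arc: "leo g \<longleftrightarrow> \<not> has_periodic_arc g"
  using leo_imp_no_periodic_arc no_periodic_arc_imp_leo by blast

end

section \<open>Finiteness of the exceptional rotations\<close>

text \<open>
  If the starting points differed, the second arc would start inside the first one and extend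
  beyond its end, to points before a full turn.
\<close>

lemma carc_eq_imp_start_eq:
  assumes eq: "carc a l = carc b l" and l: "0 < l" "l < 1"
  shows "circ_e a = circ_e b"
proof -
  obtain c where c: "a \<le> c" "c < a + 1" "circ_e b = circ_e c"
    using circ_e_surj_from [of "circ_e b" a] by auto
  then obtain k where k: "c = b + of_int k" by (auto simp: circ_e_eq_iff)
  have eq': "carc a l = carc c l" using eq carc_shift [of b k l] k by simp
  have "c = a"
  proof (rule ccontr)
    assume "c \<noteq> a"
    then have ac: "a < c" using c by simp
    have "circ_e c \<in> carc a l" unfolding eq' using l by auto
    then obtain u where "u \<in> {a..a+l}" "circ_e c = circ_e u" by blast
    then have "c \<le> a + l" using circ_e_inj [of a c u] c l by auto
    define t where "t = min (c + l) ((a + l + a + 1) / 2)"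
    have t: "a + l < t" "t < a + 1" "c \<le> t" "t \<le> c + l"
      using ac l \<open>c \<le> a + l\<close> by (auto simp: t_def min_def)
    then have "circ_e t \<in> carc a l" unfolding eq' by auto
    then obtain v where "v \<in> {a..a+l}" "circ_e t = circ_e v" by blast
    then have "t = v" using circ_e_inj [of a t v] t ac l by auto
    then show False using t \<open>v \<in> {a..a+l}\<close> by auto
  qed
  then show ?thesis using c by simp
qed

lemma finite_carcs_with_endpoints_in:
  assumes "finite P"
  shows "finite {carc c l | c l. 0 < l \<and> l < 1 \<and> circ_e c \<in> P \<and> circ_e (c + l) \<in> P}"
proof (rule finite_subset)
  let ?C = "{t \<in> {0..2}. circ_e t \<in> P}"
  show "finite ((\<lambda>(c, d). carc c (d - c)) ` (?C \<times> ?C))"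
    using finite_circ_e_vimage [OF assms] by blast
  show "{carc c l | c l. 0 < l \<and> l < 1 \<and> circ_e c \<in> P \<and> circ_e (c + l) \<in> P} \<subseteq> (\<lambda>(c, d). carc c (d - c)) ` (?C \<times> ?C)"
  proof
    fix Y assume "Y \<in> {carc c l | c l. 0 < l \<and> l < 1 \<and> circ_e c \<in> P \<and> circ_e (c + l) \<in> P}"
    then obtain c l where cl: "Y = carc c l" "0 < l" "l < 1" "circ_e c \<in> P" "circ_e (c + l) \<in> P" by blast
    define b where "b = frac c"
    have b: "c = b + of_int \<lfloor>c\<rfloor>" "0 \<le> b" "b < 1" by (auto simp: b_def frac_def frac_lt_1) linarith
    have eqs: "Y = carc b l" "circ_e b = circ_e c" "circ_e (b + l) = circ_e (c + l)"
      using carc_shift [of b "\<lfloor>c\<rfloor>" l] cl(1) b(1) by (simp_all add: circ_e_add b_def)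
    then have "(b, b + l) \<in> ?C \<times> ?C" using cl b by auto
    then show "Y \<in> (\<lambda>(c, d). carc c (d - c)) ` (?C \<times> ?C)"
      by (rule rev_image_eqI) (use eqs in auto)
  qed
qed

definition tight_arcs :: "(complex \<Rightarrow> complex) \<Rightarrow> complex set set" where
  "tight_arcs g = {K. \<exists>a l. K = carc a l \<and> 0 < l \<and> l < 1 \<and> leb (g ` K) \<le> l}"

context expanding_circle_map
begin

lemma free_neighbourhood:
  assumes "circ_e t \<notin> Z" obtains r where "0 < r" "circ_e ` {t-r<..<t+r} \<inter> Z = {}"
proof -
  have "closed Z" using finite_Z finite_imp_closed by blast
  then have "open (circ_e -` (- Z))"
    by (intro open_vimage continuous_circ_e continuous_on_id) (auto simp: open_Compl)
  then obtain r where r: "r > 0" "ball t r \<subseteq> circ_e -` (- Z)"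
    using assms by (meson ComplI open_contains_ball vimageI2)
  have "circ_e ` {t-r<..<t+r} \<inter> Z = {}" using r(2) by (auto simp: ball_eq_greaterThanLessThan)
  then show thesis using that r by blast
qed

text \<open>Near \<open>t\<close> the lift is monotone and expanding.\<close>

lemma lift_locally_onto:
  assumes "circ_e t \<notin> Z" "0 < r"
  obtains \<eta> where "0 < \<eta>" "{F t - \<eta><..<F t + \<eta>} \<subseteq> F ` {t-r<..<t+r}"
proof -
  obtain r0 where r0: "0 < r0" "circ_e ` {t-r0<..<t+r0} \<inter> Z = {}" using free_neighbourhood assms(1) by blast
  define q where "q = min r0 r / 2"
  define x y where "x = t - q" and "y = t + q"
  have q: "0 < q" "q < r" "q < r0" using r0 assms by (auto simp: q_def)
  have xy: "x < t" "t < y" by (auto simp: x_def y_def q)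
  have "{x<..<y} \<subseteq> {t-r0<..<t+r0}" using q by (auto simp: x_def y_def)
  then have free: "circ_e ` {x<..<y} \<inter> Z = {}" using r0(2) by blast
  have "x < y" using xy by simp
  have slope: "2 * (t - x) < \<bar>F t - F x\<bar>" "2 * (y - t) < \<bar>F y - F t\<bar>"
    using slope_piece [OF \<open>x < y\<close> free] xy by auto
  define \<eta> where "\<eta> = min \<bar>F t - F x\<bar> \<bar>F y - F t\<bar>"
  have "0 < \<eta>" using slope xy by (auto simp: \<eta>_def)
  have "connected (F ` {x..y})" by (intro connected_continuous_image lift_continuous) simp
  have "mono_or_antimono_on {x..y} F" using mono_piece \<open>x < y\<close> free by blast
  then have "{F t - \<eta><..<F t + \<eta>} \<subseteq> F ` {x..y}"
    unfolding mono_or_antimono_on_def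
  proof
    assume "mono_on {x..y} F"
    then have "F x \<le> F t" "F t \<le> F y" using xy by (auto simp: monotone_on_def)
    then have "{F t - \<eta><..<F t + \<eta>} \<subseteq> {F x..F y}" by (auto simp: \<eta>_def)
    also have "\<dots> \<subseteq> F ` {x..y}"
      using \<open>connected (F ` {x..y})\<close> xy by (intro connected_contains_Icc) auto
    finally show ?thesis .
  next
    assume "antimono_on {x..y} F"
    then have "F x \<ge> F t" "F t \<ge> F y" using xy by (auto simp: monotone_on_def)
    then have "{F t - \<eta><..<F t + \<eta>} \<subseteq> {F y..F x}" by (auto simp: \<eta>_def)
    also have "\<dots> \<subseteq> F ` {x..y}"
      using \<open>connected (F ` {x..y})\<close> xy by (intro connected_contains_Icc) auto
    finally show ?thesis .
  qed
  also have "\<dots> \<subseteq> F ` {t-r<..<t+r}" using q by (intro image_mono) (auto simp: x_def y_def)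
  finally show thesis using that \<open>0 < \<eta>\<close> by blast
qed

text \<open>
  The assumptions \<open>out\<close> and \<open>inn\<close> say that \<open>circ_e s\<close> is a boundary point of the image that is
  approached by open subsets of the image. If a preimage that is not a breakpoint were inside
  the arc, the image would be a neighbourhood of \<open>circ_e s\<close>. If it were outside, an open set
  near it would be mapped into the image, which tightness forbids.
\<close>

lemma boundary_preimages_of_tight_arc:
  assumes l: "0 < l" "l < 1" and tight: "leb (g ` carc a l) \<le> l"
    and out: "\<And>\<eta>. 0 < \<eta> \<Longrightarrow> \<not> circ_e ` {s-\<eta><..<s+\<eta>} \<subseteq> g ` carc a l"
    and inn: "\<And>\<eta>. 0 < \<eta> \<Longrightarrow> \<exists>u v. s - \<eta> < u \<and> u < v \<and> v < s + \<eta> \<and> circ_e ` {u<..<v} \<subseteq> g ` carc a l"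
    and t: "g (circ_e t) = circ_e s" "circ_e t \<notin> Z"
  shows "circ_e t = circ_e a \<or> circ_e t = circ_e (a + l)"
proof (rule ccontr)
  assume neq: "\<not> ?thesis"
  obtain t' where t': "a \<le> t'" "t' < a + 1" "circ_e t = circ_e t'"
    using circ_e_surj_from [of "circ_e t" a] by auto
  have "t' \<noteq> a" "t' \<noteq> a + l" using neq t' by auto
  have "circ_e (F t') = circ_e s" using t t' by (simp add: lift_eq)
  then obtain k where k: "s = F t' + of_int k" by (auto simp: circ_e_eq_iff)
  have nZ: "circ_e t' \<notin> Z" using t t' by simp
  have cover: "\<exists>x\<in>{t'-r<..<t'+r}. F x = w - of_int k"
    if "{F t' - \<eta><..<F t' + \<eta>} \<subseteq> F ` {t'-r<..<t'+r}" "w \<in> {s-\<eta><..<s+\<eta>}" for w \<eta> r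
  proof -
    have "w - of_int k \<in> {F t' - \<eta><..<F t' + \<eta>}" using that(2) k by auto
    then show ?thesis using that(1) by force
  qed
  have e_shift: "circ_e (w - of_int k) = circ_e w" for w using circ_e_add_int [of w "-k"] by simp
  show False
  proof (cases "t' < a + l")
    case True
    define r where "r = min (t' - a) (a + l - t')"
    have r: "0 < r" "{t'-r<..<t'+r} \<subseteq> {a..a + l}" using True t' \<open>t' \<noteq> a\<close> by (auto simp: r_def)
    obtain \<eta> where \<eta>: "0 < \<eta>" "{F t' - \<eta><..<F t' + \<eta>} \<subseteq> F ` {t'-r<..<t'+r}"
      using lift_locally_onto [OF nZ r(1)] by blast
    have "circ_e w \<in> g ` carc a l" if w: "w \<in> {s-\<eta><..<s+\<eta>}" for w
    proof -
      obtain x where x: "x \<in> {t'-r<..<t'+r}" "F x = w - of_int k" using cover [OF \<eta>(2) w] by blast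
      then have "circ_e w = g (circ_e x)" using e_shift lift_eq by metis
      then show ?thesis using x(1) r(2) by blast
    qed
    then show False using out [OF \<eta>(1)] by blast
  next
    case False
    define r where "r = min (t' - (a + l)) (a + 1 - t')"
    have r: "0 < r" "{t'-r<..<t'+r} \<subseteq> {a + l<..<a + 1}" using False t' \<open>t' \<noteq> a + l\<close> by (auto simp: r_def)
    obtain \<eta> where \<eta>: "0 < \<eta>" "{F t' - \<eta><..<F t' + \<eta>} \<subseteq> F ` {t'-r<..<t'+r}"
      using lift_locally_onto [OF nZ r(1)] by blast
    obtain u v where uv: "s - \<eta> < u" "u < v" "v < s + \<eta>" "circ_e ` {u<..<v} \<subseteq> g ` carc a l"
      using inn [OF \<eta>(1)] by blast
    define V where "V = {t'-r<..<t'+r} \<inter> F -` {u - of_int k<..<v - of_int k}"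
    have "open V" unfolding V_def by (intro open_Int open_vimage lift_continuous) auto
    obtain x where x: "x \<in> {t'-r<..<t'+r}" "F x = (u + v) / 2 - of_int k"
      using cover [OF \<eta>(2), of "(u + v) / 2"] uv by auto
    then have "x \<in> V" using uv by (auto simp: V_def)
    have "circ_e ` V = {}"
    proof (rule tight_open_disjoint [OF C_lambda _ _ _ openin_circ_e_image [OF \<open>open V\<close>]])
      show "compact (carc a l)" "carc a l \<subseteq> circ" by auto
      show "leb (g ` carc a l) \<le> leb (carc a l)" using tight l measure_arc [of a "a + l"] by simp
      have "circ_e p \<noteq> circ_e q" if "p \<in> V" "q \<in> {a..a + l}" for p q
      proof -
        have "p \<in> {a + l<..<a + 1}" using that(1) r(2) unfolding V_def by blast
        then show ?thesis using circ_e_inj [of a p q] that(2) l by auto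
      qed
      then show "circ_e ` V \<inter> carc a l = {}" unfolding disjoint_iff image_iff by metis
      have "g (circ_e p) \<in> g ` carc a l" if "p \<in> V" for p
      proof -
        have "F p + of_int k \<in> {u<..<v}" using that by (auto simp: V_def)
        then have "circ_e (F p + of_int k) \<in> g ` carc a l" using uv(4) by blast
        then show ?thesis by (simp add: lift_eq)
      qed
      then show "g ` circ_e ` V \<subseteq> g ` carc a l" by blast
    qed
    then show False using \<open>x \<in> V\<close> by blast
  qed
qed

text \<open>
  If \<open>circ_e s\<close> is not the image of a breakpoint, its preimages are among the two endpoints of
  the arc. A small arc \<open>W\<close> close to \<open>circ_e s\<close> then has all its preimages near these two points,
  which are not breakpoints. By the slope condition each of the two neighbourhoods contributes
  less than half of the measure of \<open>W\<close>, so that \<open>g\<close> would not preserve the measure.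
\<close>

lemma boundary_of_tight_image_critical:
  assumes l: "0 < l" "l < 1" and tight: "leb (g ` carc a l) \<le> l"
    and out: "\<And>\<eta>. 0 < \<eta> \<Longrightarrow> \<not> circ_e ` {s-\<eta><..<s+\<eta>} \<subseteq> g ` carc a l"
    and inn: "\<And>\<eta>. 0 < \<eta> \<Longrightarrow> \<exists>u v. s - \<eta> < u \<and> u < v \<and> v < s + \<eta> \<and> circ_e ` {u<..<v} \<subseteq> g ` carc a l"
  shows "circ_e s \<in> g ` Z"
proof (rule ccontr)
  assume crit: "circ_e s \<notin> g ` Z"
  obtain \<delta> where \<delta>: "0 < \<delta>" "\<And>s t. \<bar>s - t\<bar> \<le> \<delta> \<Longrightarrow> \<bar>F s - F t\<bar> < 1/2" using small_scale by metis
  define X where "X = {x \<in> {a, a + l}. g (circ_e x) = circ_e s}"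
  have "\<exists>r>0. x \<in> X \<longrightarrow> circ_e ` {x-r<..<x+r} \<inter> Z = {}" for x
  proof (cases "x \<in> X")
    case True
    then have "circ_e x \<notin> Z" using crit unfolding X_def by force
    then show ?thesis using free_neighbourhood by metis
  qed (auto intro: zero_less_one)
  then obtain R where R: "\<And>x. R x > 0" "\<And>x. x \<in> X \<Longrightarrow> circ_e ` {x - R x<..<x + R x} \<inter> Z = {}" by metis
  define r where "r = min (\<delta> / 2) (min (R a) (R (a + l)))"
  have r: "0 < r" "2 * r \<le> \<delta>" using R \<delta> by (auto simp: r_def)
  have free: "circ_e ` {x-r<..<x+r} \<inter> Z = {}" if "x \<in> X" for x
  proof -
    have "r \<le> R x" using that by (auto simp: r_def X_def)
    then have "{x-r<..<x+r} \<subseteq> {x - R x<..<x + R x}" by auto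
    then show ?thesis using R(2) [OF that] by blast
  qed
  define O' where "O' = (\<Union>x\<in>X. circ_e ` {x-r<..<x+r})"
  have "openin (top_of_set circ) O'" unfolding O'_def
    by (intro openin_Union) (auto intro: openin_circ_e_image)
  then have "closedin (top_of_set circ) (circ - O')" by (auto intro: closedin_diff)
  then have cpt: "compact (circ - O')" using closedin_compact compact_circ by blast
  have "circ_e s \<notin> g ` (circ - O')"
  proof
    assume "circ_e s \<in> g ` (circ - O')"
    then obtain z where z: "z \<in> circ" "z \<notin> O'" "g z = circ_e s" by force
    then obtain t where t: "z = circ_e t" using circ_e_surj by blast
    have "circ_e t \<notin> Z" using crit z(3) t by (metis imageI)
    then have "circ_e t = circ_e a \<or> circ_e t = circ_e (a + l)"
      using boundary_preimages_of_tight_arc [OF l tight out inn] z t by blast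
    then obtain x where "x \<in> {a, a + l}" "z = circ_e x" using t by blast
    then have x: "x \<in> X" "z = circ_e x" using z(3) unfolding X_def by auto
    have "x \<in> {x-r<..<x+r}" using r(1) by simp
    then have "z \<in> O'" unfolding O'_def x(2) using x(1) by blast
    then show False using z by simp
  qed
  moreover have ic: "compact (g ` (circ - O'))" "g ` (circ - O') \<subseteq> circ"
    by (intro image_compact [OF C_lambda] image_subset_circ [OF C_lambda] cpt Diff_subset)+
  moreover have "circ - g ` (circ - O') = circ \<inter> - g ` (circ - O')" by auto
  then have "openin (top_of_set circ) (circ - g ` (circ - O'))"
    using ic by (auto simp: openin_open compact_imp_closed intro!: exI [of _ "- g ` (circ - O')"])
  ultimately obtain t0 \<rho> where \<rho>: "0 < \<rho>" "\<rho> < 1/4" "circ_e ` {t0-\<rho>..t0+\<rho>} \<subseteq> circ - g ` (circ - O')"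
    using open_image_arc_contains [of "circ - g ` (circ - O')" "circ_e s"] by (metis DiffI circ_e_in_circ)
  define W where "W = carc (t0 - \<rho>) (2 * \<rho>)"
  have W: "W \<in> sets circ_leb" "leb W = 2 * \<rho>" using \<rho> by (auto simp: W_def measure_arc)
  have W': "W \<inter> g ` (circ - O') = {}"
  proof -
    have "W = circ_e ` {t0-\<rho>..t0+\<rho>}" by (simp add: W_def add.commute)
    then show ?thesis using \<rho>(3) by blast
  qed
  have "\<exists>S. S \<in> sets circ_leb \<and> leb S < \<rho> \<and> (x \<in> X \<longrightarrow> {z \<in> circ_e ` {x-r..x+r}. g z \<in> W} \<subseteq> S)" for x
  proof (cases "x \<in> X")
    case True
    obtain S where "S \<in> sets circ_leb" "{z \<in> circ_e ` {x-r..x+r}. g z \<in> carc (t0 - \<rho>) (2 * \<rho>)} \<subseteq> S" "leb S < 2 * \<rho> / 2"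
    proof (rule thin_preimage [of "x - r" "x + r" "2 * \<rho>" "t0 - \<rho>"])
      show "circ_e ` {x-r<..<x+r} \<inter> Z = {}" using free True by blast
      show "\<bar>F s - F u\<bar> < 1/2" if "s \<in> {x-r..x+r}" "u \<in> {x-r..x+r}" for s u
        using that r(2) by (intro \<delta>(2)) auto
    qed (use r \<rho> in auto)
    then show ?thesis by (auto simp: W_def)
  next
    case False then show ?thesis using \<rho> by (intro exI [of _ "{}"]) auto
  qed
  then obtain S where S: "\<And>x. S x \<in> sets circ_leb" "\<And>x. leb (S x) < \<rho>"
    "\<And>x. x \<in> X \<Longrightarrow> {z \<in> circ_e ` {x-r..x+r}. g z \<in> W} \<subseteq> S x" by metis
  have "g -` W \<inter> circ \<subseteq> S a \<union> S (a + l)"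
  proof
    fix z assume z: "z \<in> g -` W \<inter> circ"
    then have "z \<in> O'" using W' by blast
    then obtain x t where x: "x \<in> X" "t \<in> {x-r<..<x+r}" "z = circ_e t" by (auto simp: O'_def)
    then have "t \<in> {x-r..x+r}" by auto
    then have "z \<in> S x" using S(3) [OF x(1)] z x(3) by blast
    then show "z \<in> S a \<union> S (a + l)" using x(1) by (auto simp: X_def)
  qed
  then have "leb (g -` W \<inter> circ) \<le> leb (S a \<union> S (a + l))" using S by (intro leb_mono) auto
  also have "\<dots> \<le> leb (S a) + leb (S (a + l))" using S by (intro measure_Un_le)
  finally show False using C_lambda_preserves(2) [OF C_lambda W(1)] W S(2) [of a] S(2) [of "a + l"] by simp
qed

lemma tight_image_endpoints_critical:
  assumes l: "0 < l" "l < 1" and tight: "leb (g ` carc a l) \<le> l" and c: "g ` carc a l = carc c l"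
  shows "circ_e c \<in> g ` Z" "circ_e (c + l) \<in> g ` Z"
proof -
  have notin: "circ_e t \<notin> carc c l" if "c + l < t" "t < c + 1" for t
  proof
    assume "circ_e t \<in> carc c l"
    then obtain v where "v \<in> {c..c+l}" "circ_e t = circ_e v" by blast
    then show False using circ_e_inj [of c t v] that l by auto
  qed
  show "circ_e c \<in> g ` Z"
  proof (rule boundary_of_tight_image_critical [OF l tight])
    fix \<eta> :: real assume \<eta>: "0 < \<eta>"
    define \<theta> where "\<theta> = min \<eta> (1 - l) / 2"
    have \<theta>: "0 < \<theta>" "\<theta> < \<eta>" "\<theta> < 1 - l" using \<eta> l by (auto simp: \<theta>_def)
    have "circ_e (c - \<theta>) = circ_e (c - \<theta> + 1)" by simp
    then have "circ_e (c - \<theta>) \<notin> carc c l" using notin [of "c - \<theta> + 1"] \<theta> by simp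
    moreover have "c - \<theta> \<in> {c-\<eta><..<c+\<eta>}" using \<theta> by auto
    ultimately show "\<not> circ_e ` {c-\<eta><..<c+\<eta>} \<subseteq> g ` carc a l" unfolding c by blast
    have "circ_e ` {c<..<c + min \<eta> l / 2} \<subseteq> g ` carc a l" unfolding c by (intro image_mono) auto
    then show "\<exists>u v. c - \<eta> < u \<and> u < v \<and> v < c + \<eta> \<and> circ_e ` {u<..<v} \<subseteq> g ` carc a l"
      using \<eta> l by (intro exI [of _ c] exI [of _ "c + min \<eta> l / 2"]) auto
  qed
  show "circ_e (c + l) \<in> g ` Z"
  proof (rule boundary_of_tight_image_critical [OF l tight])
    fix \<eta> :: real assume \<eta>: "0 < \<eta>"
    define \<theta> where "\<theta> = min \<eta> (1 - l) / 2"
    have \<theta>: "0 < \<theta>" "\<theta> < \<eta>" "\<theta> < 1 - l" using \<eta> l by (auto simp: \<theta>_def)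
    then have "circ_e (c + l + \<theta>) \<notin> carc c l" using notin [of "c + l + \<theta>"] \<theta> by simp
    moreover have "c + l + \<theta> \<in> {c+l-\<eta><..<c+l+\<eta>}" using \<theta> by auto
    ultimately show "\<not> circ_e ` {c+l-\<eta><..<c+l+\<eta>} \<subseteq> g ` carc a l" unfolding c by blast
    have "circ_e ` {c + l - min \<eta> l / 2<..<c + l} \<subseteq> g ` carc a l" unfolding c using l by (intro image_mono) auto
    then show "\<exists>u v. c + l - \<eta> < u \<and> u < v \<and> v < c + l + \<eta> \<and> circ_e ` {u<..<v} \<subseteq> g ` carc a l"
      using \<eta> l by (intro exI [of _ "c + l - min \<eta> l / 2"] exI [of _ "c + l"]) auto
  qed
qed

lemma finite_tight_images: "finite ((`) g ` tight_arcs g)"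
proof (rule finite_subset [OF _ finite_carcs_with_endpoints_in])
  show "finite (g ` Z)" using finite_Z by blast
  show "(`) g ` tight_arcs g \<subseteq> {carc c l | c l. 0 < l \<and> l < 1 \<and> circ_e c \<in> g ` Z \<and> circ_e (c + l) \<in> g ` Z}"
  proof
    fix Y assume "Y \<in> (`) g ` tight_arcs g"
    then obtain a l where al: "Y = g ` carc a l" "0 < l" "l < 1" "leb (g ` carc a l) \<le> l"
      by (auto simp: tight_arcs_def)
    then obtain c where c: "g ` carc a l = carc c l"
      using tight_image_arc [OF C_lambda lift] by (metis less_imp_le)
    show "Y \<in> {carc c l | c l. 0 < l \<and> l < 1 \<and> circ_e c \<in> g ` Z \<and> circ_e (c + l) \<in> g ` Z}"
      using tight_image_endpoints_critical [OF al(2-4) c] al c by blast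
  qed
qed

text \<open>
  The part of the interior of one arc that lies outside the other is an open set that is mapped
  into the tight image.
\<close>

lemma tight_image_eq_imp_subset:
  assumes "0 < l" "l < 1" "0 < l'" "l' < 1" "leb (g ` carc b l') \<le> l'" "g ` carc a l = g ` carc b l'"
  shows "carc a l \<subseteq> carc b l'"
proof -
  have "openin (top_of_set circ) (circ_e ` {a<..<a + l})" by (simp add: openin_circ_e_image)
  moreover have "closedin (top_of_set circ) (carc b l')" by (intro closed_subset) auto
  ultimately have op: "openin (top_of_set circ) (circ_e ` {a<..<a + l} - carc b l')" by (rule openin_diff)
  have "circ_e ` {a<..<a + l} - carc b l' = {}"
  proof (rule tight_open_disjoint [OF C_lambda _ _ _ op])
    show "compact (carc b l')" "carc b l' \<subseteq> circ" by auto
    show "leb (g ` carc b l') \<le> leb (carc b l')" using assms by (simp add: measure_arc)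
    have "circ_e ` {a<..<a + l} \<subseteq> carc a l" by (intro image_mono) auto
    then show "g ` (circ_e ` {a<..<a + l} - carc b l') \<subseteq> g ` carc b l'" unfolding assms(6) [symmetric] by blast
  qed blast
  then have "circ_e ` {a<..<a + l} \<subseteq> carc b l'" by blast
  then have "circ_e ` closure {a<..<a + l} \<subseteq> carc b l'"
    by (intro image_closure_subset continuous_circ_e) auto
  then show ?thesis using assms by simp
qed

text \<open>There are finitely many images, and a tight arc is determined by its image.\<close>

lemma finite_tight_arcs: "finite (tight_arcs g)"
proof (rule finite_imageD [OF finite_tight_images])
  show "inj_on ((`) g) (tight_arcs g)"
  proof (rule inj_onI)
    fix K K' assume K: "K \<in> tight_arcs g" "K' \<in> tight_arcs g" "g ` K = g ` K'"
    obtain a l where al: "K = carc a l" "0 < l" "l < 1" "leb (g ` K) \<le> l"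
      using K(1) unfolding tight_arcs_def by blast
    obtain b l' where bl: "K' = carc b l'" "0 < l'" "l' < 1" "leb (g ` K') \<le> l'"
      using K(2) unfolding tight_arcs_def by blast
    show "K = K'"
    proof
      show "K \<subseteq> K'" unfolding al(1) bl(1)
        by (rule tight_image_eq_imp_subset) (use al bl K(3) in simp_all)
      show "K' \<subseteq> K" unfolding al(1) bl(1)
        by (rule tight_image_eq_imp_subset) (use al bl K(3) in simp_all)
    qed
  qed
qed

end

lemma rot_image_carc: "rot \<alpha> ` carc a l = carc (a + \<alpha>) l"
proof -
  have "rot \<alpha> ` carc a l = circ_e ` ((\<lambda>t. t + \<alpha>) ` {a..a + l})"
    by (simp only: image_image rot_circ_e)
  also have "(\<lambda>t. t + \<alpha>) ` {a..a + l} = {a + \<alpha>..a + \<alpha> + l}" by (simp add: add_ac)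
  finally show ?thesis .
qed

lemma rot_0 [simp]: "rot 0 = id" by (auto simp: rot_def fun_eq_iff)

text \<open>
  Let \<open>A\<close> be a periodic arc of \<open>rot \<alpha> \<circ> f\<close>. The measures along its orbit do not decrease and
  return to the initial value, so \<open>A\<close> and \<open>rot \<alpha> ` f ` A\<close> are both tight for \<open>f\<close>. There are
  finitely many such pairs of arcs, and \<open>\<alpha>\<close> is determined by the pair, because a rotation that
  fixes an arc shorter than the circle is trivial.
\<close>

lemma finite_E1:
  assumes "expanding_circle_map f F Z" shows "finite (E1 f)"
proof -
  interpret expanding_circle_map f F Z by fact
  \<comment> \<open>The parameters whose rotation takes the image \<open>Y\<close> of a tight arc to \<open>X\<close>.\<close>
  define At where "At = (\<lambda>(Y, X). {\<alpha> \<in> {0..<1}. Y \<in> (`) f ` tight_arcs f \<and> rot \<alpha> ` Y = X})"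
  have fin: "finite (At p)" for p
  proof -
    obtain Y X where p: "p = (Y, X)" by force
    have "\<alpha> = \<beta>" if a: "\<alpha> \<in> At p" and b: "\<beta> \<in> At p" for \<alpha> \<beta>
    proof -
      obtain a l where al: "Y = f ` carc a l" "0 < l" "l < 1" "leb (f ` carc a l) \<le> l"
        using a unfolding At_def p tight_arcs_def by blast
      then obtain c where c: "Y = carc c l"
        using tight_image_arc [OF C_lambda lift] by (metis less_imp_le)
      have "carc (c + \<alpha>) l = carc (c + \<beta>) l"
        using a b by (auto simp: At_def p c rot_image_carc)
      then have "circ_e (c + \<alpha>) = circ_e (c + \<beta>)" using carc_eq_imp_start_eq al by blast
      then have "circ_e \<alpha> = circ_e \<beta>" by (simp add: circ_e_add)
      then show ?thesis using a b circ_e_inj [of 0 \<alpha> \<beta>] by (auto simp: At_def p)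
    qed
    then have "At p \<subseteq> {\<alpha>} \<or> At p = {}" if "\<alpha> \<in> At p" for \<alpha> using that by blast
    then show ?thesis by (metis ex_in_conv finite.emptyI finite.insertI finite_subset)
  qed
  have "E1 f \<subseteq> (\<Union>p\<in>(`) f ` tight_arcs f \<times> tight_arcs f. At p)"
  proof
    fix \<alpha> assume "\<alpha> \<in> E1 f"
    then obtain A n where \<alpha>: "\<alpha> \<in> {0..<1}" and A: "periodic_arc (T \<alpha> 0 f) A n"
      by (auto simp: E1_def has_periodic_arc_def)
    define h where "h = T \<alpha> 0 f"
    interpret h: expanding_circle_map h "\<lambda>t. F (t + 0) + \<alpha>" "rot 0 -` Z"
      unfolding h_def by (rule expanding_circle_map_T) fact
    have h_eq: "h ` X = rot \<alpha> ` f ` X" for X by (simp add: h_def T_def image_comp)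
    obtain a l where al: "A = carc a l" "0 < l" "l < 1"
    proof -
      obtain a b where "a < b" "b < a + 1" "A = circ_e ` {a..b}"
        using A by (auto simp: periodic_arc_def is_arc_iff_param arc_param_def)
      then show thesis using that [of a "b - a"] by auto
    qed
    have n: "n \<ge> 1" "(h ^^ n) ` A = A" using A by (auto simp: periodic_arc_def h_def)
    have it: "\<exists>a' l'. l \<le> l' \<and> l' \<le> 1 \<and> (h ^^ m) ` A = carc a' l'" for m
    proof -
      obtain a' l' where "l \<le> l'" "l' \<le> 1" "(h ^^ m) ` carc a l = carc a' l'"
        by (rule image_arc [OF h.funpow_C_lambda h.funpow_lift, of l m a]) (use al in auto)
      then show ?thesis using al by auto
    qed
    then have cpt: "compact ((h ^^ m) ` A)" "(h ^^ m) ` A \<subseteq> circ" for m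
      by (metis arc_compact carc_subset_circ)+
    have step: "leb ((h ^^ m) ` A) \<le> leb ((h ^^ (m + k)) ` A)" for m k
      using leb_image_ge [OF h.funpow_C_lambda [of k] cpt(1) [of m] cpt(2) [of m]]
      by (simp add: add.commute flip: h.funpow_image)
    have "leb A = l" using al by (simp add: measure_arc)
    \<comment> \<open>After the first image, \<open>n - 1\<close> further steps lead back to \<open>A\<close>.\<close>
    have l1: "leb (h ` A) \<le> l"
      using step [of 1 "n - 1"] n \<open>leb A = l\<close> by simp
    have "(h ^^ (1 + n)) ` A = h ` A"
      unfolding h.funpow_image [of 1 n A] n(2) by simp
    moreover have "2 + (n - 1) = 1 + n" using n by simp
    ultimately have "leb ((h ^^ (1 + 1)) ` A) \<le> leb (h ` A)"
      using step [of 2 "n - 1"] by (metis one_add_one)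
    then have l2: "leb (h ` h ` A) \<le> l"
      using l1 unfolding h.funpow_image by simp
    have tf: "leb (f ` X) = leb (h ` X)" if "compact X" "X \<subseteq> circ" for X
    proof -
      have "rot \<alpha> -` (rot \<alpha> ` f ` X) \<inter> circ = f ` X"
        using image_subset_circ [OF C_lambda that(2)] by (auto simp: rot_def)
      moreover have "h ` X \<in> sets circ_leb" using image_sets [OF h.C_lambda that] .
      ultimately show ?thesis using emeasure_rot [of "h ` X" \<alpha>] by (simp add: h_eq measure_def)
    qed
    obtain b where b: "h ` A = carc b l"
      using tight_image_arc [OF h.C_lambda h.lift al(2)] al l1 by (metis less_imp_le)
    have tf': "leb (f ` carc x l) = leb (h ` carc x l)" for x
      by (rule tf [OF arc_compact carc_subset_circ])
    have "A \<in> tight_arcs f"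
      unfolding tight_arcs_def
      by (rule CollectI, rule exI [of _ a], rule exI [of _ l]) (use al l1 tf' [of a] in simp)
    moreover have "h ` A \<in> tight_arcs f"
      unfolding tight_arcs_def
      by (rule CollectI, rule exI [of _ b], rule exI [of _ l]) (use al(2,3) l2 tf' [of b] b in simp)
    ultimately show "\<alpha> \<in> (\<Union>p\<in>(`) f ` tight_arcs f \<times> tight_arcs f. At p)"
      using \<alpha> by (intro UN_I [of "(f ` A, h ` A)"]) (auto simp: At_def h_eq)
  qed
  moreover have "finite (\<Union>p\<in>(`) f ` tight_arcs f \<times> tight_arcs f. At p)"
    using finite_tight_images finite_tight_arcs fin by blast
  ultimately show ?thesis by (rule finite_subset)
qed

section \<open>Approximation by grid cells\<close>

text \<open>
  Defined through the floor, half-open cells of a grid are disjoint and fill the line without a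
  discussion of their endpoints.
\<close>

definition cells :: "nat \<Rightarrow> int set \<Rightarrow> real set" where
  "cells L J = {t. \<lfloor>real L * t\<rfloor> \<in> J}"

lemma cells_singleton: assumes "0 < L" shows "cells L {j} = {of_int j / L..<(of_int j + 1) / L}"
  using assms by (auto simp: cells_def floor_eq_iff field_simps)

lemma cells_UN: "cells L J = (\<Union>j\<in>J. cells L {j})"
  by (auto simp: cells_def)

lemma cells_borel [measurable, simp]: "0 < L \<Longrightarrow> cells L J \<in> sets borel"
proof -
  assume "0 < L"
  then have "cells L {j} \<in> sets borel" for j by (simp add: cells_singleton)
  moreover have "countable J" by simp
  ultimately show ?thesis by (subst cells_UN) (intro sets.countable_UN', auto)
qed

lemma emeasure_cells: assumes "0 < L" "finite J" shows "emeasure lborel (cells L J) = ennreal (card J / L)"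
proof -
  have "emeasure lborel (\<Union>j\<in>J. cells L {j}) = (\<Sum>j\<in>J. emeasure lborel (cells L {j}))"
    using assms by (intro sum_emeasure [symmetric]) (auto simp: disjoint_family_on_def cells_def)
  also have "\<dots> = (\<Sum>j\<in>J. ennreal (1 / L))"
  proof (rule sum.cong)
    fix j assume "j \<in> J"
    have "(of_int j + 1) / real L - of_int j / real L = 1 / L" by (simp add: diff_divide_distrib [symmetric])
    then show "emeasure lborel (cells L {j}) = ennreal (1 / L)"
      using assms by (simp add: cells_singleton divide_right_mono)
  qed simp
  also have "\<dots> = ennreal (\<Sum>j\<in>J. 1 / L)" by (rule sum_ennreal) simp
  also have "\<dots> = ennreal (card J / L)" by simp
  finally show ?thesis using cells_UN [of L J] by simp
qed

lemma measure_cells: "0 < L \<Longrightarrow> finite J \<Longrightarrow> measure lborel (cells L J) = card J / L"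
  by (simp add: measure_def emeasure_cells)

lemma finite_cells_meeting: assumes "compact K" shows "finite ((\<lambda>s. \<lfloor>real L * s\<rfloor>) ` K)"
proof -
  obtain b where b: "\<And>s. s \<in> K \<Longrightarrow> \<bar>s\<bar> \<le> b" using compact_imp_bounded [OF assms] unfolding bounded_real by blast
  have "\<lfloor>real L * s\<rfloor> \<in> {\<lfloor>- (real L * b)\<rfloor>..\<lfloor>real L * b\<rfloor>}" if "s \<in> K" for s
  proof -
    have "\<bar>real L * s\<bar> \<le> real L * b"
      unfolding abs_mult using b [OF that] by (simp add: mult_left_mono)
    then have "- (real L * b) \<le> real L * s" "real L * s \<le> real L * b" by linarith+
    then show ?thesis by (auto intro: floor_mono)
  qed
  then show ?thesis by (intro finite_subset [OF _ finite_atLeastAtMost_int]) blast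
qed

text \<open>
  Once the cells are shorter than the distance of \<open>K\<close> to the complement of an open set \<open>U\<close>
  around \<open>K\<close>, those that meet \<open>K\<close> lie in \<open>U\<close>, and \<open>U\<close> can be chosen of nearly the same measure
  as \<open>K\<close>.
\<close>

lemma cells_meeting_compact:
  assumes "compact K" "0 < \<epsilon>"
  obtains L where "0 < L" "measure lborel (cells L ((\<lambda>s. \<lfloor>real L * s\<rfloor>) ` K)) \<le> measure lborel K + \<epsilon>"
proof -
  have Kb: "K \<in> sets borel" using assms by (simp add: borel_compact)
  then have "K \<in> sets lebesgue" by simp
  then obtain U where U: "open U" "K \<subseteq> U" "U - K \<in> lmeasurable" "emeasure lebesgue (U - K) < ennreal \<epsilon>"
    using sets_lebesgue_outer_open assms(2) by blast
  obtain e where e: "e > 0" "(\<Union>x\<in>K. ball x e) \<subseteq> U"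
    using compact_subset_open_imp_ball_epsilon_subset assms(1) U by blast
  obtain n where n: "1 / real (Suc n) < e" using nat_approx_posE e(1) by blast
  define L where "L = Suc n"
  define J where "J = (\<lambda>s. \<lfloor>real L * s\<rfloor>) ` K"
  have sub: "cells L J \<subseteq> U"
  proof
    fix t assume "t \<in> cells L J"
    then obtain s where s: "s \<in> K" "\<lfloor>real L * t\<rfloor> = \<lfloor>real L * s\<rfloor>" by (auto simp: cells_def J_def)
    then have "\<bar>real L * t - real L * s\<bar> < 1" by linarith
    then have "real L * \<bar>t - s\<bar> < 1" by (simp add: abs_mult flip: right_diff_distrib)
    then have "\<bar>t - s\<bar> < 1 / L" by (simp add: L_def field_simps)
    then have "t \<in> ball s e" using n by (simp add: L_def dist_real_def abs_minus_commute)
    then show "t \<in> U" using e(2) s(1) by blast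
  qed
  have fK: "emeasure lborel K < \<infinity>" using emeasure_compact_finite [OF assms(1)] by (simp add: top.not_eq_extremum)
  have "emeasure lborel U = emeasure lborel (K \<union> (U - K))" using U(2) by (simp add: Un_absorb1)
  also have "\<dots> = emeasure lborel K + emeasure lborel (U - K)"
    using Kb U(1) by (intro plus_emeasure [symmetric]) auto
  also have "\<dots> \<le> ennreal (measure lborel K) + ennreal \<epsilon>"
  proof (intro add_mono)
    show "emeasure lborel K \<le> ennreal (measure lborel K)"
      using fK by (simp add: emeasure_eq_ennreal_measure)
    show "emeasure lborel (U - K) \<le> ennreal \<epsilon>"
      using U Kb by (simp add: less_imp_le)
  qed
  also have "\<dots> = ennreal (measure lborel K + \<epsilon>)" using assms(2) by (simp add: ennreal_plus)
  finally have leU: "emeasure lborel U \<le> ennreal (measure lborel K + \<epsilon>)" .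
  have "emeasure lborel (cells L J) \<le> emeasure lborel U"
    using sub U(1) by (intro emeasure_mono) auto
  also note leU
  finally have "emeasure lborel (cells L J) \<le> ennreal (measure lborel K + \<epsilon>)" .
  then have "measure lborel (cells L J) \<le> measure lborel K + \<epsilon>"
    using assms(2) by (simp add: measure_def enn2real_leI)
  then show thesis using that [of L] by (simp add: L_def J_def)
qed

lemma compact_inner_approx:
  assumes B: "B \<in> sets borel" "B \<subseteq> {a..b::real}" and "0 < \<epsilon>"
  obtains K where "compact K" "K \<subseteq> B" "measure lborel (B - K) \<le> \<epsilon>"
proof -
  have "B \<in> sets lebesgue" using B by simp
  then obtain K where K: "closed K" "K \<subseteq> B" "B - K \<in> lmeasurable" "emeasure lebesgue (B - K) < ennreal \<epsilon>"
    using sets_lebesgue_inner_closed assms(3) by blast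
  have "compact K" using K B(2) by (meson bounded_closed_interval bounded_subset compact_eq_bounded_closed dual_order.trans)
  moreover have "measure lborel (B - K) \<le> \<epsilon>"
    using K B assms(3) by (simp add: measure_def enn2real_leI less_imp_le)
  ultimately show thesis using that K by blast
qed

lemma emeasure_subset_Icc_finite: "X \<subseteq> {a..b::real} \<Longrightarrow> emeasure lborel X < \<infinity>"
  by (meson bounded_closed_interval bounded_subset emeasure_bounded_finite)

lemma measure_mono_Icc: "X \<subseteq> Y \<Longrightarrow> X \<in> sets borel \<Longrightarrow> Y \<in> sets borel \<Longrightarrow> Y \<subseteq> {a..b::real} \<Longrightarrow> measure lborel X \<le> measure lborel Y"
  using emeasure_subset_Icc_finite [of Y a b] by (intro measure_mono_fmeasurable) (auto simp: fmeasurable_def)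

lemma measure_Un_Icc:
  assumes "X \<in> sets borel" "Y \<in> sets borel" "X \<subseteq> {a..b::real}" "Y \<subseteq> {a..b}" "X \<inter> Y = {}"
  shows "measure lborel (X \<union> Y) = measure lborel X + measure lborel Y"
  using assms emeasure_subset_Icc_finite [of X a b] emeasure_subset_Icc_finite [of Y a b]
  by (intro measure_Union) (auto simp: less_top)

lemma measure_Un_le_borel: "X \<in> sets borel \<Longrightarrow> Y \<in> sets borel \<Longrightarrow> measure lborel (X \<union> Y) \<le> measure lborel X + measure lborel (Y::real set)"
  by (intro measure_Un_le) auto

lemma cells_approx:
  assumes B: "B \<in> sets borel" "B \<subseteq> {0..<1::real}" and "0 < \<epsilon>"
  obtains L J where "0 < L" "finite J" "J \<subseteq> {0..<int L}" "measure lborel (B - cells L J) \<le> \<epsilon>" "measure lborel (cells L J - B) \<le> \<epsilon>"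
    "cells L J \<subseteq> {0..<1}"
proof -
  have "B \<subseteq> {0..1}" using B by auto
  then obtain K where K: "compact K" "K \<subseteq> B" "measure lborel (B - K) \<le> \<epsilon>"
    using compact_inner_approx [OF B(1)] assms(3) by blast
  obtain L where L: "0 < L" "measure lborel (cells L ((\<lambda>s. \<lfloor>real L * s\<rfloor>) ` K)) \<le> measure lborel K + \<epsilon>"
    using cells_meeting_compact [OF K(1) assms(3)] by blast
  define J where "J = (\<lambda>s. \<lfloor>real L * s\<rfloor>) ` K"
  have finJ: "finite J" using finite_cells_meeting K(1) by (simp add: J_def)
  have Kb: "K \<in> sets borel" using K(1) by (simp add: borel_compact)
  have KJ: "K \<subseteq> cells L J" by (auto simp: cells_def J_def)
  have J: "J \<subseteq> {0..<int L}"
  proof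
    fix j assume "j \<in> J"
    then obtain s where s: "s \<in> K" "j = \<lfloor>real L * s\<rfloor>" by (auto simp: J_def)
    then have "s \<in> {0..<1}" using K(2) B(2) by blast
    then have "0 \<le> s" "s < 1" by auto
    then show "j \<in> {0..<int L}" using L(1) s(2) by (simp add: floor_less_iff)
  qed
  have sub: "cells L J \<subseteq> {0..<1}"
  proof
    fix t assume "t \<in> cells L J"
    then have "0 \<le> \<lfloor>real L * t\<rfloor>" "\<lfloor>real L * t\<rfloor> < int L" using J by (auto simp: cells_def)
    then have "0 \<le> real L * t" "real L * t < real L * 1" by (simp_all add: floor_less_iff)
    then show "t \<in> {0..<1}" using L(1) by (simp add: zero_le_mult_iff)
  qed
  have "measure lborel (cells L J - B) \<le> measure lborel (cells L J - K)"
    using K(2) sub L(1) B(1) Kb by (intro measure_mono_Icc [of _ _ 0 1]) auto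
  also have "\<dots> = measure lborel (cells L J) - measure lborel K"
  proof -
    have "measure lborel (K \<union> (cells L J - K)) = measure lborel K + measure lborel (cells L J - K)"
      using sub KJ L(1) Kb by (intro measure_Un_Icc [of _ _ 0 1]) auto
    moreover have "K \<union> (cells L J - K) = cells L J" using KJ by blast
    ultimately show ?thesis by simp
  qed
  also have "\<dots> \<le> \<epsilon>" using L(2) by (simp add: J_def)
  finally have 1: "measure lborel (cells L J - B) \<le> \<epsilon>" .
  have "measure lborel (B - cells L J) \<le> measure lborel (B - K)"
    using KJ L(1) B Kb by (intro measure_mono_Icc [of _ _ 0 1]) auto
  also note K(3)
  finally show thesis by (rule that [OF L(1) finJ J _ 1 sub])
qed

text \<open>
  The image of the part of \<open>K\<close> in a cell of length \<open>1 / L\<close> lies within distance \<open>C / L\<close> of one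
  of its points. The interval with that centre has twice the length of the cell times \<open>C\<close>, which
  accounts for the factor \<open>2\<close>.
\<close>

lemma measure_lipschitz_image_le:
  fixes f :: "real \<Rightarrow> real"
  assumes "compact K" "C-lipschitz_on K f"
  shows "measure lborel (f ` K) \<le> 2 * C * measure lborel (K :: real set)"
proof (rule field_le_epsilon)
  fix e :: real assume "0 < e"
  have "0 \<le> C" using assms(2) by (rule lipschitz_on_nonneg)
  define \<epsilon> where "\<epsilon> = e / (2 * C + 1)"
  have \<epsilon>: "0 < \<epsilon>" "2 * C * \<epsilon> \<le> e" using \<open>0 < e\<close> \<open>0 \<le> C\<close> by (auto simp: \<epsilon>_def field_simps)
  obtain L where L: "0 < L" "measure lborel (cells L ((\<lambda>s. \<lfloor>real L * s\<rfloor>) ` K)) \<le> measure lborel K + \<epsilon>"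
    using cells_meeting_compact [OF assms(1) \<epsilon>(1)] by blast
  define J where "J = (\<lambda>s. \<lfloor>real L * s\<rfloor>) ` K"
  have finJ: "finite J" using finite_cells_meeting assms(1) by (simp add: J_def)
  have "\<exists>s\<in>K. \<lfloor>real L * s\<rfloor> = j" if "j \<in> J" for j using that by (auto simp: J_def)
  then obtain s where s: "\<And>j. j \<in> J \<Longrightarrow> s j \<in> K \<and> \<lfloor>real L * s j\<rfloor> = j" by metis
  have "f ` K \<subseteq> (\<Union>j\<in>J. {f (s j) - C / L .. f (s j) + C / L})"
  proof
    fix y assume "y \<in> f ` K"
    then obtain t where t: "t \<in> K" "y = f t" by auto
    define j where "j = \<lfloor>real L * t\<rfloor>"
    have j: "j \<in> J" using t by (auto simp: J_def j_def)
    have "\<lfloor>real L * t\<rfloor> = \<lfloor>real L * s j\<rfloor>" using s [OF j] by (simp add: j_def)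
    then have "\<bar>real L * t - real L * s j\<bar> < 1" by linarith
    then have "real L * \<bar>t - s j\<bar> < 1" by (simp add: abs_mult flip: right_diff_distrib)
    then have "\<bar>t - s j\<bar> \<le> 1 / L" using L(1) by (simp add: field_simps)
    then have "C * \<bar>t - s j\<bar> \<le> C * (1 / L)" using \<open>0 \<le> C\<close> by (rule mult_left_mono)
    moreover have "dist (f t) (f (s j)) \<le> C * dist t (s j)"
      using assms(2) t(1) s [OF j] by (intro lipschitz_onD) auto
    ultimately have "\<bar>f t - f (s j)\<bar> \<le> C / L" by (simp add: dist_real_def)
    then show "y \<in> (\<Union>j\<in>J. {f (s j) - C / L .. f (s j) + C / L})" using j t(2) by (auto simp: abs_le_iff intro!: bexI [of _ j])
  qed
  moreover have "compact (f ` K)"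
    using assms by (intro compact_continuous_image lipschitz_on_continuous_on)
  moreover have "compact (\<Union>j\<in>J. {f (s j) - C / L .. f (s j) + C / L})" using finJ by (intro compact_UN) auto
  ultimately have "measure lborel (f ` K) \<le> measure lborel (\<Union>j\<in>J. {f (s j) - C / L .. f (s j) + C / L})"
    by (intro measure_mono_fmeasurable fmeasurable_compact) (auto simp: borel_compact)
  also have "\<dots> \<le> (\<Sum>j\<in>J. measure lborel {f (s j) - C / L .. f (s j) + C / L})"
    using finJ by (intro measure_UNION_le) auto
  also have "\<dots> = (\<Sum>j\<in>J. 2 * (C / L))"
    using \<open>0 \<le> C\<close> L(1) by (intro sum.cong) auto
  also have "\<dots> = 2 * C * (card J / L)" by simp
  also have "\<dots> \<le> 2 * C * (measure lborel K + \<epsilon>)"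
    using L(2) measure_cells [OF L(1) finJ] \<open>0 \<le> C\<close> by (intro mult_left_mono) (auto simp: J_def)
  also have "\<dots> \<le> 2 * C * measure lborel K + e" using \<epsilon>(2) by (simp add: distrib_left)
  finally show "measure lborel (f ` K) \<le> 2 * C * measure lborel K + e" .
qed

section \<open>Sets of bounded weak variation\<close>

lemma sum_eq_single:
  fixes f :: "'a \<Rightarrow> real"
  assumes "finite A" "a \<in> A" "\<And>i. i \<in> A \<Longrightarrow> i \<noteq> a \<Longrightarrow> f i = 0" shows "sum f A = f a"
proof -
  have "sum f (A - {a}) = 0" by (rule sum.neutral) (use assms(3) in auto)
  then show ?thesis using sum.remove [OF assms(1,2), of f] by simp
qed

definition unit_leb :: "real measure" where
  "unit_leb = restrict_space lborel {0..<1}"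

lemma space_unit_leb [simp]: "space unit_leb = {0..<1}"
  by (simp add: unit_leb_def space_restrict_space)

lemma sets_unit_leb: "A \<in> sets unit_leb \<longleftrightarrow> A \<in> sets borel \<and> A \<subseteq> {0..<1}"
  by (auto simp: unit_leb_def sets_restrict_space_iff)

lemma emeasure_unit_leb: "A \<subseteq> {0..<1} \<Longrightarrow> emeasure unit_leb A = emeasure lborel A"
  unfolding unit_leb_def by (intro emeasure_restrict_space) auto

lemma measure_unit_leb: "A \<subseteq> {0..<1} \<Longrightarrow> measure unit_leb A = measure lborel A"
  by (simp add: measure_def emeasure_unit_leb)

interpretation unit_leb: finite_measure unit_leb
  by standard (simp add: emeasure_unit_leb)

lemma measurable_unit_leb: "f \<in> borel_measurable borel \<Longrightarrow> f \<in> borel_measurable unit_leb"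
  unfolding unit_leb_def by (intro measurable_restrict_space1) simp

lemma integrable_unit_leb:
  fixes f :: "real \<Rightarrow> real"
  assumes "f \<in> borel_measurable unit_leb" "\<And>x. x \<in> {0..<1} \<Longrightarrow> \<bar>f x\<bar> \<le> m"
  shows "integrable unit_leb f"
  by (rule unit_leb.integrable_const_bound [of _ m]) (use assms in auto)

lemma integral_indicator_unit_leb:
  "X \<in> sets borel \<Longrightarrow> X \<subseteq> {0..<1} \<Longrightarrow> (\<integral>x. indicator X x \<partial>unit_leb) = measure lborel X"
  using measure_unit_leb [of X] by (simp add: sets_unit_leb Int_absorb2)

text \<open>
  The supremum of the integrals of \<open>\<eta>\<close> over a set \<open>B\<close>, taken over all test functions with
  \<open>b = 1\<close>, is the variation of the indicator of \<open>B\<close> on the open unit interval. Working with this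
  pairing replaces functions of bounded variation and transfer operators. The exceptional finite
  set of points makes room for compositions with piecewise smooth maps.
\<close>

definition test_fun :: "real \<Rightarrow> (real \<Rightarrow> real) \<Rightarrow> (real \<Rightarrow> real) \<Rightarrow> bool" where
  "test_fun b \<psi> \<eta> \<longleftrightarrow> continuous_on {0..1} \<psi> \<and> \<psi> 0 = 0 \<and> \<psi> 1 = 0 \<and> (\<forall>t\<in>{0..1}. \<bar>\<psi> t\<bar> \<le> b) \<and>
     (\<exists>S. finite S \<and> (\<forall>t\<in>{0<..<1} - S. (\<psi> has_real_derivative \<eta> t) (at t))) \<and>
     \<eta> \<in> borel_measurable borel \<and> (\<exists>B. \<forall>t. \<bar>\<eta> t\<bar> \<le> B)"

lemma test_fun_nonneg: "test_fun b \<psi> \<eta> \<Longrightarrow> 0 \<le> b"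
  unfolding test_fun_def by (metis abs_zero atLeastAtMost_iff order_refl zero_le_one)

lemma integral_derivative_interval:
  assumes \<psi>: "test_fun b \<psi> \<eta>" and pq: "0 \<le> p" "p \<le> q" "q \<le> 1"
  shows "(\<integral>x. indicator {p..<q} x * \<eta> x \<partial>unit_leb) = \<psi> q - \<psi> p"
proof -
  obtain B where B: "\<And>t. \<bar>\<eta> t\<bar> \<le> B" and [measurable]: "\<eta> \<in> borel_measurable borel"
    using \<psi> by (auto simp: test_fun_def)
  have int: "integrable lborel (\<lambda>x. indicator {p..q} x *\<^sub>R \<eta> x)"
    by (rule integrableI_bounded_set_indicator [of _ _ _ B]) (use B in \<open>auto simp: emeasure_lborel_Icc_eq\<close>)
  obtain S where S: "finite S" "\<And>t. t \<in> {0<..<1} - S \<Longrightarrow> (\<psi> has_real_derivative \<eta> t) (at t)"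
    using \<psi> by (auto simp: test_fun_def)
  have "(\<eta> has_integral (\<psi> q - \<psi> p)) {p..q}"
  proof (rule fundamental_theorem_of_calculus_interior_strong [OF S(1) pq(2)])
    show "continuous_on {p..q} \<psi>" using \<psi> pq by (auto simp: test_fun_def intro: continuous_on_subset)
    show "(\<psi> has_vector_derivative \<eta> x) (at x)" if "x \<in> {p<..<q} - S" for x
      using S(2) [of x] that pq by (simp add: has_real_derivative_iff_has_vector_derivative)
  qed
  moreover have "(\<integral>x. indicator {p..q} x *\<^sub>R \<eta> x \<partial>lborel) = integral {p..q} \<eta>"
    using set_borel_integral_eq_integral(2) [of "{p..q}" \<eta>] int by (simp add: set_integrable_def set_lebesgue_integral_def)
  ultimately have "(\<integral>x. indicator {p..q} x *\<^sub>R \<eta> x \<partial>lborel) = \<psi> q - \<psi> p"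
    by (simp add: integral_unique)
  moreover have "(\<integral>x. indicator {p..<q} x * \<eta> x \<partial>unit_leb) = (\<integral>x. indicator {0..<1} x *\<^sub>R (indicator {p..<q} x * \<eta> x) \<partial>lborel)"
    unfolding unit_leb_def by (intro integral_restrict_space) auto
  moreover have "\<dots> = (\<integral>x. indicator {p..q} x *\<^sub>R \<eta> x \<partial>lborel)"
  proof (rule integral_cong_AE)
    have "AE x in lborel. x \<noteq> q" by (rule AE_lborel_singleton)
    then show "AE x in lborel. indicator {0..<1} x *\<^sub>R (indicator {p..<q} x * \<eta> x) = indicator {p..q} x *\<^sub>R \<eta> x"
      by (rule AE_mp) (use pq in \<open>auto intro!: AE_I2 simp: indicator_def\<close>)
  qed auto
  ultimately show ?thesis by simp
qed

text \<open>Near \<open>t\<close> the set is either full or empty, so its distribution function is affine there.\<close>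

lemma has_derivative_measure_lessThan:
  assumes X: "X \<in> sets borel" "X \<subseteq> {0..1::real}" and "0 < e"
    and loc: "\<And>s. \<bar>s - t\<bar> < e \<Longrightarrow> s \<in> X \<longleftrightarrow> t \<in> X"
  shows "((\<lambda>t. measure lborel (X \<inter> {..<t})) has_real_derivative indicator X t) (at t)"
proof -
  define m where "m = (\<lambda>t. measure lborel (X \<inter> {..<t}))"
  have diff: "m v - m u = indicator X t * (v - u)" if uv: "u \<le> v" "\<bar>u - t\<bar> < e" "\<bar>v - t\<bar> < e" for u v
  proof -
    have "X \<inter> {..<v} = (X \<inter> {..<u}) \<union> (X \<inter> {u..<v})" using uv by auto
    then have "m v = m u + measure lborel (X \<inter> {u..<v})"
      unfolding m_def using X by (simp add: measure_Un_Icc [of _ _ 0 1] )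
        (subst measure_Un_Icc [of _ _ 0 1]; auto)
    moreover have "X \<inter> {u..<v} = (if t \<in> X then {u..<v} else {})"
    proof -
      have "s \<in> X \<longleftrightarrow> t \<in> X" if "s \<in> {u..<v}" for s using that uv by (intro loc) auto
      then show ?thesis by auto
    qed
    ultimately show ?thesis using uv by simp
  qed
  have eq: "m t + indicator X t * (s - t) = m s" if "s \<in> ball t e" for s
    using diff [of t s] diff [of s t] that \<open>0 < e\<close> by (cases "t \<le> s") (auto simp: dist_real_def algebra_simps)
  have der: "((\<lambda>s. m t + indicator X t * (s - t)) has_real_derivative indicator X t) (at t)"
    by (auto intro!: derivative_eq_intros)
  have "(m has_real_derivative indicator X t) (at t)"
    by (rule has_field_derivative_transform_within_open [OF der open_ball _ eq])
      (use \<open>0 < e\<close> in simp_all)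
  then show ?thesis by (simp add: m_def)
qed

lemma continuous_measure_lessThan:
  assumes X: "X \<in> sets borel" "X \<subseteq> {0..1::real}"
  shows "continuous_on S (\<lambda>t. measure lborel (X \<inter> {..<t}))"
proof -
  define m where "m = (\<lambda>t. measure lborel (X \<inter> {..<t}))"
  have diff: "m u \<le> m v \<and> m v \<le> m u + (v - u)" if uv: "u \<le> v" for u v
  proof -
    have "X \<inter> {..<v} = (X \<inter> {..<u}) \<union> (X \<inter> {u..<v})" using uv by auto
    then have "m v \<le> m u + measure lborel (X \<inter> {u..<v})"
      unfolding m_def using X measure_Un_le_borel [of "X \<inter> {..<u}" "X \<inter> {u..<v}"] by simp
    moreover have "measure lborel (X \<inter> {u..<v}) \<le> measure lborel {u..<v}"
      using X by (intro measure_mono_Icc [of _ _ u v]) auto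
    moreover have "m u \<le> m v" unfolding m_def using X uv by (intro measure_mono_Icc [of _ _ 0 1]) auto
    ultimately show ?thesis using uv by simp
  qed
  have "1-lipschitz_on S m"
  proof (rule lipschitz_onI)
    show "dist (m x) (m y) \<le> 1 * dist x y" for x y
      using diff [of x y] diff [of y x] by (auto simp: dist_real_def abs_le_iff split: abs_split)
  qed simp
  then show ?thesis unfolding m_def by (rule lipschitz_on_continuous_on)
qed

lemma floor_locally_constant:
  assumes "0 < L" "real L * t \<notin> \<int>"
  obtains e where "0 < e" "\<And>s. \<bar>s - t\<bar> < e \<Longrightarrow> \<lfloor>real L * s\<rfloor> = \<lfloor>real L * t\<rfloor>"
proof -
  define d where "d = min (frac (real L * t)) (1 - frac (real L * t))"
  have "0 < d" using assms(2) by (simp add: d_def frac_lt_1 frac_gt_0_iff)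
  have fl: "\<lfloor>real L * s\<rfloor> = \<lfloor>real L * t\<rfloor>" if "\<bar>s - t\<bar> < d / L" for s
  proof -
    have "real L * \<bar>s - t\<bar> < d" using that assms(1) by (simp add: field_simps)
    then have "\<bar>real L * s - real L * t\<bar> < d" by (simp add: abs_mult flip: right_diff_distrib)
    then have "of_int \<lfloor>real L * t\<rfloor> \<le> real L * s" "real L * s < of_int \<lfloor>real L * t\<rfloor> + 1"
      unfolding d_def frac_def by linarith+
    then show ?thesis by (simp add: floor_unique)
  qed
  show thesis
  proof (rule that)
    show "0 < d / L" using \<open>0 < d\<close> assms(1) by simp
  qed (rule fl)
qed

lemma finite_grid: assumes "0 < L" shows "finite {t \<in> {0..1}. real L * t \<in> \<int>}"
proof (rule finite_subset)
  show "{t \<in> {0..1}. real L * t \<in> \<int>} \<subseteq> (\<lambda>i. of_int i / real L) ` {0..int L}"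
  proof
    fix t assume t: "t \<in> {t \<in> {0..1}. real L * t \<in> \<int>}"
    then obtain i where i: "real L * t = of_int i" by (auto elim: Ints_cases)
    then have "t = of_int i / real L" using assms by (simp add: field_simps)
    moreover have "0 \<le> real L * t" "real L * t \<le> real L" using t assms by (auto simp: mult_left_le)
    then have "i \<in> {0..int L}" using i by auto
    ultimately show "t \<in> (\<lambda>i. of_int i / real L) ` {0..int L}" by blast
  qed
qed simp

text \<open>
  On a cell in which \<open>Q\<close> has the density \<open>d\<close>, let \<open>u\<close> be the primitive of the indicator of \<open>Q\<close>
  minus \<open>d\<close>. It vanishes at both ends of the cell, and \<open>\<bar>u\<bar> \<le> d * (1 - d) / N\<close>. Divided by this
  bound it becomes a test function whose derivative has integral \<open>1\<close> over \<open>Q\<close>. The sum over the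
  mixed cells still is bounded by \<open>1\<close>, because the cells are disjoint, while the integral over
  \<open>Q\<close> counts the mixed cells.
\<close>

lemma weak_variation_few_mixed_cells:
  fixes K \<epsilon> \<kappa> :: real
  assumes N: "0 < N" and \<kappa>: "0 < \<kappa>" "\<kappa> \<le> 1/2" and L: "0 < L" and Q: "Q = cells L J" "finite J" "Q \<subseteq> {0..<1}"
    and var: "\<And>b \<psi> \<eta> m. test_fun b \<psi> \<eta> \<Longrightarrow> (\<And>t. \<bar>\<eta> t\<bar> \<le> m) \<Longrightarrow> \<bar>\<integral>x. indicator Q x * \<eta> x \<partial>unit_leb\<bar> \<le> K * b + \<epsilon> * m"
  defines "d \<equiv> \<lambda>j. real N * measure lborel (Q \<inter> cells N {j})"
  shows "card {j \<in> {0..<int N}. \<kappa> \<le> d j \<and> d j \<le> 1 - \<kappa>} \<le> K + \<epsilon> * (2 * N / \<kappa>)"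
proof -
  define Mx where "Mx = {j \<in> {0..<int N}. \<kappa> \<le> d j \<and> d j \<le> 1 - \<kappa>}"
  have finM: "finite Mx" unfolding Mx_def by (rule finite_subset [of _ "{0..<int N}"]) auto
  define I where "I = (\<lambda>j. cells N {j})"
  have I_eq: "I j = {of_int j / N..<(of_int j + 1) / N}" for j unfolding I_def by (rule cells_singleton [OF N])
  have I_sub: "I j \<subseteq> {0..<1}" if "j \<in> Mx" for j
  proof -
    have "0 \<le> j" "j + 1 \<le> int N" using that by (auto simp: Mx_def)
    then have "real_of_int 0 \<le> of_int j" "real_of_int (j + 1) \<le> real N" by linarith+
    then show ?thesis unfolding I_eq using N by (auto simp: field_simps)
  qed
  have [measurable]: "I j \<in> sets borel" "Q \<in> sets borel" for j using N L Q by (auto simp: I_def)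
  have lenI: "measure lborel (I j) = 1 / N" for j
    using measure_cells [OF N, of "{j}"] by (simp add: I_def)
  have dI: "measure lborel (Q \<inter> I j) = d j / N" for j using N by (simp add: d_def I_def)
  have disj: "j = j'" if "x \<in> I j" "x \<in> I j'" for x j j' using that by (auto simp: I_def cells_def)
  \<comment> \<open>The normalisation that makes the primitive on a mixed cell bounded by \<open>1\<close>.\<close>
  define k where "k = (\<lambda>j. N / (d j * (1 - d j)))"
  have dpos: "0 < d j" "d j < 1" "d j * (1 - d j) \<ge> \<kappa> / 2" if "j \<in> Mx" for j
  proof -
    have j: "\<kappa> \<le> d j" "d j \<le> 1 - \<kappa>" using that by (auto simp: Mx_def)
    then show "0 < d j" "d j < 1" using \<kappa> by auto
    show "d j * (1 - d j) \<ge> \<kappa> / 2"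
    proof (cases "d j \<le> 1/2")
      case True
      then have "\<kappa> * (1/2) \<le> d j * (1 - d j)" using j \<kappa> by (intro mult_mono) auto
      then show ?thesis by simp
    next
      case False
      then have "(1/2) * \<kappa> \<le> d j * (1 - d j)" using j \<kappa> by (intro mult_mono) auto
      then show ?thesis by simp
    qed
  qed
  define u where "u = (\<lambda>j t. measure lborel ((Q \<inter> I j) \<inter> {..<t}) - d j * measure lborel (I j \<inter> {..<t}))"
  define \<psi> where "\<psi> = (\<lambda>t. \<Sum>j\<in>Mx. k j * u j t)"
  define \<eta> where "\<eta> = (\<lambda>t. \<Sum>j\<in>Mx. k j * (indicator (Q \<inter> I j) t - d j * indicator (I j) t))"
  have u_before: "u j t = 0" if "t \<le> of_int j / N" for j t
  proof -
    have "I j \<inter> {..<t} = {}" using that by (auto simp: I_eq)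
    then show ?thesis by (simp add: u_def Int_assoc)
  qed
  have u_after: "u j t = 0" if "(of_int j + 1) / N \<le> t" for j t
  proof -
    have "I j \<inter> {..<t} = I j" using that by (auto simp: I_eq)
    then show ?thesis using dI lenI by (simp add: u_def Int_assoc)
  qed
  have u_supp: "t \<in> I j" if "u j t \<noteq> 0" for j t
    using u_before [of t j] u_after [of j t] that unfolding I_eq
    by (cases "t \<le> of_int j / N"; cases "(of_int j + 1) / N \<le> t") auto
  have u_bound: "\<bar>k j * u j t\<bar> \<le> 1" if j: "j \<in> Mx" for j t
  proof -
    define a where "a = measure lborel ((Q \<inter> I j) \<inter> {..<t})"
    define c where "c = measure lborel ((I j - Q) \<inter> {..<t})"
    have "I j \<inter> {..<t} = ((Q \<inter> I j) \<inter> {..<t}) \<union> ((I j - Q) \<inter> {..<t})" by auto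
    then have tot: "measure lborel (I j \<inter> {..<t}) = a + c"
      unfolding a_def c_def using I_sub [OF j]
      by (simp only:) (intro measure_Un_Icc [of _ _ 0 1]; auto)
    have I01: "I j \<subseteq> {0..1}" using I_sub [OF j] by auto
    have "measure lborel ((Q \<inter> I j) \<union> (I j - Q)) = measure lborel (Q \<inter> I j) + measure lborel (I j - Q)"
      by (rule measure_Un_Icc [of _ _ 0 1]) (use I01 in auto)
    moreover have "(Q \<inter> I j) \<union> (I j - Q) = I j" by blast
    ultimately have "measure lborel (I j) = measure lborel (Q \<inter> I j) + measure lborel (I j - Q)" by simp
    then have rest: "measure lborel (I j - Q) = (1 - d j) / N" using dI lenI by (simp add: diff_divide_distrib)
    have a: "0 \<le> a" "a \<le> d j / N"
      unfolding a_def dI [symmetric] using I_sub [OF j] by (auto intro!: measure_mono_Icc [of _ _ 0 1])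
    have c: "0 \<le> c" "c \<le> (1 - d j) / N"
      unfolding c_def rest [symmetric] using I_sub [OF j] by (auto intro!: measure_mono_Icc [of _ _ 0 1])
    have "u j t = (1 - d j) * a - d j * c" unfolding u_def tot by (simp add: a_def algebra_simps)
    moreover have "0 \<le> (1 - d j) * a" "0 \<le> d j * c" using a c dpos [OF j] by simp_all
    moreover have "(1 - d j) * a \<le> d j * (1 - d j) / N"
      using mult_left_mono [of a "d j / N" "1 - d j"] a dpos [OF j] by (simp add: mult.commute)
    moreover have "d j * c \<le> d j * (1 - d j) / N"
      using mult_left_mono [of c "(1 - d j) / N" "d j"] c dpos [OF j] by simp
    ultimately have "\<bar>u j t\<bar> \<le> d j * (1 - d j) / N" by (simp add: abs_le_iff)
    then have "k j * \<bar>u j t\<bar> \<le> k j * (d j * (1 - d j) / N)"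
      using dpos [OF j] by (intro mult_left_mono) (auto simp: k_def)
    also have "\<dots> = 1" using dpos [OF j] N by (simp add: k_def)
    finally show ?thesis using dpos [OF j] by (simp add: abs_mult k_def)
  qed
  have \<psi>_bound: "\<bar>\<psi> t\<bar> \<le> 1" for t
  proof (cases "\<exists>j\<in>Mx. u j t \<noteq> 0")
    case True
    then obtain j where j: "j \<in> Mx" "u j t \<noteq> 0" by blast
    then have tj: "t \<in> I j" using u_supp by blast
    have "\<psi> t = k j * u j t"
      unfolding \<psi>_def
    proof (rule sum_eq_single [OF finM j(1)])
      fix i assume "i \<in> Mx" "i \<noteq> j"
      then show "k i * u i t = 0" using u_supp [of i t] disj [OF tj] by auto
    qed
    then show ?thesis using u_bound j by simp
  next
    case False then show ?thesis by (simp add: \<psi>_def)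
  qed
  have \<eta>_bound: "\<bar>\<eta> t\<bar> \<le> 2 * N / \<kappa>" for t
  proof (cases "\<exists>j\<in>Mx. t \<in> I j")
    case True
    then obtain j where j: "j \<in> Mx" "t \<in> I j" by blast
    have "\<eta> t = k j * (indicator (Q \<inter> I j) t - d j * indicator (I j) t)"
      unfolding \<eta>_def
    proof (rule sum_eq_single [OF finM j(1)])
      fix i assume "i \<in> Mx" "i \<noteq> j"
      then have "t \<notin> I i" using disj [OF j(2)] by blast
      then show "k i * (indicator (Q \<inter> I i) t - d i * indicator (I i) t) = 0" by simp
    qed
    then have "\<bar>\<eta> t\<bar> = \<bar>k j\<bar> * \<bar>indicator (Q \<inter> I j) t - d j * indicator (I j) t\<bar>"
      by (simp add: abs_mult)
    also have "\<dots> \<le> \<bar>k j\<bar> * 1"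
      by (rule mult_left_mono) (use dpos [OF j(1)] j(2) in \<open>auto simp: indicator_def\<close>)
    also have "\<dots> = N / (d j * (1 - d j))" using dpos [OF j(1)] by (simp add: k_def)
    also have "\<dots> \<le> N / (\<kappa> / 2)"
      using dpos [OF j(1)] \<kappa> by (intro divide_left_mono mult_pos_pos) auto
    finally show ?thesis by (simp add: mult.commute)
  next
    case False
    then have "\<eta> t = 0" unfolding \<eta>_def by (intro sum.neutral) auto
    then show ?thesis using \<kappa> by simp
  qed
  have test: "test_fun 1 \<psi> \<eta>"
    unfolding test_fun_def
  proof (intro conjI)
    show "continuous_on {0..1} \<psi>"
      unfolding \<psi>_def
    proof (intro continuous_intros)
      fix j assume "j \<in> Mx"
      then have "I j \<subseteq> {0..1}" using I_sub by fastforce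
      then show "continuous_on {0..1} (u j)" unfolding u_def
        by (intro continuous_intros continuous_measure_lessThan) auto
    qed
    have ends: "0 \<le> real_of_int j / N" "(real_of_int j + 1) / N \<le> 1" if "j \<in> Mx" for j
    proof -
      have "0 \<le> j" "j + 1 \<le> int N" using that by (auto simp: Mx_def)
      then have "real_of_int 0 \<le> of_int j" "real_of_int (j + 1) \<le> real N" by linarith+
      then show "0 \<le> real_of_int j / N" "(real_of_int j + 1) / N \<le> 1" using N by (auto simp: field_simps)
    qed
    show "\<psi> 0 = 0" unfolding \<psi>_def using u_before ends by (intro sum.neutral) auto
    show "\<psi> 1 = 0" unfolding \<psi>_def using u_after ends by (intro sum.neutral) auto
    show "\<forall>t\<in>{0..1}. \<bar>\<psi> t\<bar> \<le> 1" using \<psi>_bound by blast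
    show "\<exists>S. finite S \<and> (\<forall>t\<in>{0<..<1} - S. (\<psi> has_real_derivative \<eta> t) (at t))"
    proof (intro exI conjI ballI)
      show "finite ({t \<in> {0..1}. real N * t \<in> \<int>} \<union> {t \<in> {0..1}. real L * t \<in> \<int>})"
        using finite_grid N L by blast
      fix t assume t: "t \<in> {0<..<1} - ({t \<in> {0..1}. real N * t \<in> \<int>} \<union> {t \<in> {0..1}. real L * t \<in> \<int>})"
      obtain e1 where e1: "0 < e1" "\<And>s. \<bar>s - t\<bar> < e1 \<Longrightarrow> \<lfloor>real N * s\<rfloor> = \<lfloor>real N * t\<rfloor>"
        using floor_locally_constant [OF N, of t] t by auto
      obtain e2 where e2: "0 < e2" "\<And>s. \<bar>s - t\<bar> < e2 \<Longrightarrow> \<lfloor>real L * s\<rfloor> = \<lfloor>real L * t\<rfloor>"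
        using floor_locally_constant [OF L, of t] t by auto
      have 1: "((\<lambda>t. measure lborel ((Q \<inter> I j) \<inter> {..<t})) has_real_derivative indicator (Q \<inter> I j) t) (at t)" if "j \<in> Mx" for j
      proof (rule has_derivative_measure_lessThan [of _ "min e1 e2"])
        show "s \<in> Q \<inter> I j \<longleftrightarrow> t \<in> Q \<inter> I j" if "\<bar>s - t\<bar> < min e1 e2" for s
          using e1(2) [of s] e2(2) [of s] that by (simp add: Q(1) I_def cells_def)
      qed (use e1 e2 I_sub [OF that] in auto)
      have 2: "((\<lambda>t. measure lborel (I j \<inter> {..<t})) has_real_derivative indicator (I j) t) (at t)" if "j \<in> Mx" for j
      proof (rule has_derivative_measure_lessThan [of _ e1])
        show "s \<in> I j \<longleftrightarrow> t \<in> I j" if "\<bar>s - t\<bar> < e1" for s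
          using e1(2) [of s] that by (simp add: I_def cells_def)
      qed (use e1 I_sub [OF that] in auto)
      show "(\<psi> has_real_derivative \<eta> t) (at t)"
        unfolding \<psi>_def \<eta>_def u_def
        by (intro DERIV_sum DERIV_cmult DERIV_diff 1 2)
    qed
    show "\<eta> \<in> borel_measurable borel" unfolding \<eta>_def by measurable
    show "\<exists>B. \<forall>t. \<bar>\<eta> t\<bar> \<le> B" using \<eta>_bound by blast
  qed
  have "(\<integral>x. indicator Q x * \<eta> x \<partial>unit_leb) = (\<integral>x. (\<Sum>j\<in>Mx. k j * (1 - d j) * indicator (Q \<inter> I j) x) \<partial>unit_leb)"
  proof (rule Bochner_Integration.integral_cong [OF refl])
    fix x
    show "indicator Q x * \<eta> x = (\<Sum>j\<in>Mx. k j * (1 - d j) * indicator (Q \<inter> I j) x)"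
      unfolding \<eta>_def sum_distrib_left
      by (intro sum.cong refl) (auto simp: indicator_def algebra_simps)
  qed
  also have "\<dots> = (\<Sum>j\<in>Mx. \<integral>x. k j * (1 - d j) * indicator (Q \<inter> I j) x \<partial>unit_leb)"
  proof (rule Bochner_Integration.integral_sum)
    fix j
    show "integrable unit_leb (\<lambda>x. k j * (1 - d j) * indicator (Q \<inter> I j) x)"
      by (rule integrable_unit_leb [of _ "\<bar>k j * (1 - d j)\<bar>"]) (auto intro!: measurable_unit_leb simp: indicator_def)
  qed
  also have "\<dots> = (\<Sum>j\<in>Mx. 1)"
  proof (rule sum.cong)
    fix j assume j: "j \<in> Mx"
    have "(\<integral>x. indicator (Q \<inter> I j) x \<partial>unit_leb) = d j / N"
      using integral_indicator_unit_leb [of "Q \<inter> I j"] Q(3) dI by auto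
    then have "(\<integral>x. k j * (1 - d j) * indicator (Q \<inter> I j) x \<partial>unit_leb) = k j * (1 - d j) * (d j / N)" by simp
    also have "\<dots> = 1" using dpos [OF j] N by (simp add: k_def)
    finally show "(\<integral>x. k j * (1 - d j) * indicator (Q \<inter> I j) x \<partial>unit_leb) = 1" .
  qed simp
  finally have "(\<integral>x. indicator Q x * \<eta> x \<partial>unit_leb) = card Mx" by simp
  moreover have "\<bar>\<integral>x. indicator Q x * \<eta> x \<partial>unit_leb\<bar> \<le> K * 1 + \<epsilon> * (2 * N / \<kappa>)"
    by (rule var [OF test \<eta>_bound])
  ultimately show ?thesis by (simp add: Mx_def)
qed

lemma integral_indicator_diff_le:
  fixes \<zeta> :: "real \<Rightarrow> real"
  assumes X: "X \<in> sets borel" "X \<subseteq> {0..<1}" and Y: "Y \<in> sets borel" "Y \<subseteq> {0..<1}"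
    and \<zeta>: "\<zeta> \<in> borel_measurable unit_leb" "\<And>x. \<bar>\<zeta> x\<bar> \<le> m"
  shows "\<bar>(\<integral>x. indicator X x * \<zeta> x \<partial>unit_leb) - (\<integral>x. indicator Y x * \<zeta> x \<partial>unit_leb)\<bar>
    \<le> m * (measure lborel (X - Y) + measure lborel (Y - X))"
proof -
  have m: "0 \<le> m" using \<zeta>(2) [of 0] by linarith
  have meas: "(\<lambda>x. indicator Z x * \<zeta> x) \<in> borel_measurable unit_leb" if "Z \<in> sets borel" for Z
  proof (rule borel_measurable_times [OF _ \<zeta>(1)])
    show "indicator Z \<in> borel_measurable unit_leb"
      by (rule measurable_unit_leb) (use that in simp)
  qed
  have bnd: "\<bar>indicator Z x * \<zeta> x\<bar> \<le> m" for Z x using \<zeta>(2) [of x] m by (auto simp: indicator_def)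
  have int: "integrable unit_leb (\<lambda>x. indicator Z x * \<zeta> x)" if "Z \<in> sets borel" for Z
    by (rule integrable_unit_leb [OF meas [OF that] bnd])
  have intI: "integrable unit_leb (\<lambda>x. m * indicator Z x)" if "Z \<in> sets borel" for Z
    by (rule integrable_unit_leb [of _ m]) (use m that in \<open>auto intro!: measurable_unit_leb simp: indicator_def\<close>)
  have "\<bar>(\<integral>x. indicator X x * \<zeta> x \<partial>unit_leb) - (\<integral>x. indicator Y x * \<zeta> x \<partial>unit_leb)\<bar>
      = \<bar>\<integral>x. indicator X x * \<zeta> x - indicator Y x * \<zeta> x \<partial>unit_leb\<bar>"
    using int X Y by simp
  also have "\<dots> \<le> (\<integral>x. \<bar>indicator X x * \<zeta> x - indicator Y x * \<zeta> x\<bar> \<partial>unit_leb)"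
    by (rule integral_abs_bound)
  also have "\<dots> \<le> (\<integral>x. m * indicator (X - Y) x + m * indicator (Y - X) x \<partial>unit_leb)"
  proof (rule integral_mono)
    show "integrable unit_leb (\<lambda>x. \<bar>indicator X x * \<zeta> x - indicator Y x * \<zeta> x\<bar>)"
      using int X Y by (intro integrable_abs Bochner_Integration.integrable_diff) auto
    show "integrable unit_leb (\<lambda>x. m * indicator (X - Y) x + m * indicator (Y - X) x)"
      using X Y by (intro Bochner_Integration.integrable_add intI) auto
    show "\<bar>indicator X x * \<zeta> x - indicator Y x * \<zeta> x\<bar> \<le> m * indicator (X - Y) x + m * indicator (Y - X) x" for x
      using \<zeta>(2) [of x] m by (auto simp: indicator_def)
  qed
  also have "\<dots> = (\<integral>x. m * indicator (X - Y) x \<partial>unit_leb) + (\<integral>x. m * indicator (Y - X) x \<partial>unit_leb)"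
    using X Y by (intro Bochner_Integration.integral_add intI) auto
  also have "\<dots> = m * measure lborel (X - Y) + m * measure lborel (Y - X)"
    using integral_indicator_unit_leb [of "X - Y"] integral_indicator_unit_leb [of "Y - X"] X Y
    by (simp add: subset_iff)
  finally show ?thesis by (simp add: distrib_left)
qed

lemma test_fun_bounded: "test_fun b \<psi> \<eta> \<Longrightarrow> \<exists>B. \<forall>t. \<bar>\<eta> t\<bar> \<le> B"
  by (simp add: test_fun_def)

text \<open>
  At most \<open>K + 1\<close> cells are mixed. If all others were nearly empty, the measure of \<open>B\<close> would be
  at most \<open>(K + 1) / N\<close> plus small errors, which is less than \<open>a\<close>. The term \<open>\<epsilon> * m\<close> in the
  hypothesis leaves room to replace \<open>B\<close> by a union of grid cells.
\<close>

lemma weak_variation_nearly_full_cell: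
  fixes K \<epsilon> \<kappa> a :: real
  assumes B: "B \<in> sets borel" "B \<subseteq> {0..<1}" and a: "0 < a" "a \<le> measure lborel B"
    and N: "0 < N" "4 * (K + 1) \<le> a * N" and \<kappa>: "0 < \<kappa>" "\<kappa> \<le> 1/2" "\<kappa> \<le> a / 4"
    and \<epsilon>: "0 < \<epsilon>" "6 * \<epsilon> * N \<le> \<kappa>"
    and var: "\<And>b \<psi> \<eta> m. test_fun b \<psi> \<eta> \<Longrightarrow> (\<And>t. \<bar>\<eta> t\<bar> \<le> m) \<Longrightarrow> \<bar>\<integral>x. indicator B x * \<eta> x \<partial>unit_leb\<bar> \<le> K * b + \<epsilon> * m"
  obtains j where "j \<in> {0..<int N}" "measure lborel (cells N {j} - B) \<le> 2 * \<kappa>"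
proof -
  obtain L J where L: "0 < L" "finite J" "J \<subseteq> {0..<int L}" "measure lborel (B - cells L J) \<le> \<epsilon>"
     "measure lborel (cells L J - B) \<le> \<epsilon>" "cells L J \<subseteq> {0..<1}"
    using cells_approx [OF B \<epsilon>(1)] by blast
  define Q where "Q = cells L J"
  have Qb [measurable]: "Q \<in> sets borel" using L by (simp add: Q_def)
  have varQ: "\<bar>\<integral>x. indicator Q x * \<eta> x \<partial>unit_leb\<bar> \<le> K * b + (3 * \<epsilon>) * m"
    if t: "test_fun b \<psi> \<eta>" "\<And>t. \<bar>\<eta> t\<bar> \<le> m" for b \<psi> \<eta> m
  proof -
    have "0 \<le> m" using t(2) [of 0] by linarith
    have "\<eta> \<in> borel_measurable unit_leb" using t(1) by (auto simp: test_fun_def intro: measurable_unit_leb)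
    then have "\<bar>(\<integral>x. indicator Q x * \<eta> x \<partial>unit_leb) - (\<integral>x. indicator B x * \<eta> x \<partial>unit_leb)\<bar>
        \<le> m * (measure lborel (Q - B) + measure lborel (B - Q))"
      using L B t(2) by (intro integral_indicator_diff_le) (auto simp: Q_def)
    also have "\<dots> \<le> m * (\<epsilon> + \<epsilon>)" using L \<open>0 \<le> m\<close> by (intro mult_left_mono add_mono) (auto simp: Q_def)
    finally show ?thesis using var [OF t] by (simp add: algebra_simps abs_le_iff)
  qed
  define d where "d = (\<lambda>j. real N * measure lborel (Q \<inter> cells N {j}))"
  define Mx where "Mx = {j \<in> {0..<int N}. \<kappa> \<le> d j \<and> d j \<le> 1 - \<kappa>}"
  have "card Mx \<le> K + (3 * \<epsilon>) * (2 * real N / \<kappa>)"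
    unfolding Mx_def d_def
    by (rule weak_variation_few_mixed_cells [OF N(1) \<kappa>(1,2) L(1) Q_def L(2) _ varQ]) (use L in \<open>auto simp: Q_def\<close>)
  moreover have "(3 * \<epsilon>) * (2 * real N / \<kappa>) = (6 * \<epsilon> * N) / \<kappa>" by simp
  moreover have "(6 * \<epsilon> * N) / \<kappa> \<le> 1" using \<epsilon>(2) \<kappa>(1) by simp
  ultimately have cardM: "card Mx \<le> K + 1" by linarith
  have \<epsilon>\<kappa>: "\<epsilon> \<le> \<kappa>"
  proof -
    have "\<epsilon> * 1 \<le> \<epsilon> * (6 * N)" using N(1) \<epsilon>(1) by (intro mult_left_mono) auto
    then show ?thesis using \<epsilon>(2) by (simp add: mult.commute mult.left_commute)
  qed
  have d_le: "d j \<le> 1" for j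
  proof -
    have c: "measure lborel (cells N {j}) = 1 / N" using measure_cells [OF N(1), of "{j}"] by simp
    have "cells N {j} \<subseteq> {of_int j / N..(of_int j + 1) / N}" unfolding cells_singleton [OF N(1)] by auto
    then have "measure lborel (Q \<inter> cells N {j}) \<le> 1 / N"
      unfolding c [symmetric] using N by (intro measure_mono_Icc) auto
    then show ?thesis using N(1) by (simp add: d_def field_simps)
  qed
  have "\<exists>j\<in>{0..<int N}. 1 - \<kappa> < d j"
  proof (rule ccontr)
    assume "\<not> ?thesis"
    then have small: "d j < \<kappa>" if "j \<in> {0..<int N} - Mx" for j using that by (force simp: Mx_def)
    have Qeq: "Q = (\<Union>j\<in>{0..<int N}. Q \<inter> cells N {j})"
    proof -
      have "\<lfloor>real N * t\<rfloor> \<in> {0..<int N}" if "t \<in> Q" for t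
      proof -
        have "0 \<le> t" "t < 1" using that L by (auto simp: Q_def)
        then show ?thesis using N(1) by (simp add: floor_less_iff)
      qed
      then show ?thesis by (auto simp: cells_def)
    qed
    have "measure lborel B \<le> measure lborel (Q \<union> (B - Q))"
      using B L by (intro measure_mono_Icc [of _ _ 0 1]) (auto simp: Q_def)
    also have "\<dots> \<le> measure lborel Q + measure lborel (B - Q)" using B by (intro measure_Un_le_borel) auto
    finally have mB: "measure lborel B \<le> measure lborel Q + \<epsilon>" using L by (simp add: Q_def)
    have "measure lborel Q = measure lborel (\<Union>j\<in>{0..<int N}. Q \<inter> cells N {j})" using Qeq by simp
    also have "\<dots> \<le> (\<Sum>j\<in>{0..<int N}. measure lborel (Q \<inter> cells N {j}))"
      using N by (intro measure_UNION_le) auto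
    also have "\<dots> = (\<Sum>j\<in>{0..<int N}. d j) / N" using N by (simp add: d_def flip: sum_distrib_left)
    finally have mQ: "measure lborel Q \<le> (\<Sum>j\<in>{0..<int N}. d j) / N" .
    have "(\<Sum>j\<in>{0..<int N}. d j) \<le> (\<Sum>j\<in>{0..<int N}. indicator Mx j + \<kappa>)"
    proof (rule sum_mono)
      fix j assume "j \<in> {0..<int N}"
      then show "d j \<le> indicator Mx j + \<kappa>"
        using d_le [of j] small [of j] \<kappa>(1) by (cases "j \<in> Mx") auto
    qed
    also have "\<dots> = real (card Mx) + real N * \<kappa>"
    proof -
      have "(\<Sum>j\<in>{0..<int N}. indicator Mx j) = (\<Sum>j\<in>Mx. 1 :: real)"
        by (rule sum.mono_neutral_cong_right) (auto simp: Mx_def indicator_def)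
      then show ?thesis by (simp add: sum.distrib)
    qed
    finally have "(\<Sum>j\<in>{0..<int N}. d j) / N \<le> (real (card Mx) + real N * \<kappa>) / N"
      using N(1) by (intro divide_right_mono) auto
    moreover have "(real (card Mx) + real N * \<kappa>) / N = card Mx / N + \<kappa>" using N by (simp add: add_divide_distrib)
    moreover have "card Mx / N \<le> a / 4"
    proof -
      have "4 * real (card Mx) \<le> 4 * (K + 1)" using cardM by simp
      also note N(2)
      finally show ?thesis using N(1) by (simp add: field_simps)
    qed
    ultimately show False using mB mQ a \<kappa> \<epsilon>\<kappa> by linarith
  qed
  then obtain j where j: "j \<in> {0..<int N}" "1 - \<kappa> < d j" by blast
  have "measure lborel (cells N {j} - B) \<le> 2 * \<kappa>"
  proof -
    have c: "measure lborel (cells N {j}) = 1 / N" using measure_cells [OF N(1), of "{j}"] by simp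
    have sub: "cells N {j} \<subseteq> {of_int j / N..(of_int j + 1) / N}" unfolding cells_singleton [OF N(1)] by auto
    have "measure lborel ((Q \<inter> cells N {j}) \<union> (cells N {j} - Q)) = measure lborel (Q \<inter> cells N {j}) + measure lborel (cells N {j} - Q)"
      using N(1) sub by (intro measure_Un_Icc) auto
    moreover have "(Q \<inter> cells N {j}) \<union> (cells N {j} - Q) = cells N {j}" by blast
    ultimately have "N * measure lborel (cells N {j} - Q) = 1 - d j" using c N(1) by (simp add: d_def field_simps)
    then have "N * measure lborel (cells N {j} - Q) \<le> \<kappa>" using j by simp
    moreover have "1 * measure lborel (cells N {j} - Q) \<le> N * measure lborel (cells N {j} - Q)"
      using N(1) by (intro mult_right_mono) auto
    ultimately have 1: "measure lborel (cells N {j} - Q) \<le> \<kappa>" by simp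
    have "measure lborel (cells N {j} - B) \<le> measure lborel ((cells N {j} - Q) \<union> (Q - B))"
    proof (rule measure_mono_Icc [of _ _ "min 0 (of_int j / N)" "max 1 ((of_int j + 1) / N)"])
      show "cells N {j} - Q \<union> (Q - B) \<subseteq> {min 0 (of_int j / N)..max 1 ((of_int j + 1) / N)}"
        using sub L(6) by (fastforce simp: Q_def)
    qed (use N B in auto)
    also have "\<dots> \<le> measure lborel (cells N {j} - Q) + measure lborel (Q - B)"
      using N B by (intro measure_Un_le_borel) auto
    finally show ?thesis using 1 L(5) \<epsilon>\<kappa> by (simp add: Q_def)
  qed
  then show thesis using that j by blast
qed

section \<open>A weak Lasota-Yorke inequality\<close>

text \<open>
  The function \<open>v\<close> is the reciprocal of the derivative of a branch. Only \<open>v\<close> and its derivative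
  enter the estimates, and the bounds on them are stable under composition. The image of the
  open interval is an interval inside \<open>(0, 1)\<close>, so that a branch can be followed by another one.
\<close>

definition expanding_piece :: "(real \<Rightarrow> real) \<Rightarrow> real \<Rightarrow> real \<Rightarrow> real \<Rightarrow> bool" where
  "expanding_piece h r p q \<longleftrightarrow> (\<exists>H v v' K P Q.
     continuous_on {p..q} H \<and> continuous_on {p..q} v \<and> continuous_on {p<..<q} v' \<and>
     (\<forall>t\<in>{p..q}. \<bar>v t\<bar> \<le> r \<and> H t \<in> {P..Q}) \<and>
     (\<forall>t\<in>{p<..<q}. h t = H t \<and> v t \<noteq> 0 \<and> (H has_real_derivative 1 / v t) (at t) \<and>
        (v has_real_derivative v' t) (at t) \<and> \<bar>v' t\<bar> \<le> K) \<and>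
     0 \<le> P \<and> P < Q \<and> Q \<le> 1 \<and> H ` {p<..<q} = {P<..<Q} \<and> inj_on H {p<..<q})"

definition piecewise_expanding :: "(real \<Rightarrow> real) \<Rightarrow> real \<Rightarrow> bool" where
  "piecewise_expanding h r \<longleftrightarrow> (\<exists>D. finite D \<and>
     (\<forall>p q. 0 \<le> p \<and> p < q \<and> q \<le> 1 \<and> {p<..<q} \<inter> D = {} \<longrightarrow> expanding_piece h r p q))"

text \<open>
  With \<open>v = 1 / h'\<close>, the chain rule gives \<open>((\<psi> \<circ> h) * v)' = \<eta> \<circ> h + (\<psi> \<circ> h) * v'\<close>. So \<open>\<eta> \<circ> h\<close>
  is, up to a bounded remainder, the derivative of a function bounded by \<open>r * b\<close>. Subtracting
  the affine interpolation of its boundary values makes this function vanish at both ends and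
  doubles the bound, and the slope of the interpolation joins the remainder.
\<close>

lemma expanding_piece_pullback:
  assumes "expanding_piece h r p q" "p < q"
  obtains C where "0 \<le> C" "\<And>b \<psi> \<eta>. test_fun b \<psi> \<eta> \<Longrightarrow> \<exists>w \<rho> S. continuous_on UNIV w \<and> (\<forall>t. t \<notin> {p<..<q} \<longrightarrow> w t = 0 \<and> \<rho> t = 0) \<and>
     (\<forall>t. \<bar>w t\<bar> \<le> 2 * r * b \<and> \<bar>\<rho> t\<bar> \<le> C * b) \<and> \<rho> \<in> borel_measurable borel \<and> finite S \<and>
     (\<forall>t\<in>{p<..<q} - S. (w has_real_derivative (\<eta> (h t) - \<rho> t)) (at t))"
proof -
  obtain H v v' K P Q where H: "continuous_on {p..q} H" "continuous_on {p..q} v" "continuous_on {p<..<q} v'"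
      "\<And>t. t \<in> {p..q} \<Longrightarrow> \<bar>v t\<bar> \<le> r" "\<And>t. t \<in> {p..q} \<Longrightarrow> H t \<in> {P..Q}"
     and H': "\<And>t. t \<in> {p<..<q} \<Longrightarrow> h t = H t" "\<And>t. t \<in> {p<..<q} \<Longrightarrow> v t \<noteq> 0"
       "\<And>t. t \<in> {p<..<q} \<Longrightarrow> (H has_real_derivative 1 / v t) (at t)"
       "\<And>t. t \<in> {p<..<q} \<Longrightarrow> (v has_real_derivative v' t) (at t)" "\<And>t. t \<in> {p<..<q} \<Longrightarrow> \<bar>v' t\<bar> \<le> K"
     and P: "0 \<le> P" "P < Q" "Q \<le> 1" "H ` {p<..<q} = {P<..<Q}" "inj_on H {p<..<q}"
    using assms(1) unfolding expanding_piece_def by (elim exE conjE) blast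
  have r: "0 \<le> r" using H(4) [of p] assms(2) by auto
  have K: "0 \<le> K" using H'(5) [of "(p + q) / 2"] assms(2) by auto
  define C where "C = K + 2 * r / (q - p)"
  have "0 \<le> C" using r K assms(2) by (simp add: C_def)
  moreover have "\<exists>w \<rho> S. continuous_on UNIV w \<and> (\<forall>t. t \<notin> {p<..<q} \<longrightarrow> w t = 0 \<and> \<rho> t = 0) \<and>
     (\<forall>t. \<bar>w t\<bar> \<le> 2 * r * b \<and> \<bar>\<rho> t\<bar> \<le> C * b) \<and> \<rho> \<in> borel_measurable borel \<and> finite S \<and>
     (\<forall>t\<in>{p<..<q} - S. (w has_real_derivative (\<eta> (h t) - \<rho> t)) (at t))"
    if test: "test_fun b \<psi> \<eta>" for b \<psi> \<eta>
  proof -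
    have \<psi>: "continuous_on {0..1} \<psi>" "\<And>t. t \<in> {0..1} \<Longrightarrow> \<bar>\<psi> t\<bar> \<le> b" using test by (auto simp: test_fun_def)
    have b: "0 \<le> b" using test by (rule test_fun_nonneg)
    obtain S0 where S0: "finite S0" "\<And>t. t \<in> {0<..<1} - S0 \<Longrightarrow> (\<psi> has_real_derivative \<eta> t) (at t)"
      using test by (auto simp: test_fun_def)
    have H01: "H t \<in> {0..1}" if "t \<in> {p..q}" for t using H(5) [OF that] P by auto
    define u where "u = (\<lambda>t. \<psi> (H t) * v t)"
    \<comment> \<open>The slope of the affine interpolation of the boundary values of \<open>u\<close>.\<close>
    define s where "s = (u q - u p) / (q - p)"
    define w0 where "w0 = (\<lambda>t. u t - (u p + s * (t - p)))"
    define w where "w = (\<lambda>t. w0 (max p (min q t)))"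
    define \<rho> where "\<rho> = (\<lambda>t. indicator {p<..<q} t *\<^sub>R (s - \<psi> (H t) * v' t))"
    define S where "S = H -` S0 \<inter> {p<..<q}"
    have contH: "continuous_on X (\<lambda>t. \<psi> (H t))" if "X \<subseteq> {p..q}" for X
      by (rule continuous_on_compose2 [OF \<psi>(1) continuous_on_subset [OF H(1) that]]) (use H01 that in auto)
    have u_le: "\<bar>u t\<bar> \<le> r * b" if "t \<in> {p..q}" for t
    proof -
      have "\<bar>\<psi> (H t)\<bar> * \<bar>v t\<bar> \<le> b * r"
        using \<psi>(2) [OF H01 [OF that]] H(4) [OF that] b by (intro mult_mono) auto
      then show ?thesis by (simp add: u_def abs_mult mult.commute)
    qed
    have pq: "p \<in> {p..q}" "q \<in> {p..q}" using assms(2) by auto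
    have s_le: "\<bar>s\<bar> \<le> 2 * r * b / (q - p)"
    proof -
      have "\<bar>u q - u p\<bar> \<le> 2 * r * b" using u_le [OF pq(1)] u_le [OF pq(2)] by linarith
      then show ?thesis using assms(2) by (simp add: s_def abs_divide divide_right_mono)
    qed
    have w0_ends: "w0 p = 0" "w0 q = 0" using assms(2) by (auto simp: w0_def s_def)
    have w0_le: "\<bar>w0 t\<bar> \<le> 2 * r * b" if t: "t \<in> {p..q}" for t
    proof -
      define \<theta> where "\<theta> = (t - p) / (q - p)"
      have \<theta>: "0 \<le> \<theta>" "\<theta> \<le> 1" using t assms(2) by (auto simp: \<theta>_def)
      have "s * (t - p) = \<theta> * (u q - u p)" by (simp add: s_def \<theta>_def)
      then have "u p + s * (t - p) = (1 - \<theta>) * u p + \<theta> * u q"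
        by (simp add: algebra_simps)
      moreover have "\<bar>(1 - \<theta>) * u p + \<theta> * u q\<bar> \<le> (1 - \<theta>) * (r * b) + \<theta> * (r * b)"
        by (rule order_trans [OF abs_triangle_ineq])
          (use \<theta> u_le [OF pq(1)] u_le [OF pq(2)] in \<open>auto simp: abs_mult intro!: add_mono mult_left_mono\<close>)
      moreover have "(1 - \<theta>) * (r * b) + \<theta> * (r * b) = r * b" by (simp add: left_diff_distrib)
      ultimately show ?thesis using u_le [OF t] unfolding w0_def by linarith
    qed
    have contw0: "continuous_on {p..q} w0"
      unfolding w0_def u_def by (intro continuous_intros contH H) auto
    have contw: "continuous_on UNIV w" unfolding w_def
      by (rule continuous_on_compose2 [OF contw0]) (use assms(2) in \<open>auto intro!: continuous_intros\<close>)
    have out: "w t = 0 \<and> \<rho> t = 0" if "t \<notin> {p<..<q}" for t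
    proof (cases "t \<le> p")
      case True
      then have "max p (min q t) = p" using assms(2) by auto
      then show ?thesis using w0_ends that by (simp add: w_def \<rho>_def)
    next
      case False
      then have "q \<le> t" using that by auto
      then have "max p (min q t) = q" using assms(2) by auto
      then show ?thesis using w0_ends that by (simp add: w_def \<rho>_def)
    qed
    have bnd: "\<bar>w t\<bar> \<le> 2 * r * b \<and> \<bar>\<rho> t\<bar> \<le> C * b" for t
    proof
      show "\<bar>w t\<bar> \<le> 2 * r * b" unfolding w_def using assms(2) by (intro w0_le) auto
      show "\<bar>\<rho> t\<bar> \<le> C * b"
      proof (cases "t \<in> {p<..<q}")
        case True
        then have "\<bar>\<psi> (H t)\<bar> * \<bar>v' t\<bar> \<le> b * K"
          using \<psi>(2) [OF H01 [of t]] H'(5) [OF True] b by (intro mult_mono) auto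
        then have "\<bar>s - \<psi> (H t) * v' t\<bar> \<le> 2 * r * b / (q - p) + b * K"
          using s_le abs_triangle_ineq4 [of s "\<psi> (H t) * v' t"] by (simp add: abs_mult)
        also have "\<dots> = C * b" by (simp add: C_def distrib_right)
        finally show ?thesis using True by (simp add: \<rho>_def)
      next
        case False then show ?thesis using \<open>0 \<le> C\<close> b by (simp add: \<rho>_def)
      qed
    qed
    have meas: "\<rho> \<in> borel_measurable borel"
      unfolding \<rho>_def
    proof (rule borel_measurable_continuous_on_indicator)
      show "continuous_on {p<..<q} (\<lambda>t. s - \<psi> (H t) * v' t)"
        by (intro continuous_intros contH H) auto
    qed simp
    have finS: "finite S" unfolding S_def by (rule finite_vimage_IntI [OF S0(1) P(5)])
    have der: "(w has_real_derivative (\<eta> (h t) - \<rho> t)) (at t)" if "t \<in> {p<..<q} - S" for t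
    proof -
      have t: "t \<in> {p<..<q}" "H t \<notin> S0" using that by (auto simp: S_def)
      have "H t \<in> {P<..<Q}" using P(4) t(1) by blast
      then have "H t \<in> {0<..<1} - S0" using P t(2) by auto
      then have "(\<psi> has_real_derivative \<eta> (H t)) (at (H t))" by (rule S0(2))
      from DERIV_chain2 [OF this H'(3) [OF t(1)]]
      have "((\<lambda>t. \<psi> (H t)) has_real_derivative \<eta> (H t) * (1 / v t)) (at t)" .
      from DERIV_mult [OF this H'(4) [OF t(1)]]
      have "(u has_real_derivative (\<eta> (H t) * (1 / v t)) * v t + v' t * \<psi> (H t)) (at t)"
        unfolding u_def by (simp add: mult.commute)
      moreover have "((\<lambda>t. u p + s * (t - p)) has_real_derivative s) (at t)"
        by (auto intro!: derivative_eq_intros)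
      ultimately have "(w0 has_real_derivative ((\<eta> (H t) * (1 / v t)) * v t + v' t * \<psi> (H t)) - s) (at t)"
        unfolding w0_def by (rule DERIV_diff)
      moreover have "((\<eta> (H t) * (1 / v t)) * v t + v' t * \<psi> (H t)) - s = \<eta> (h t) - \<rho> t"
        using t(1) H'(1,2) [OF t(1)] by (simp add: \<rho>_def)
      ultimately have d: "(w0 has_real_derivative \<eta> (h t) - \<rho> t) (at t)" by simp
      show ?thesis
        by (rule has_field_derivative_transform_within_open [OF d, of "{p<..<q}"]) (use t(1) in \<open>auto simp: w_def\<close>)
    qed
    show ?thesis using contw out bnd meas finS der by blast
  qed
  ultimately show thesis using that by blast
qed

definition gaps :: "real set \<Rightarrow> (real \<times> real) set" where
  "gaps D = {(p, q) \<in> D \<times> D. p < q \<and> {p<..<q} \<inter> D = {}}"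

lemma finite_gaps: "finite D \<Longrightarrow> finite (gaps D)"
  unfolding gaps_def by (rule finite_subset [of _ "D \<times> D"]) auto

lemma gaps_unique:
  assumes "(p, q) \<in> gaps D" "(p', q') \<in> gaps D" "t \<in> {p<..<q}" "t \<in> {p'<..<q'}"
  shows "(p, q) = (p', q')"
proof -
  have g: "p \<in> D" "q \<in> D" "p' \<in> D" "q' \<in> D" "\<And>x. x \<in> D \<Longrightarrow> \<not> (p < x \<and> x < q)" "\<And>x. x \<in> D \<Longrightarrow> \<not> (p' < x \<and> x < q')"
    using assms(1,2) unfolding gaps_def by (auto simp: disjoint_iff)
  have "p = p'" using g(5) [OF g(3)] g(6) [OF g(1)] assms(3,4) by auto
  moreover have "q = q'" using g(5) [OF g(4)] g(6) [OF g(2)] assms(3,4) by auto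
  ultimately show ?thesis by simp
qed

lemma gaps_cover:
  assumes "finite D" "a \<in> D" "b \<in> D" "a < t" "t < b" "t \<notin> D"
  obtains p q where "(p, q) \<in> gaps D" "p < t" "t < q" "a \<le> p" "q \<le> b"
proof -
  define p where "p = Max {d \<in> D. d < t}"
  define q where "q = Min {d \<in> D. t < d}"
  have f: "finite {d \<in> D. d < t}" "finite {d \<in> D. t < d}" "{d \<in> D. d < t} \<noteq> {}" "{d \<in> D. t < d} \<noteq> {}"
    using assms by auto
  have p: "p \<in> D" "p < t" "\<And>d. d \<in> D \<Longrightarrow> d < t \<Longrightarrow> d \<le> p"
    using Max_in [OF f(1,3)] Max_ge [OF f(1)] by (auto simp: p_def)
  have q: "q \<in> D" "t < q" "\<And>d. d \<in> D \<Longrightarrow> t < d \<Longrightarrow> q \<le> d"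
    using Min_in [OF f(2,4)] Min_le [OF f(2)] by (auto simp: q_def)
  have "\<not> (p < d \<and> d < q)" if "d \<in> D" for d
    using p(3) [OF that] q(3) [OF that] that assms(6) by (cases "d < t"; cases "t < d") auto
  then have "(p, q) \<in> gaps D" using p q by (auto simp: gaps_def)
  moreover have "a \<le> p" "q \<le> b" using p(3) q(3) assms by auto
  ultimately show thesis using that p q by blast
qed

text \<open>
  This is the dual form of the Lasota-Yorke inequality for the transfer operator of \<open>h\<close>. The
  functions obtained on the pieces vanish at the ends of the pieces. They therefore fit together
  to a continuous function, and the bound \<open>2 * r * b\<close> of a single piece holds for all of them
  together.
\<close>

lemma lasota_yorke:
  assumes h: "piecewise_expanding h r" "h \<in> borel_measurable borel" and r0: "0 \<le> r"
  obtains C where "0 \<le> C" "\<And>b \<psi> \<eta>. test_fun b \<psi> \<eta> \<Longrightarrow> \<exists>\<xi> \<rho>. test_fun (2 * r * b) \<xi> (\<lambda>t. \<eta> (h t) - \<rho> t) \<and>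
     \<rho> \<in> borel_measurable borel \<and> (\<forall>t. \<bar>\<rho> t\<bar> \<le> C * b)"
proof -
  obtain D0 where D0: "finite D0" "\<And>p q. 0 \<le> p \<Longrightarrow> p < q \<Longrightarrow> q \<le> 1 \<Longrightarrow> {p<..<q} \<inter> D0 = {} \<Longrightarrow> expanding_piece h r p q"
    using h(1) unfolding piecewise_expanding_def by blast
  define D where "D = (D0 \<inter> {0..1}) \<union> {0, 1}"
  have D: "finite D" "0 \<in> D" "1 \<in> D" "D \<subseteq> {0..1}" using D0(1) by (auto simp: D_def)
  define G where "G = gaps D"
  have finG: "finite G" using finite_gaps D(1) by (simp add: G_def)
  have G01: "0 \<le> fst g \<and> fst g < snd g \<and> snd g \<le> 1 \<and> {fst g<..<snd g} \<inter> D = {}" if "g \<in> G" for g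
    using that D(4) by (auto simp: G_def gaps_def)
  define P where "P = (\<lambda>g C b \<eta> w \<rho> S. continuous_on UNIV w \<and> (\<forall>t. t \<notin> {fst g<..<snd g} \<longrightarrow> w t = 0 \<and> \<rho> t = 0) \<and>
     (\<forall>t. \<bar>w t\<bar> \<le> 2 * r * b \<and> \<bar>\<rho> t\<bar> \<le> C * b) \<and> \<rho> \<in> borel_measurable borel \<and> finite S \<and>
     (\<forall>t\<in>{fst g<..<snd g} - S. (w has_real_derivative (\<eta> (h t) - \<rho> t)) (at t)))"
  have "\<exists>C. g \<in> G \<longrightarrow> 0 \<le> C \<and> (\<forall>b \<psi> \<eta>. test_fun b \<psi> \<eta> \<longrightarrow> (\<exists>w \<rho> S. P g C b \<eta> w \<rho> S))" for g
  proof (cases "g \<in> G")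
    case True
    then have "{fst g<..<snd g} \<inter> D0 = {}" using G01 [OF True] by (auto simp: D_def)
    then have "expanding_piece h r (fst g) (snd g)" using G01 [OF True] by (intro D0(2)) auto
    then show ?thesis
      by (rule expanding_piece_pullback) (use G01 [OF True] in \<open>auto simp: P_def\<close>)
  qed auto
  then obtain Cg where Cg: "\<And>g. g \<in> G \<Longrightarrow> 0 \<le> Cg g" "\<And>g b \<psi> \<eta>. g \<in> G \<Longrightarrow> test_fun b \<psi> \<eta> \<Longrightarrow> \<exists>w \<rho> S. P g (Cg g) b \<eta> w \<rho> S"
    by metis
  define C where "C = sum Cg G"
  have "0 \<le> C" using Cg(1) by (simp add: C_def sum_nonneg)
  have Cg_le: "Cg g \<le> C" if "g \<in> G" for g
    unfolding C_def by (rule member_le_sum) (use that Cg finG in auto)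
  have "\<exists>\<xi> \<rho>. test_fun (2 * r * b) \<xi> (\<lambda>t. \<eta> (h t) - \<rho> t) \<and>
     \<rho> \<in> borel_measurable borel \<and> (\<forall>t. \<bar>\<rho> t\<bar> \<le> C * b)" if test: "test_fun b \<psi> \<eta>" for b \<psi> \<eta>
  proof -
    have b: "0 \<le> b" using test by (rule test_fun_nonneg)
    have "\<forall>g\<in>G. \<exists>w \<rho> S. P g (Cg g) b \<eta> w \<rho> S" using Cg(2) test by blast
    then obtain w \<rho> S where P: "\<And>g. g \<in> G \<Longrightarrow> P g (Cg g) b \<eta> (w g) (\<rho> g) (S g)" by metis
    have w: "continuous_on UNIV (w g)" "\<And>t. t \<notin> {fst g<..<snd g} \<Longrightarrow> w g t = 0" "\<And>t. \<bar>w g t\<bar> \<le> 2 * r * b"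
      and \<rho>: "\<And>t. t \<notin> {fst g<..<snd g} \<Longrightarrow> \<rho> g t = 0" "\<And>t. \<bar>\<rho> g t\<bar> \<le> Cg g * b" "\<rho> g \<in> borel_measurable borel"
      and S: "finite (S g)"
        "\<And>t. t \<in> {fst g<..<snd g} - S g \<Longrightarrow> (w g has_real_derivative (\<eta> (h t) - \<rho> g t)) (at t)"
      if "g \<in> G" for g
      using P [OF that] unfolding P_def by blast+
    define \<xi> where "\<xi> = (\<lambda>t. \<Sum>g\<in>G. w g t)"
    define R where "R = (\<lambda>t. \<Sum>g\<in>G. \<rho> g t)"
    have uniq: "g = g'" if "g \<in> G" "g' \<in> G" "t \<in> {fst g<..<snd g}" "t \<in> {fst g'<..<snd g'}" for g g' t
      using gaps_unique [of "fst g" "snd g" D "fst g'" "snd g'" t] that by (simp add: G_def prod_eq_iff)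
    have single: "\<xi> t = w g t" "R t = \<rho> g t" if g: "g \<in> G" "t \<in> {fst g<..<snd g}" for g t
      unfolding \<xi>_def R_def
      by (rule sum_eq_single [OF finG g(1)], metis w(2) uniq g, rule sum_eq_single [OF finG g(1)], metis \<rho>(1) uniq g)
    have zero: "\<xi> t = 0" "R t = 0" if "\<And>g. g \<in> G \<Longrightarrow> t \<notin> {fst g<..<snd g}" for t
      unfolding \<xi>_def R_def using that w(2) \<rho>(1) by (simp_all add: sum.neutral)
    have R_le: "\<bar>R t\<bar> \<le> C * b" for t
    proof (cases "\<exists>g\<in>G. t \<in> {fst g<..<snd g}")
      case True
      then obtain g where g: "g \<in> G" "t \<in> {fst g<..<snd g}" by blast
      have "\<bar>R t\<bar> \<le> Cg g * b" using single(2) [OF g] \<rho>(2) [OF g(1)] by simp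
      also have "\<dots> \<le> C * b" using Cg_le [OF g(1)] b by (rule mult_right_mono)
      finally show ?thesis .
    next
      case False then show ?thesis using zero(2) [of t] \<open>0 \<le> C\<close> b by (auto intro: mult_nonneg_nonneg)
    qed
    have R_meas: "R \<in> borel_measurable borel" unfolding R_def using \<rho>(3) by (intro borel_measurable_sum) auto
    have r: "0 \<le> 2 * r * b" using r0 b by simp
    have \<xi>_le: "\<bar>\<xi> t\<bar> \<le> 2 * r * b" for t
    proof (cases "\<exists>g\<in>G. t \<in> {fst g<..<snd g}")
      case True
      then obtain g where g: "g \<in> G" "t \<in> {fst g<..<snd g}" by blast
      then show ?thesis using single(1) [OF g] w(3) [OF g(1)] by simp
    next
      case False then show ?thesis using zero(1) [of t] r by auto
    qed
    obtain B where B: "\<And>t. \<bar>\<eta> t\<bar> \<le> B" using test_fun_bounded [OF test] by blast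
    have "test_fun (2 * r * b) \<xi> (\<lambda>t. \<eta> (h t) - R t)"
      unfolding test_fun_def
    proof (intro conjI)
      show "continuous_on {0..1} \<xi>" unfolding \<xi>_def
        by (intro continuous_on_sum continuous_on_subset [OF w(1)]) auto
      show "\<xi> 0 = 0" by (rule zero(1)) (use G01 in \<open>auto simp: not_less\<close>)
      show "\<xi> 1 = 0" by (rule zero(1)) (use G01 in \<open>auto simp: not_less\<close>)
      show "\<forall>t\<in>{0..1}. \<bar>\<xi> t\<bar> \<le> 2 * r * b" using \<xi>_le by blast
      show "\<exists>S. finite S \<and> (\<forall>t\<in>{0<..<1} - S. (\<xi> has_real_derivative \<eta> (h t) - R t) (at t))"
      proof (intro exI conjI ballI)
        show "finite (D \<union> (\<Union>g\<in>G. S g))" using D(1) finG S(1) by auto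
        fix t assume t: "t \<in> {0<..<1} - (D \<union> (\<Union>g\<in>G. S g))"
        obtain p q where "(p, q) \<in> gaps D" "p < t" "t < q" by (rule gaps_cover [OF D(1-3), of t]) (use t in auto)
        then have g: "(p, q) \<in> G" "t \<in> {fst (p, q)<..<snd (p, q)}" by (auto simp: G_def)
        define g where "g = (p, q)"
        note g = g [folded g_def]
        have "(w g has_real_derivative (\<eta> (h t) - \<rho> g t)) (at t)" using S(2) [OF g(1), of t] g t by auto
        then have "(\<xi> has_real_derivative (\<eta> (h t) - \<rho> g t)) (at t)"
          by (rule has_field_derivative_transform_within_open [of _ _ _ "{fst g<..<snd g}"])
            (use g(2) single(1) [OF g(1)] in simp_all)
        then show "(\<xi> has_real_derivative \<eta> (h t) - R t) (at t)" using single(2) [OF g] by simp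
      qed
      have "\<eta> \<in> borel_measurable borel" using test by (simp add: test_fun_def)
      then have "(\<lambda>t. \<eta> (h t)) \<in> borel_measurable borel" using h(2) by (rule measurable_compose [rotated])
      then show "(\<lambda>t. \<eta> (h t) - R t) \<in> borel_measurable borel" using R_meas by (rule borel_measurable_diff)
      have "\<bar>\<eta> (h t) - R t\<bar> \<le> B + C * b" for t
        using B [of "h t"] R_le [of t] by linarith
      then show "\<exists>B. \<forall>t. \<bar>\<eta> (h t) - R t\<bar> \<le> B" by blast
    qed
    then show ?thesis using R_meas R_le by blast
  qed
  then show thesis by (rule that [OF \<open>0 \<le> C\<close>])
qed

text \<open>
  For \<open>r \<le> 1/4\<close> each step halves the bound on the test function and adds a remainder of at most
  \<open>C * b\<close>. The remainders add up to a geometric series.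
\<close>

lemma lasota_yorke_iterate:
  fixes h :: "real \<Rightarrow> real"
  assumes h: "piecewise_expanding h r" "h \<in> borel_measurable borel" and r: "0 \<le> r" "r \<le> 1/4"
  shows "\<exists>C\<ge>0. \<forall>Q V n. Q \<in> sets borel \<and> 0 \<le> V \<and>
     (\<forall>b \<psi> \<eta>. test_fun b \<psi> \<eta> \<longrightarrow> \<bar>\<integral>x. indicator Q x * \<eta> x \<partial>unit_leb\<bar> \<le> V * b) \<longrightarrow>
     (\<forall>b \<psi> \<eta>. test_fun b \<psi> \<eta> \<longrightarrow> \<bar>\<integral>x. indicator Q x * \<eta> ((h ^^ n) x) \<partial>unit_leb\<bar> \<le> (V / 2 ^ n + 2 * C) * b)"
proof -
  obtain C where C: "0 \<le> C" "\<And>b \<psi> \<eta>. test_fun b \<psi> \<eta> \<Longrightarrow> \<exists>\<xi> \<rho>. test_fun (2 * r * b) \<xi> (\<lambda>t. \<eta> (h t) - \<rho> t) \<and>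
     \<rho> \<in> borel_measurable borel \<and> (\<forall>t. \<bar>\<rho> t\<bar> \<le> C * b)"
    using lasota_yorke [OF h r(1)] by blast
  have hn: "h ^^ n \<in> borel_measurable borel" for n
    using h(2) by (rule measurable_compose_n)
  have main: "\<bar>\<integral>x. indicator Q x * \<eta> ((h ^^ n) x) \<partial>unit_leb\<bar> \<le> (V / 2 ^ n + 2 * C) * b"
    if Q: "Q \<in> sets borel"
      and V: "\<And>b \<psi> \<eta>. test_fun b \<psi> \<eta> \<Longrightarrow> \<bar>\<integral>x. indicator Q x * \<eta> x \<partial>unit_leb\<bar> \<le> V * b" "0 \<le> V"
      and test: "test_fun b \<psi> \<eta>" for Q V n b \<psi> \<eta>
    using test
  proof (induction n arbitrary: b \<psi> \<eta>)
    case 0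
    have "0 \<le> b" using 0 by (rule test_fun_nonneg)
    then have "V * b \<le> (V + 2 * C) * b" using C(1) by (intro mult_right_mono) auto
    then show ?case using V(1) [OF 0] by simp
  next
    case (Suc n)
    have b: "0 \<le> b" using Suc.prems by (rule test_fun_nonneg)
    obtain \<xi> \<rho> where \<xi>: "test_fun (2 * r * b) \<xi> (\<lambda>t. \<eta> (h t) - \<rho> t)" and \<rho>: "\<rho> \<in> borel_measurable borel" "\<And>t. \<bar>\<rho> t\<bar> \<le> C * b"
      using C(2) [OF Suc.prems] by blast
    define \<eta>' where "\<eta>' = (\<lambda>t. \<eta> (h t) - \<rho> t)"
    obtain B where B: "\<And>t. \<bar>\<eta>' t\<bar> \<le> B" using test_fun_bounded [OF \<xi>] by (auto simp: \<eta>'_def)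
    have meas: "\<eta>' \<in> borel_measurable borel" using \<xi> by (simp add: test_fun_def \<eta>'_def)
    have int: "integrable unit_leb (\<lambda>x. indicator Q x * u ((h ^^ n) x))"
      if "u \<in> borel_measurable borel" "\<And>t. \<bar>u t\<bar> \<le> m" for u and m :: real
    proof (rule integrable_unit_leb [of _ "m"])
      have "(\<lambda>x. u ((h ^^ n) x)) \<in> borel_measurable borel" using hn that(1) by (rule measurable_compose)
      then have "(\<lambda>x. indicator Q x * u ((h ^^ n) x)) \<in> borel_measurable borel"
        using Q by (intro borel_measurable_times) auto
      then show "(\<lambda>x. indicator Q x * u ((h ^^ n) x)) \<in> borel_measurable unit_leb"
        by (rule measurable_unit_leb)
      show "\<bar>indicator Q x * u ((h ^^ n) x)\<bar> \<le> m" for x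
      proof -
        have "0 \<le> m" using that(2) [of 0] by linarith
        then show ?thesis using that(2) [of "(h ^^ n) x"] by (auto simp: indicator_def)
      qed
    qed
    have "(\<integral>x. indicator Q x * \<eta> ((h ^^ Suc n) x) \<partial>unit_leb)
        = (\<integral>x. indicator Q x * \<eta>' ((h ^^ n) x) + indicator Q x * \<rho> ((h ^^ n) x) \<partial>unit_leb)"
      by (simp add: \<eta>'_def algebra_simps)
    also have "\<dots> = (\<integral>x. indicator Q x * \<eta>' ((h ^^ n) x) \<partial>unit_leb) + (\<integral>x. indicator Q x * \<rho> ((h ^^ n) x) \<partial>unit_leb)"
      by (rule Bochner_Integration.integral_add [OF int [OF meas B] int [OF \<rho>]])
    finally have split: "(\<integral>x. indicator Q x * \<eta> ((h ^^ Suc n) x) \<partial>unit_leb) = \<dots>" .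
    have 1: "\<bar>\<integral>x. indicator Q x * \<eta>' ((h ^^ n) x) \<partial>unit_leb\<bar> \<le> (V / 2 ^ n + 2 * C) * (2 * r * b)"
      using Suc.IH [OF \<xi>] by (simp add: \<eta>'_def)
    have "(2 * r) * b \<le> (1/2) * b" using r b by (intro mult_right_mono) auto
    then have "2 * r * b \<le> b / 2" by simp
    then have 2: "(V / 2 ^ n + 2 * C) * (2 * r * b) \<le> (V / 2 ^ n + 2 * C) * (b / 2)"
      using V(2) C(1) by (intro mult_left_mono) auto
    have "\<bar>\<integral>x. indicator Q x * \<rho> ((h ^^ n) x) \<partial>unit_leb\<bar> \<le> (\<integral>x. \<bar>indicator Q x * \<rho> ((h ^^ n) x)\<bar> \<partial>unit_leb)"
      by (rule integral_abs_bound)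
    also have "\<dots> \<le> (\<integral>x. C * b \<partial>unit_leb)"
    proof (rule integral_mono)
      show "integrable unit_leb (\<lambda>x. \<bar>indicator Q x * \<rho> ((h ^^ n) x)\<bar>)" by (intro integrable_abs int [OF \<rho>])
      have "0 \<le> C * b" using C(1) b by simp
      then show "\<bar>indicator Q x * \<rho> ((h ^^ n) x)\<bar> \<le> C * b" for x
        using \<rho>(2) [of "(h ^^ n) x"] by (auto simp: indicator_def)
    qed simp
    also have "\<dots> = C * b" using measure_unit_leb [of "{0..<1}"] by simp
    finally have 3: "\<bar>\<integral>x. indicator Q x * \<rho> ((h ^^ n) x) \<partial>unit_leb\<bar> \<le> C * b" .
    have "(V / 2 ^ n + 2 * C) * (b / 2) + C * b = (V / 2 ^ Suc n + 2 * C) * b" by (simp add: algebra_simps)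
    then show ?case unfolding split using 1 2 3 by linarith
  qed
  show ?thesis
  proof (intro exI [of _ C] conjI allI impI)
    show "0 \<le> C" by (fact C(1))
    fix Q V n b \<psi> \<eta>
    assume Q: "Q \<in> sets borel \<and> 0 \<le> V \<and>
      (\<forall>b \<psi> \<eta>. test_fun b \<psi> \<eta> \<longrightarrow> \<bar>\<integral>x. indicator Q x * \<eta> x \<partial>unit_leb\<bar> \<le> V * b)"
      and t: "test_fun b \<psi> \<eta>"
    show "\<bar>\<integral>x. indicator Q x * \<eta> ((h ^^ n) x) \<partial>unit_leb\<bar> \<le> (V / 2 ^ n + 2 * C) * b"
      by (rule main [OF _ _ _ t]) (use Q in blast)+
  qed
qed

lemma test_fun_cells_bound:
  assumes L: "0 < L" "finite J" "J \<subseteq> {0..<int L}" and test: "test_fun b \<psi> \<eta>"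
  shows "\<bar>\<integral>x. indicator (cells L J) x * \<eta> x \<partial>unit_leb\<bar> \<le> (2 * real L) * b"
proof -
  obtain B where B: "\<And>t. \<bar>\<eta> t\<bar> \<le> B" using test_fun_bounded [OF test] by blast
  have meas: "\<eta> \<in> borel_measurable borel" using test by (simp add: test_fun_def)
  have B0: "0 \<le> B" using B [of 0] by linarith
  have b: "0 \<le> b" using test by (rule test_fun_nonneg)
  have "(\<integral>x. indicator (cells L J) x * \<eta> x \<partial>unit_leb) = (\<integral>x. (\<Sum>j\<in>J. indicator (cells L {j}) x * \<eta> x) \<partial>unit_leb)"
  proof (rule Bochner_Integration.integral_cong [OF refl])
    fix x
    have "(indicator (cells L J) x :: real) = (\<Sum>j\<in>J. indicator (cells L {j}) x)"
    proof (cases "\<lfloor>real L * x\<rfloor> \<in> J")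
      case True
      then have "(\<Sum>j\<in>J. indicator (cells L {j}) x :: real) = indicator (cells L {\<lfloor>real L * x\<rfloor>}) x"
        by (intro sum_eq_single L) (auto simp: cells_def)
      then show ?thesis using True by (simp add: cells_def)
    next
      case False
      then have "(\<Sum>j\<in>J. indicator (cells L {j}) x :: real) = 0"
        by (intro sum.neutral) (auto simp: cells_def indicator_def)
      then show ?thesis using False by (simp add: cells_def)
    qed
    then show "indicator (cells L J) x * \<eta> x = (\<Sum>j\<in>J. indicator (cells L {j}) x * \<eta> x)"
      by (simp add: sum_distrib_right)
  qed
  also have "\<dots> = (\<Sum>j\<in>J. \<integral>x. indicator (cells L {j}) x * \<eta> x \<partial>unit_leb)"
  proof (rule Bochner_Integration.integral_sum)
    fix j
    have "(\<lambda>x. indicator (cells L {j}) x * \<eta> x) \<in> borel_measurable borel"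
      using meas L(1) by (intro borel_measurable_times) auto
    then show "integrable unit_leb (\<lambda>x. indicator (cells L {j}) x * \<eta> x)"
      by (intro integrable_unit_leb [of _ B] measurable_unit_leb) (use B B0 in \<open>auto simp: indicator_def\<close>)
  qed
  also have "\<bar>\<dots>\<bar> \<le> (\<Sum>j\<in>J. \<bar>\<integral>x. indicator (cells L {j}) x * \<eta> x \<partial>unit_leb\<bar>)" by (rule sum_abs)
  also have "\<dots> \<le> (\<Sum>j\<in>J. 2 * b)"
  proof (rule sum_mono)
    fix j assume "j \<in> J"
    then have "0 \<le> j" "j + 1 \<le> int L" using L(3) by auto
    then have j: "real_of_int 0 \<le> of_int j" "real_of_int (j + 1) \<le> real L" by linarith+
    define p q where "p = of_int j / real L" and "q = (of_int j + 1) / real L"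
    have pq: "0 \<le> p" "p \<le> q" "q \<le> 1" using j L(1) by (auto simp: p_def q_def divide_right_mono)
    have "(\<integral>x. indicator (cells L {j}) x * \<eta> x \<partial>unit_leb) = \<psi> q - \<psi> p"
      unfolding cells_singleton [OF L(1)] using integral_derivative_interval [OF test pq] by (simp add: p_def q_def)
    moreover have "\<bar>\<psi> p\<bar> \<le> b" "\<bar>\<psi> q\<bar> \<le> b" using test pq by (auto simp: test_fun_def)
    ultimately show "\<bar>\<integral>x. indicator (cells L {j}) x * \<eta> x \<partial>unit_leb\<bar> \<le> 2 * b" by linarith
  qed
  also have "\<dots> = 2 * real (card J) * b" by simp
  also have "\<dots> \<le> 2 * real L * b"
  proof -
    have "card J \<le> card {0..<int L}" using L(3) by (intro card_mono) auto
    then show ?thesis using b by (intro mult_right_mono mult_left_mono) auto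
  qed
  finally show ?thesis .
qed

lemma distr_funpow_unit_leb:
  assumes "h \<in> measurable unit_leb unit_leb" "distr unit_leb unit_leb h = unit_leb"
  shows "h ^^ n \<in> measurable unit_leb unit_leb \<and> distr unit_leb unit_leb (h ^^ n) = unit_leb"
proof (induction n)
  case 0
  have "distr unit_leb unit_leb id = unit_leb" by (simp add: distr_id id_def)
  then show ?case by simp
next
  case (Suc n)
  have "distr unit_leb unit_leb (h \<circ> h ^^ n) = distr (distr unit_leb unit_leb (h ^^ n)) unit_leb h"
    by (rule distr_distr [symmetric]) (use Suc assms in auto)
  also have "\<dots> = unit_leb" using Suc assms by simp
  finally have "distr unit_leb unit_leb (h \<circ> h ^^ n) = unit_leb" .
  moreover have "h \<circ> h ^^ n \<in> measurable unit_leb unit_leb" using Suc assms(1) by (auto intro: measurable_comp)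
  ultimately show ?case unfolding funpow.simps(2) by blast
qed

text \<open>
  By invariance, integrals over \<open>B n\<close> against \<open>\<eta>\<close> are integrals over \<open>A\<close> against \<open>\<eta> \<circ> h ^^ n\<close>.
  Up to a small error \<open>A\<close> is a finite union of cells, and its variation, however large, is
  forgotten under iteration. For large \<open>n\<close> the set \<open>B n\<close> thus has weak variation at most
  \<open>2 * C + 1\<close> up to a small error, where \<open>C\<close> is the constant of the iterated inequality. All
  sets \<open>B n\<close> have the measure of \<open>A\<close>, so the size \<open>N\<close> of the grid can be chosen from \<open>C\<close> and
  this measure alone.
\<close>

lemma tail_set_nearly_full_cell:
  assumes h: "piecewise_expanding h r" "h \<in> borel_measurable borel" "0 \<le> r" "r \<le> 1/4"
    and pres: "h \<in> measurable unit_leb unit_leb" "distr unit_leb unit_leb h = unit_leb"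
    and A: "A \<in> sets borel" "A \<subseteq> {0..<1}" "0 < measure lborel A"
    and B: "\<And>n. B n \<in> sets borel" "\<And>n. B n \<subseteq> {0..<1}" "\<And>n x. x \<in> {0..<1} \<Longrightarrow> x \<in> A \<longleftrightarrow> (h ^^ n) x \<in> B n"
  obtains N where "0 < N" "\<And>\<kappa>. 0 < \<kappa> \<Longrightarrow> \<exists>n0. \<forall>n\<ge>n0. \<exists>j\<in>{0..<int N}. measure lborel (cells N {j} - B n) \<le> \<kappa>"
proof -
  obtain C where C0: "0 \<le> C" and C: "\<forall>Q V n. Q \<in> sets borel \<and> 0 \<le> V \<and>
     (\<forall>b \<psi> \<eta>. test_fun b \<psi> \<eta> \<longrightarrow> \<bar>\<integral>x. indicator Q x * \<eta> x \<partial>unit_leb\<bar> \<le> V * b) \<longrightarrow>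
     (\<forall>b \<psi> \<eta>. test_fun b \<psi> \<eta> \<longrightarrow> \<bar>\<integral>x. indicator Q x * \<eta> ((h ^^ n) x) \<partial>unit_leb\<bar> \<le> (V / 2 ^ n + 2 * C) * b)"
    using lasota_yorke_iterate [OF h] by (elim exE conjE)
  define a where "a = measure lborel A"
  have a: "0 < a" using A by (simp add: a_def)
  \<comment> \<open>The summand \<open>1\<close> is for the initial variation, which is divided by \<open>2 ^ n\<close>.\<close>
  define K where "K = 2 * C + 1"
  obtain N0 :: nat where N0: "4 * (K + 1) / a < real N0" using reals_Archimedean2 by blast
  define N where "N = Suc N0"
  have N: "0 < N" "4 * (K + 1) \<le> a * N" using N0 a by (auto simp: N_def field_simps)
  have hn: "h ^^ n \<in> measurable unit_leb unit_leb" "distr unit_leb unit_leb (h ^^ n) = unit_leb" for n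
    using distr_funpow_unit_leb [OF pres] by blast+
  have change: "(\<integral>x. indicator (B n) x * \<eta> x \<partial>unit_leb) = (\<integral>x. indicator A x * \<eta> ((h ^^ n) x) \<partial>unit_leb)"
    if "\<eta> \<in> borel_measurable borel" for n and \<eta> :: "real \<Rightarrow> real"
  proof -
    have "(\<lambda>x. indicator (B n) x * \<eta> x) \<in> borel_measurable borel"
      using B(1) that by (intro borel_measurable_times) auto
    then have m: "(\<lambda>x. indicator (B n) x * \<eta> x) \<in> borel_measurable unit_leb" by (rule measurable_unit_leb)
    have "(\<integral>x. indicator (B n) x * \<eta> x \<partial>unit_leb) = (\<integral>x. indicator (B n) x * \<eta> x \<partial>distr unit_leb unit_leb (h ^^ n))"
      using hn(2) by simp
    also have "\<dots> = (\<integral>x. indicator (B n) ((h ^^ n) x) * \<eta> ((h ^^ n) x) \<partial>unit_leb)"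
      by (rule integral_distr [OF hn(1) m])
    also have "\<dots> = (\<integral>x. indicator A x * \<eta> ((h ^^ n) x) \<partial>unit_leb)"
      by (rule Bochner_Integration.integral_cong) (use B(3) in \<open>auto simp: indicator_def\<close>)
    finally show ?thesis .
  qed
  have mB: "measure lborel (B n) = a" for n
    using change [of "\<lambda>_. 1" n] integral_indicator_unit_leb [OF B(1,2)] integral_indicator_unit_leb [OF A(1,2)]
    by (simp add: a_def)
  have "\<exists>n0. \<forall>n\<ge>n0. \<exists>j\<in>{0..<int N}. measure lborel (cells N {j} - B n) \<le> \<kappa>" if \<kappa>: "0 < \<kappa>" for \<kappa>
  proof -
    define \<kappa>' where "\<kappa>' = min (\<kappa> / 2) (min (a / 4) (1 / 2))"
    have \<kappa>': "0 < \<kappa>'" "\<kappa>' \<le> 1/2" "\<kappa>' \<le> a / 4" "2 * \<kappa>' \<le> \<kappa>" using \<kappa> a by (auto simp: \<kappa>'_def)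
    define \<epsilon> where "\<epsilon> = \<kappa>' / (6 * N)"
    have \<epsilon>: "0 < \<epsilon>" "6 * \<epsilon> * N \<le> \<kappa>'" using \<kappa>' N by (auto simp: \<epsilon>_def)
    obtain L J where L: "0 < L" "finite J" "J \<subseteq> {0..<int L}" "measure lborel (A - cells L J) \<le> \<epsilon> / 2"
      "measure lborel (cells L J - A) \<le> \<epsilon> / 2" "cells L J \<subseteq> {0..<1}"
      using cells_approx [OF A(1,2), of "\<epsilon> / 2"] \<epsilon>(1) by auto
    define Q where "Q = cells L J"
    have Qb: "Q \<in> sets borel" using L by (simp add: Q_def)
    obtain n0 :: nat where n0: "2 * real L < 2 ^ n0" using real_arch_pow [of 2 "2 * real L"] by auto
    have "\<exists>j\<in>{0..<int N}. measure lborel (cells N {j} - B n) \<le> \<kappa>" if n: "n \<ge> n0" for n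
    proof -
      have "(2::real) ^ n0 \<le> 2 ^ n" using n by (intro power_increasing) auto
      then have "2 * real L \<le> 2 ^ n" using n0 by linarith
      then have V: "2 * real L / 2 ^ n \<le> 1" by simp
      have var: "\<bar>\<integral>x. indicator (B n) x * \<eta> x \<partial>unit_leb\<bar> \<le> K * b + \<epsilon> * m"
        if t: "test_fun b \<psi> \<eta>" "\<And>t. \<bar>\<eta> t\<bar> \<le> m" for b \<psi> \<eta> m
      proof -
        have b: "0 \<le> b" using t(1) by (rule test_fun_nonneg)
        have m: "0 \<le> m" using t(2) [of 0] by linarith
        have meas: "\<eta> \<in> borel_measurable borel" using t(1) by (simp add: test_fun_def)
        have meas': "(\<lambda>x. \<eta> ((h ^^ n) x)) \<in> borel_measurable unit_leb"
          using hn(1) measurable_unit_leb [OF meas] by (rule measurable_compose)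
        have "\<bar>\<integral>x. indicator Q x * \<eta> ((h ^^ n) x) \<partial>unit_leb\<bar> \<le> (2 * real L / 2 ^ n + 2 * C) * b"
        proof (rule C [rule_format])
          show "Q \<in> sets borel \<and> 0 \<le> 2 * real L \<and>
              (\<forall>b \<psi> \<eta>. test_fun b \<psi> \<eta> \<longrightarrow> \<bar>\<integral>x. indicator Q x * \<eta> x \<partial>unit_leb\<bar> \<le> 2 * real L * b)"
            using test_fun_cells_bound [OF L(1-3)] Qb by (simp add: Q_def)
        qed (rule t(1))
        also have "\<dots> \<le> K * b" using V b by (intro mult_right_mono) (auto simp: K_def)
        finally have 1: "\<bar>\<integral>x. indicator Q x * \<eta> ((h ^^ n) x) \<partial>unit_leb\<bar> \<le> K * b" .
        have "\<bar>(\<integral>x. indicator A x * \<eta> ((h ^^ n) x) \<partial>unit_leb) - (\<integral>x. indicator Q x * \<eta> ((h ^^ n) x) \<partial>unit_leb)\<bar>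
            \<le> m * (measure lborel (A - Q) + measure lborel (Q - A))"
          using A Qb L(6) meas' t(2) by (intro integral_indicator_diff_le) (auto simp: Q_def)
        also have "\<dots> \<le> m * (\<epsilon> / 2 + \<epsilon> / 2)" using L m by (intro mult_left_mono add_mono) (auto simp: Q_def)
        finally have 2: "\<bar>(\<integral>x. indicator A x * \<eta> ((h ^^ n) x) \<partial>unit_leb) - (\<integral>x. indicator Q x * \<eta> ((h ^^ n) x) \<partial>unit_leb)\<bar> \<le> \<epsilon> * m"
          by (simp add: mult.commute)
        show ?thesis unfolding change [OF meas] using 1 2 by linarith
      qed
      have aB: "a \<le> measure lborel (B n)" using mB by simp
      obtain j where j: "j \<in> {0..<int N}" "measure lborel (cells N {j} - B n) \<le> 2 * \<kappa>'"
        by (rule weak_variation_nearly_full_cell [OF B(1,2) a aB N \<kappa>'(1-3) \<epsilon> var])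
      then have "measure lborel (cells N {j} - B n) \<le> \<kappa>" using \<kappa>'(4) by linarith
      then show ?thesis using j(1) by blast
    qed
    then show ?thesis by blast
  qed
  then show thesis by (rule that [OF N(1)])
qed

section \<open>The interval map of an expanding circle map\<close>

lemma continuous_on_Icc_bounded:
  fixes f :: "real \<Rightarrow> real"
  assumes "continuous_on {p..q} f"
  shows "\<exists>K. \<forall>t\<in>{p..q}. \<bar>f t\<bar> \<le> K"
proof -
  have "bounded (f ` {p..q})"
    by (intro compact_imp_bounded compact_continuous_image assms) simp
  then obtain K where "\<forall>y\<in>f ` {p..q}. \<bar>y\<bar> \<le> K" unfolding bounded_real ..
  then show ?thesis by (intro exI [of _ K]) blast
qed

text \<open>
  The breakpoints of the composition are those of \<open>h\<close> and the points that are mapped to them,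
  finitely many on each of the injective branches. For the branches \<open>H\<close> and \<open>G\<close> with reciprocal
  derivatives \<open>v\<close> and \<open>w\<close> the composition has the reciprocal derivative \<open>(w \<circ> H) * v\<close>, with
  derivative \<open>w' \<circ> H + (w \<circ> H) * v'\<close>.
\<close>

lemma piecewise_expanding_comp:
  assumes h: "piecewise_expanding h r" and r: "0 \<le> r"
  shows "piecewise_expanding (h \<circ> h) (r * r)"
proof -
  obtain D0 where D0: "finite D0" "\<And>p q. 0 \<le> p \<Longrightarrow> p < q \<Longrightarrow> q \<le> 1 \<Longrightarrow> {p<..<q} \<inter> D0 = {} \<Longrightarrow> expanding_piece h r p q"
    using h unfolding piecewise_expanding_def by blast
  define D where "D = (D0 \<inter> {0..1}) \<union> {0, 1}"
  have D: "finite D" "0 \<in> D" "1 \<in> D" "D \<subseteq> {0..1}" using D0(1) by (auto simp: D_def)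
  have piece: "expanding_piece h r p q" if "0 \<le> p" "p < q" "q \<le> 1" "{p<..<q} \<inter> D = {}" for p q
    using that by (intro D0(2)) (auto simp: D_def)
  define E where "E = D \<union> (\<Union>(p, q)\<in>gaps D. {t \<in> {p<..<q}. h t \<in> D})"
  have "finite {t \<in> {p<..<q}. h t \<in> D}" if "(p, q) \<in> gaps D" for p q
  proof -
    have pq: "0 \<le> p" "p < q" "q \<le> 1" "{p<..<q} \<inter> D = {}" using that D(4) by (auto simp: gaps_def)
    then obtain H where "\<And>t. t \<in> {p<..<q} \<Longrightarrow> h t = H t" "inj_on H {p<..<q}"
      using piece [OF pq] unfolding expanding_piece_def by metis
    then have "{t \<in> {p<..<q}. h t \<in> D} = H -` D \<inter> {p<..<q}" by auto
    then show ?thesis using finite_vimage_IntI [OF D(1) \<open>inj_on H {p<..<q}\<close>] by simp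
  qed
  then have finE: "finite E" unfolding E_def using D(1) finite_gaps [OF D(1)] by auto
  have "expanding_piece (h \<circ> h) (r * r) p q" if pq: "0 \<le> p" "p < q" "q \<le> 1" "{p<..<q} \<inter> E = {}" for p q
  proof -
    have pqD: "{p<..<q} \<inter> D = {}" using pq(4) by (auto simp: E_def)
    have off: "h t \<notin> D" if t: "t \<in> {p<..<q}" for t
    proof -
      have "t \<notin> D" "0 < t" "t < 1" using pqD t pq by auto
      then obtain p' q' where "(p', q') \<in> gaps D" "p' < t" "t < q'" using gaps_cover [OF D(1-3)] by metis
      then show ?thesis using pq(4) t unfolding E_def by fastforce
    qed
    obtain H v v' K P Q where H: "continuous_on {p..q} H" "continuous_on {p..q} v" "continuous_on {p<..<q} v'"
        "\<And>t. t \<in> {p..q} \<Longrightarrow> \<bar>v t\<bar> \<le> r" "\<And>t. t \<in> {p..q} \<Longrightarrow> H t \<in> {P..Q}"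
      and H': "\<And>t. t \<in> {p<..<q} \<Longrightarrow> h t = H t" "\<And>t. t \<in> {p<..<q} \<Longrightarrow> v t \<noteq> 0"
        "\<And>t. t \<in> {p<..<q} \<Longrightarrow> (H has_real_derivative 1 / v t) (at t)"
        "\<And>t. t \<in> {p<..<q} \<Longrightarrow> (v has_real_derivative v' t) (at t)" "\<And>t. t \<in> {p<..<q} \<Longrightarrow> \<bar>v' t\<bar> \<le> K"
      and P: "0 \<le> P" "P < Q" "Q \<le> 1" "H ` {p<..<q} = {P<..<Q}" "inj_on H {p<..<q}"
      using piece [OF pq(1-3) pqD] unfolding expanding_piece_def by (elim exE conjE) blast
    have PQD: "{P<..<Q} \<inter> D = {}"
    proof -
      have "y \<notin> D" if y: "y \<in> {P<..<Q}" for y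
      proof -
        obtain t where "t \<in> {p<..<q}" "y = H t" using y P(4) by (metis imageE)
        then show ?thesis using off H'(1) by metis
      qed
      then show ?thesis by blast
    qed
    obtain G w w' M R S where G: "continuous_on {P..Q} G" "continuous_on {P..Q} w" "continuous_on {P<..<Q} w'"
        "\<And>t. t \<in> {P..Q} \<Longrightarrow> \<bar>w t\<bar> \<le> r" "\<And>t. t \<in> {P..Q} \<Longrightarrow> G t \<in> {R..S}"
      and G': "\<And>t. t \<in> {P<..<Q} \<Longrightarrow> h t = G t" "\<And>t. t \<in> {P<..<Q} \<Longrightarrow> w t \<noteq> 0"
        "\<And>t. t \<in> {P<..<Q} \<Longrightarrow> (G has_real_derivative 1 / w t) (at t)"
        "\<And>t. t \<in> {P<..<Q} \<Longrightarrow> (w has_real_derivative w' t) (at t)" "\<And>t. t \<in> {P<..<Q} \<Longrightarrow> \<bar>w' t\<bar> \<le> M"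
      and R: "0 \<le> R" "R < S" "S \<le> 1" "G ` {P<..<Q} = {R<..<S}" "inj_on G {P<..<Q}"
      using piece [OF P(1-3) PQD] unfolding expanding_piece_def by (elim exE conjE) blast
    have Hin: "H t \<in> {P<..<Q}" if "t \<in> {p<..<q}" for t using P(4) that by blast
    have sub: "{p<..<q} \<subseteq> {p..q}" by auto
    have contH': "continuous_on {p<..<q} H" "continuous_on {p<..<q} v" using H(1,2) sub continuous_on_subset by blast+
    show ?thesis unfolding expanding_piece_def
    proof (intro exI conjI ballI)
      show "continuous_on {p..q} (\<lambda>t. G (H t))"
        by (rule continuous_on_compose2 [OF G(1) H(1)]) (use H(5) in blast)
      show "continuous_on {p..q} (\<lambda>t. w (H t) * v t)"
        by (intro continuous_on_mult H(2) continuous_on_compose2 [OF G(2) H(1)]) (use H(5) in blast)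
      show "continuous_on {p<..<q} (\<lambda>t. w' (H t) + w (H t) * v' t)"
      proof (intro continuous_on_add continuous_on_mult H(3))
        show "continuous_on {p<..<q} (\<lambda>t. w' (H t))"
          by (rule continuous_on_compose2 [OF G(3) contH'(1)]) (use Hin in blast)
        show "continuous_on {p<..<q} (\<lambda>t. w (H t))"
          by (rule continuous_on_compose2 [OF G(2) contH'(1)]) (use H(5) sub in blast)
      qed
      show "\<bar>w (H t) * v t\<bar> \<le> r * r" if "t \<in> {p..q}" for t
        unfolding abs_mult using G(4) H(4,5) that r by (intro mult_mono) auto
      show "G (H t) \<in> {R..S}" if "t \<in> {p..q}" for t using G(5) H(5) that by blast
      fix t assume t: "t \<in> {p<..<q}"
      have Ht: "H t \<in> {P<..<Q}" using Hin t by blast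
      show "(h \<circ> h) t = G (H t)" using H'(1) [OF t] G'(1) [OF Ht] by simp
      show "w (H t) * v t \<noteq> 0" using H'(2) [OF t] G'(2) [OF Ht] by simp
      show "((\<lambda>t. G (H t)) has_real_derivative 1 / (w (H t) * v t)) (at t)"
        using DERIV_chain2 [OF G'(3) [OF Ht] H'(3) [OF t]] by simp
      have "((\<lambda>t. w (H t)) has_real_derivative w' (H t) * (1 / v t)) (at t)"
        by (rule DERIV_chain2 [OF G'(4) [OF Ht] H'(3) [OF t]])
      from DERIV_mult [OF this H'(4) [OF t]]
      have "((\<lambda>t. w (H t) * v t) has_real_derivative w' (H t) * (1 / v t) * v t + v' t * w (H t)) (at t)" .
      then show "((\<lambda>t. w (H t) * v t) has_real_derivative w' (H t) + w (H t) * v' t) (at t)"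
        using H'(2) [OF t] by (simp add: mult.commute)
      have "\<bar>w (H t) * v' t\<bar> \<le> r * K"
        unfolding abs_mult using G(4) [of "H t"] H'(5) [OF t] Ht r by (intro mult_mono) auto
      then show "\<bar>w' (H t) + w (H t) * v' t\<bar> \<le> M + r * K" using G'(5) [OF Ht] by linarith
    next
      show "0 \<le> R" "R < S" "S \<le> 1" by (fact R)+
      show "(\<lambda>t. G (H t)) ` {p<..<q} = {R<..<S}" using P(4) R(4) by (metis image_image)
      show "inj_on (\<lambda>t. G (H t)) {p<..<q}"
        using comp_inj_on [OF P(5), of G] R(5) unfolding P(4) by (simp add: o_def)
    qed
  qed
  then show ?thesis using finE unfolding piecewise_expanding_def by blast
qed

text \<open>
  Without integer values in the interior, \<open>F\<close> stays between two consecutive integers, and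
  \<open>frac \<circ> F\<close> is a translate of \<open>F\<close>.
\<close>

lemma C2_piece_expanding:
  fixes F :: "real \<Rightarrow> real"
  assumes pq: "p < q" and C2: "C2_on_interval p q F" and mono: "mono_or_antimono_on {p..q} F"
    and slope: "\<And>s t. s \<in> {p..q} \<Longrightarrow> t \<in> {p..q} \<Longrightarrow> s < t \<Longrightarrow> 2 * (t - s) < \<bar>F t - F s\<bar>"
    and int: "\<And>t. t \<in> {p<..<q} \<Longrightarrow> F t \<notin> \<int>"
  shows "expanding_piece (\<lambda>t. frac (F t)) (1/2) p q"
proof -
  obtain F' F'' where F': "\<And>t. t \<in> {p..q} \<Longrightarrow> (F has_real_derivative F' t) (at t within {p..q})"
     "\<And>t. t \<in> {p..q} \<Longrightarrow> (F' has_real_derivative F'' t) (at t within {p..q})" "continuous_on {p..q} F''"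
    using C2 unfolding C2_on_interval_def by blast
  have contF: "continuous_on {p..q} F" "continuous_on {p..q} F'"
    using F'(1,2) DERIV_continuous_on by blast+
  have big: "2 \<le> \<bar>F' t\<bar>" if t: "t \<in> {p..q}" for t
  proof -
    have "((\<lambda>y. (F y - F t) / (y - t)) \<longlongrightarrow> F' t) (at t within {p..q})"
      using F'(1) [OF t] by (simp add: has_field_derivative_iff)
    then have "((\<lambda>y. \<bar>(F y - F t) / (y - t)\<bar>) \<longlongrightarrow> \<bar>F' t\<bar>) (at t within {p..q})" by (rule tendsto_rabs)
    moreover have "at t within {p..q} \<noteq> bot" using pq t by (simp add: trivial_limit_within connected_imp_perfect)
    moreover have "\<forall>\<^sub>F y in at t within {p..q}. 2 \<le> \<bar>(F y - F t) / (y - t)\<bar>"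
      unfolding eventually_at_filter
    proof (rule always_eventually, intro allI impI)
      fix y assume y: "y \<noteq> t" "y \<in> {p..q}"
      have "2 * \<bar>y - t\<bar> \<le> \<bar>F y - F t\<bar>"
        using slope [of y t] slope [of t y] y t by (cases "y < t") auto
      then show "2 \<le> \<bar>(F y - F t) / (y - t)\<bar>" using y(1) by (simp add: abs_divide field_simps)
    qed
    ultimately show ?thesis using tendsto_lowerbound by blast
  qed
  have inj: "inj_on F {p..q}"
  proof (rule inj_onI)
    fix s t assume st: "s \<in> {p..q}" "t \<in> {p..q}" "F s = F t"
    then show "s = t" using slope [of s t] slope [of t s] by (cases s t rule: linorder_cases) auto
  qed
  define P0 where "P0 = min (F p) (F q)"
  define Q0 where "Q0 = max (F p) (F q)"
  have PQ0: "P0 < Q0" using slope [of p q] pq by (auto simp: P0_def Q0_def)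
  have range: "F t \<in> {P0..Q0}" if "t \<in> {p..q}" for t
    using mono that pq unfolding mono_or_antimono_on_def monotone_on_def P0_def Q0_def by auto
  have range': "F t \<in> {P0<..<Q0}" if t: "t \<in> {p<..<q}" for t
  proof -
    have "F t \<noteq> F p" "F t \<noteq> F q" using inj t by (auto dest: inj_onD)
    then show ?thesis using range [of t] t by (auto simp: P0_def Q0_def min_def max_def split: if_splits)
  qed
  have onto: "F ` {p<..<q} = {P0<..<Q0}"
  proof
    show "F ` {p<..<q} \<subseteq> {P0<..<Q0}" using range' by blast
    show "{P0<..<Q0} \<subseteq> F ` {p<..<q}"
    proof
      fix y assume y: "y \<in> {P0<..<Q0}"
      have "connected (F ` {p..q})" by (intro connected_continuous_image contF) simp
      then have "{P0..Q0} \<subseteq> F ` {p..q}"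
        using pq by (intro connected_contains_Icc) (auto simp: P0_def Q0_def min_def max_def)
      moreover have "y \<in> {P0..Q0}" using y by auto
      ultimately obtain t where t: "t \<in> {p..q}" "y = F t" by blast
      moreover have "t \<noteq> p" "t \<noteq> q" using y t by (auto simp: P0_def Q0_def)
      ultimately have "t \<in> {p<..<q}" by auto
      then show "y \<in> F ` {p<..<q}" using t by blast
    qed
  qed
  define k where "k = \<lfloor>P0\<rfloor>"
  have k: "of_int k \<le> P0" "Q0 \<le> of_int k + 1"
  proof -
    show "of_int k \<le> P0" by (simp add: k_def)
    show "Q0 \<le> of_int k + 1"
    proof (rule ccontr)
      assume "\<not> ?thesis"
      then have "of_int (k + 1) \<in> {P0<..<Q0}" by (auto simp: k_def)
      then obtain t where "t \<in> {p<..<q}" "F t = of_int (k + 1)" using onto by (metis imageE)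
      then show False using int [of t] by (metis Ints_of_int)
    qed
  qed
  define v where "v = (\<lambda>t. 1 / F' t)"
  define v' where "v' = (\<lambda>t. - F'' t / (F' t * F' t))"
  have nz: "F' t \<noteq> 0" if "t \<in> {p..q}" for t using big [OF that] by auto
  have contv': "continuous_on {p..q} v'" unfolding v'_def
    by (intro continuous_intros contF F') (use nz in auto)
  then obtain K where "\<forall>t\<in>{p..q}. \<bar>v' t\<bar> \<le> K"
    using continuous_on_Icc_bounded by blast
  then have K: "\<bar>v' t\<bar> \<le> K" if "t \<in> {p..q}" for t using that by blast
  have at_eq: "at t within {p..q} = at t" if "t \<in> {p<..<q}" for t
    using that by (intro at_within_interior) auto
  show ?thesis unfolding expanding_piece_def
  proof (intro exI conjI ballI)
    show "continuous_on {p..q} (\<lambda>t. F t - of_int k)" by (intro continuous_intros contF)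
    show "continuous_on {p..q} v" unfolding v_def by (intro continuous_intros contF) (use nz in auto)
    show "continuous_on {p<..<q} v'" by (rule continuous_on_subset [OF contv']) auto
    show "\<bar>v t\<bar> \<le> 1/2" if "t \<in> {p..q}" for t using big [OF that] by (simp add: v_def abs_divide field_simps)
    show "F t - of_int k \<in> {P0 - of_int k..Q0 - of_int k}" if "t \<in> {p..q}" for t using range [OF that] by auto
    fix t assume t: "t \<in> {p<..<q}"
    then have t': "t \<in> {p..q}" by auto
    have "\<lfloor>F t\<rfloor> = k" using range' [OF t] k by (intro floor_unique) auto
    then show "frac (F t) = F t - of_int k" by (simp add: frac_def)
    show "v t \<noteq> 0" using nz [OF t'] by (simp add: v_def)
    have "(F has_real_derivative F' t) (at t)" using F'(1) [OF t'] at_eq [OF t] by simp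
    then show "((\<lambda>t. F t - of_int k) has_real_derivative 1 / v t) (at t)"
      by (auto intro!: derivative_eq_intros simp: v_def)
    have "(F' has_real_derivative F'' t) (at t)" using F'(2) [OF t'] at_eq [OF t] by simp
    then show "(v has_real_derivative v' t) (at t)" unfolding v_def v'_def
      using nz [OF t'] by (auto intro!: derivative_eq_intros)
    show "\<bar>v' t\<bar> \<le> K" using K [OF t'] .
  next
    show "0 \<le> P0 - of_int k" "P0 - of_int k < Q0 - of_int k" "Q0 - of_int k \<le> 1" using k PQ0 by auto
    have "(\<lambda>t. F t - of_int k) ` {p<..<q} = (\<lambda>y. y - of_int k) ` {P0<..<Q0}"
      unfolding onto [symmetric] image_image by simp
    also have "\<dots> = {P0 - of_int k<..<Q0 - of_int k}"
    proof (intro equalityI subsetI)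
      fix y assume "y \<in> {P0 - of_int k<..<Q0 - of_int k}"
      then show "y \<in> (\<lambda>y. y - of_int k) ` {P0<..<Q0}" by (intro image_eqI [of _ _ "y + of_int k"]) auto
    qed auto
    finally show "(\<lambda>t. F t - of_int k) ` {p<..<q} = {P0 - of_int k<..<Q0 - of_int k}" .
    show "inj_on (\<lambda>t. F t - of_int k) {p<..<q}"
      using inj by (auto simp: inj_on_def)
  qed
qed

context expanding_circle_map
begin

text \<open>
  The coordinate representation on \<open>{0..<1}\<close> has two kinds of breakpoints: those of \<open>g\<close> and the
  points at which the lift crosses an integer. The latter are finitely many on every injective
  piece.
\<close>

lemma frac_lift_piecewise_expanding: "piecewise_expanding (\<lambda>t. frac (F t)) (1/2)"
proof -
  define D where "D = {t \<in> {0..1}. circ_e t \<in> Z} \<union> {0, 1}"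
  have D: "finite D" "0 \<in> D" "1 \<in> D" "D \<subseteq> {0..1}" using finite_breakpoints [of 0 1] by (auto simp: D_def)
  have freeD: "circ_e ` {p<..<q} \<inter> Z = {}" if "0 \<le> p" "q \<le> 1" "{p<..<q} \<inter> D = {}" for p q
  proof -
    have "circ_e t \<notin> Z" if t: "t \<in> {p<..<q}" for t
    proof
      assume "circ_e t \<in> Z"
      then have "t \<in> D" using t \<open>0 \<le> p\<close> \<open>q \<le> 1\<close> by (auto simp: D_def)
      then show False using t \<open>{p<..<q} \<inter> D = {}\<close> by blast
    qed
    then show ?thesis by blast
  qed
  obtain b where "\<forall>t\<in>{0..1}. \<bar>F t\<bar> \<le> b"
    using continuous_on_Icc_bounded [OF lift_continuous] by blast
  then have b: "\<bar>F t\<bar> \<le> b" if "t \<in> {0..1}" for t using that by blast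
  define I where "I = real_of_int ` {\<lfloor>- b\<rfloor>..\<lceil>b\<rceil>}"
  have finI: "finite I" by (simp add: I_def)
  have inI: "F t \<in> I" if t: "t \<in> {0..1}" and Ft: "F t \<in> \<int>" for t
  proof -
    obtain i where i: "F t = of_int i" using Ft by (auto elim: Ints_cases)
    then have "\<bar>real_of_int i\<bar> \<le> b" using b [OF t] by simp
    then have "i \<in> {\<lfloor>- b\<rfloor>..\<lceil>b\<rceil>}" by (simp add: floor_le_iff le_ceiling_iff abs_le_iff)
    then show ?thesis using i by (simp add: I_def)
  qed
  define E where "E = D \<union> (\<Union>(p, q)\<in>gaps D. {t \<in> {p<..<q}. F t \<in> I})"
  have "finite {t \<in> {p<..<q}. F t \<in> I}" if "(p, q) \<in> gaps D" for p q
  proof -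
    have pq: "0 \<le> p" "p < q" "q \<le> 1" "{p<..<q} \<inter> D = {}" using that D(4) by (auto simp: gaps_def)
    have "inj_on F {p<..<q}"
    proof (rule inj_onI)
      fix s t assume st: "s \<in> {p<..<q}" "t \<in> {p<..<q}" "F s = F t"
      then show "s = t"
        using slope_piece [OF pq(2) freeD [OF pq(1,3,4)], of s t] slope_piece [OF pq(2) freeD [OF pq(1,3,4)], of t s]
        by (cases s t rule: linorder_cases) auto
    qed
    moreover have "{t \<in> {p<..<q}. F t \<in> I} = F -` I \<inter> {p<..<q}" by auto
    ultimately show ?thesis using finite_vimage_IntI [OF finI] by simp
  qed
  then have finE: "finite E" unfolding E_def using D(1) finite_gaps [OF D(1)] by auto
  have "expanding_piece (\<lambda>t. frac (F t)) (1/2) p q" if pq: "0 \<le> p" "p < q" "q \<le> 1" "{p<..<q} \<inter> E = {}" for p q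
  proof -
    have pqD: "{p<..<q} \<inter> D = {}" using pq(4) by (auto simp: E_def)
    note free = freeD [OF pq(1,3) pqD]
    show ?thesis
    proof (rule C2_piece_expanding [OF pq(2) C2_piece [OF pq(2) free] mono_piece [OF pq(2) free] slope_piece [OF pq(2) free]])
      fix t assume t: "t \<in> {p<..<q}"
      show "F t \<notin> \<int>"
      proof
        assume "F t \<in> \<int>"
        then have "F t \<in> I" using inI [of t] t pq by auto
        have "t \<notin> D" "0 < t" "t < 1" using pqD t pq by auto
        then obtain p' q' where "(p', q') \<in> gaps D" "p' < t" "t < q'" using gaps_cover [OF D(1-3)] by metis
        then have "t \<in> E" using \<open>F t \<in> I\<close> unfolding E_def by fastforce
        then show False using pq(4) t by blast
      qed
    qed
  qed
  then show ?thesis using finE unfolding piecewise_expanding_def by blast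
qed

lemma lift_lipschitz:
  obtains C where "C-lipschitz_on {0..2} F"
proof -
  define D where "D = {t \<in> {0..2}. circ_e t \<in> Z} \<union> {0, 2}"
  have D: "finite D" "0 \<in> D" "2 \<in> D" "D \<subseteq> {0..2}" using finite_breakpoints [of 0 2] by (auto simp: D_def)
  have "\<exists>C. 0 \<le> C \<and> C-lipschitz_on {fst g..snd g} F" if "g \<in> gaps D" for g
  proof -
    obtain p q where g: "g = (p, q)" by force
    have pq: "0 \<le> p" "p < q" "q \<le> 2" "{p<..<q} \<inter> D = {}" using that g D(4) by (auto simp: gaps_def)
    then have free: "circ_e ` {p<..<q} \<inter> Z = {}" by (force simp: D_def)
    obtain F' F'' where F': "\<And>t. t \<in> {p..q} \<Longrightarrow> (F has_real_derivative F' t) (at t within {p..q})"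
     "\<And>t. t \<in> {p..q} \<Longrightarrow> (F' has_real_derivative F'' t) (at t within {p..q})"
      using C2_piece [OF pq(2) free] unfolding C2_on_interval_def by blast
    have "continuous_on {p..q} F'" using F'(2) DERIV_continuous_on by blast
    then obtain K where "\<forall>t\<in>{p..q}. \<bar>F' t\<bar> \<le> K"
      using continuous_on_Icc_bounded by blast
    then have K: "\<bar>F' t\<bar> \<le> K" if "t \<in> {p..q}" for t using that by blast
    have "0 \<le> K" using K [of p] pq by auto
    have "K-lipschitz_on {p..q} F"
    proof (rule lipschitz_onI)
      show "dist (F x) (F y) \<le> K * dist x y" if "x \<in> {p..q}" "y \<in> {p..q}" for x y
        using field_differentiable_bound [of "{p..q}" F F' K x y] F'(1) K that by (simp add: dist_norm)
    qed fact
    then show ?thesis using \<open>0 \<le> K\<close> g by auto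
  qed
  then obtain Cg where Cg: "\<And>g. g \<in> gaps D \<Longrightarrow> 0 \<le> Cg g \<and> (Cg g)-lipschitz_on {fst g..snd g} F" by metis
  define C where "C = sum Cg (gaps D)"
  have "C-lipschitz_on {0..2} F"
  proof (rule lipschitz_on_closed_Union [where I = "gaps D" and U = "\<lambda>g. {fst g..snd g}"])
    show "C-lipschitz_on {fst g..snd g} F" if "g \<in> gaps D" for g
      using Cg [OF that] member_le_sum [of g "gaps D" Cg] Cg that finite_gaps [OF D(1)]
      unfolding C_def by (meson lipschitz_on_le DiffD1)
    show "0 \<le> C" unfolding C_def using Cg by (intro sum_nonneg) auto
    show "finite (gaps D)" by (rule finite_gaps [OF D(1)])
    show "{0..2} \<subseteq> (\<Union>g\<in>gaps D. {fst g..snd g})"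
    proof
      fix t :: real assume t: "t \<in> {0..2}"
      show "t \<in> (\<Union>g\<in>gaps D. {fst g..snd g})"
      proof (cases "t \<in> D")
        case False
        then have "0 < t" "t < 2" using t D by (metis atLeastAtMost_iff less_eq_real_def)+
        then obtain p q where "(p, q) \<in> gaps D" "p < t" "t < q" using gaps_cover [OF D(1-3)] False by metis
        then show ?thesis by (intro UN_I [of "(p, q)"]) auto
      next
        case True
        show ?thesis
        proof (cases "t = 2")
          case True
          define p where "p = Max (D - {2})"
          have f: "finite (D - {2})" "D - {2} \<noteq> {}" using D by auto
          have p: "p \<in> D - {2}" "\<And>d. d \<in> D - {2} \<Longrightarrow> d \<le> p" using Max_in [OF f] Max_ge [OF f(1)] by (auto simp: p_def)
          have "(p, 2) \<in> gaps D" using p D(3,4) by (force simp: gaps_def)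
          then show ?thesis using p D(4) True by (intro UN_I [of "(p, 2)"]) auto
        next
          case False
          define q where "q = Min {d \<in> D. t < d}"
          have f: "finite {d \<in> D. t < d}" "{d \<in> D. t < d} \<noteq> {}" using D False t by auto
          have q: "q \<in> D" "t < q" "\<And>d. d \<in> D \<Longrightarrow> t < d \<Longrightarrow> q \<le> d" using Min_in [OF f] Min_le [OF f(1)] by (auto simp: q_def)
          have "(t, q) \<in> gaps D" using q \<open>t \<in> D\<close> by (force simp: gaps_def)
          then show ?thesis using q by (intro UN_I [of "(t, q)"]) auto
        qed
      qed
    qed
  qed auto
  then show thesis using that by blast
qed

end

section \<open>Exactness\<close>

lemma emeasure_lborel_translate:
  fixes c :: real
  assumes "B \<in> sets borel" shows "emeasure lborel ((+) c -` B) = emeasure lborel B"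
proof -
  have "emeasure lborel B = emeasure (distr lborel borel ((+) c)) B"
    using lborel_distr_plus [of c] by simp
  also have "\<dots> = emeasure lborel ((+) c -` B)" using assms by (subst emeasure_distr) auto
  finally show ?thesis by simp
qed

text \<open>Cutting \<open>Y\<close> at the integers and translating the parts to \<open>{0..<1}\<close> covers the image.\<close>

lemma leb_circ_e_image_le:
  assumes "compact Y" shows "leb (circ_e ` Y) \<le> measure lborel Y"
proof -
  obtain b :: nat where b: "Y \<subseteq> {- real b..real b}"
  proof -
    obtain B where B: "\<And>y. y \<in> Y \<Longrightarrow> \<bar>y\<bar> \<le> B"
      using compact_imp_bounded [OF assms] unfolding bounded_real by auto
    obtain b :: nat where "B \<le> real b" using real_arch_simple by blast
    then have "Y \<subseteq> {- real b..real b}" using B by force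
    then show thesis by (rule that)
  qed
  define I where "I = {- int b - 1..int b}"
  define P where "P = (\<lambda>k. Y \<inter> {of_int k..<of_int k + 1})"
  have [measurable]: "Y \<in> sets borel" using assms by (simp add: borel_compact)
  have Pm: "P k \<in> sets borel" for k by (simp add: P_def)
  define S where "S = (\<lambda>k::int. (+) (of_int k) -` P k)"
  have Sm: "S k \<in> sets lborel" for k
  proof -
    have "(+) (of_int k :: real) \<in> borel_measurable borel" by simp
    from measurable_sets_borel [OF this Pm [of k]] show ?thesis by (simp add: S_def)
  qed
  have ce: "compact (circ_e ` Y)" using assms by (intro compact_continuous_image continuous_circ_e) auto
  then have es: "circ_e ` Y \<in> sets circ_leb" by (intro compact_sets_circ_leb) auto
  have sub: "circ_e -` (circ_e ` Y) \<inter> {0..<1} \<subseteq> (\<Union>k\<in>I. S k)"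
  proof
    fix t assume t: "t \<in> circ_e -` (circ_e ` Y) \<inter> {0..<1}"
    then obtain y where y: "y \<in> Y" "circ_e t = circ_e y" by blast
    then obtain k where k: "y = t + of_int k" by (auto simp: circ_e_eq_iff)
    have "t \<in> S k" using y k t by (auto simp: S_def P_def add.commute)
    moreover have "k \<in> I"
    proof -
      have "- real b \<le> y" "y \<le> real b" using b y(1) by auto
      then have "- int b - 1 \<le> k" "k \<le> int b" using k t by auto
      then show ?thesis by (simp add: I_def)
    qed
    ultimately show "t \<in> (\<Union>k\<in>I. S k)" by blast
  qed
  have "emeasure circ_leb (circ_e ` Y) = emeasure lborel (circ_e -` (circ_e ` Y) \<inter> {0..<1})"
    by (rule emeasure_circ_leb [OF es])
  also have "\<dots> \<le> emeasure lborel (\<Union>k\<in>I. S k)"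
    using sub Sm by (intro emeasure_mono sets.finite_UN) (auto simp: I_def)
  also have "\<dots> \<le> (\<Sum>k\<in>I. emeasure lborel (S k))"
    using Sm by (intro emeasure_subadditive_finite) (auto simp: I_def)
  also have "\<dots> = (\<Sum>k\<in>I. emeasure lborel (P k))"
    unfolding S_def using emeasure_lborel_translate [OF Pm] by simp
  also have "\<dots> = emeasure lborel (\<Union>k\<in>I. P k)"
  proof (rule sum_emeasure)
    show "disjoint_family_on P I"
      unfolding disjoint_family_on_def
    proof (intro ballI impI)
      fix i j :: int assume "i \<noteq> j"
      have "i = j" if "t \<in> P i \<inter> P j" for t
        using that by (simp add: P_def)
      then show "P i \<inter> P j = {}" using \<open>i \<noteq> j\<close> by auto
    qed
  qed (use Pm in \<open>simp_all add: I_def image_subset_iff\<close>)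
  also have "\<dots> \<le> emeasure lborel Y" by (intro emeasure_mono) (auto simp: P_def)
  finally show ?thesis
    using emeasure_compact_finite [OF assms] by (simp add: measure_def enn2real_mono)
qed

lemma circ_compact_inner_approx:
  assumes X: "X \<in> sets circ_leb" and "0 < \<epsilon>"
  obtains K where "compact K" "K \<subseteq> X" "leb X \<le> leb K + \<epsilon>"
proof -
  define X' where "X' = circ_e -` X \<inter> {0..<1}"
  have X': "X' \<in> sets borel" "X' \<subseteq> {0..1}" using circ_e_vimage_sets [OF X] by (auto simp: X'_def)
  obtain K' where K': "compact K'" "K' \<subseteq> X'" "measure lborel (X' - K') \<le> \<epsilon>"
    using compact_inner_approx [OF X' assms(2)] by blast
  have K'b: "K' \<in> sets borel" using K'(1) by (simp add: borel_compact)
  define K where "K = circ_e ` K'"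
  have "compact K" unfolding K_def
    by (rule compact_continuous_image [OF _ K'(1)]) (intro continuous_intros)
  moreover have "K \<subseteq> X" using K'(2) by (auto simp: K_def X'_def)
  ultimately have K: "compact K" "K \<subseteq> X" .
  have "K \<subseteq> circ" by (auto simp: K_def)
  then have Ks: "K \<in> sets circ_leb" using K(1) by (intro compact_sets_circ_leb)
  have "leb X = measure lborel X'" using measure_circ_leb_period [OF X, of 0] by (simp add: X'_def)
  also have "\<dots> = measure lborel (K' \<union> (X' - K'))" using K'(2) by (simp add: Un_absorb1)
  also have "\<dots> \<le> measure lborel K' + measure lborel (X' - K')"
    using K'b X' by (intro measure_Un_le_borel) auto
  also have "measure lborel K' \<le> measure lborel (circ_e -` K \<inter> {0..<1})"
    using K'b circ_e_vimage_sets [OF Ks] K'(2)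
    by (intro measure_mono_Icc [of _ _ 0 1]) (auto simp: K_def X'_def)
  also have "\<dots> = leb K" using measure_circ_leb_period [OF Ks, of 0] by simp
  finally have "leb X \<le> leb K + \<epsilon>" using K'(3) by simp
  then show thesis by (rule that [OF K])
qed

context expanding_circle_map
begin

text \<open>
  Compact subsets of \<open>W \<inter> g ` carc a l\<close> are images under the lift, which is Lipschitz, of
  compact sets of parameters of points in \<open>carc a l \<inter> g -` W\<close>. Applied to the complement of a
  set, this says that a set that nearly fills an arc has an image that nearly fills the image of
  the arc.
\<close>

lemma image_measure_le_preimage:
  "\<exists>C\<ge>0. \<forall>a l W. 0 \<le> l \<and> l \<le> 1 \<and> W \<in> sets circ_leb \<longrightarrow>
    leb (W \<inter> g ` carc a l) \<le> C * leb (carc a l \<inter> (g -` W \<inter> circ))"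
proof -
  obtain L where L: "L-lipschitz_on {0..2} F" using lift_lipschitz by blast
  have L0: "0 \<le> L" using L by (rule lipschitz_on_nonneg)
  have main: "leb (W \<inter> g ` carc a l) \<le> (2 * L) * leb (carc a l \<inter> (g -` W \<inter> circ))"
    if a: "0 \<le> a" "a < 1" and l: "0 \<le> l" "l \<le> 1" and W: "W \<in> sets circ_leb" for a l W
  proof (rule field_le_epsilon)
    fix \<epsilon> :: real assume \<epsilon>: "0 < \<epsilon>"
    define R where "R = carc a l \<inter> (g -` W \<inter> circ)"
    have R: "R \<in> sets circ_leb" unfolding R_def using C_lambda_preserves(1) [OF C_lambda W] by auto
    have "W \<inter> g ` carc a l \<in> sets circ_leb"
      using W image_sets [OF C_lambda arc_compact carc_subset_circ] by auto
    then obtain K where K: "compact K" "K \<subseteq> W \<inter> g ` carc a l" "leb (W \<inter> g ` carc a l) \<le> leb K + \<epsilon>"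
      using circ_compact_inner_approx \<epsilon> by blast
    define S where "S = {a..a + l} \<inter> (\<lambda>t. circ_e (F t)) -` K"
    have "continuous_on UNIV (\<lambda>t. circ_e (F t))" by (intro continuous_circ_e lift_continuous)
    then have cS: "compact S" unfolding S_def
      using K(1) by (intro compact_Int_closed closed_vimage compact_imp_closed) auto
    have S02: "S \<subseteq> {0..2}" using a l by (auto simp: S_def)
    have cF: "compact (F ` S)" using cS by (intro compact_continuous_image lift_continuous)
    have "K \<subseteq> circ_e ` F ` S"
    proof
      fix z assume z: "z \<in> K"
      then obtain t where "t \<in> {a..a + l}" "z = g (circ_e t)" using K(2) by blast
      then have "t \<in> S" "z = circ_e (F t)" using z by (auto simp: S_def lift_eq)
      then show "z \<in> circ_e ` F ` S" by blast
    qed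
    moreover have "compact (circ_e ` (F ` S))"
      by (rule compact_continuous_image [OF _ cF]) (intro continuous_intros)
    then have "circ_e ` F ` S \<in> sets circ_leb" by (rule compact_sets_circ_leb) auto
    ultimately have "leb K \<le> leb (circ_e ` F ` S)" by (rule leb_mono)
    also have "\<dots> \<le> measure lborel (F ` S)" by (rule leb_circ_e_image_le [OF cF])
    also have "\<dots> \<le> 2 * L * measure lborel S"
      by (rule measure_lipschitz_image_le [OF cS lipschitz_on_subset [OF L S02]])
    finally have "leb K \<le> 2 * L * measure lborel S" .
    moreover have "measure lborel S \<le> leb R"
    proof -
      have Rm: "circ_e -` R \<in> sets borel" by (rule circ_e_vimage_sets [OF R])
      have "S \<subseteq> (circ_e -` R \<inter> {a..<a+1}) \<union> {a + 1}"
      proof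
        fix t assume t: "t \<in> S"
        then have "circ_e (F t) \<in> W" using K(2) by (auto simp: S_def)
        then have "circ_e t \<in> R" using t by (auto simp: R_def S_def lift_eq)
        then show "t \<in> (circ_e -` R \<inter> {a..<a+1}) \<union> {a + 1}" using t l by (auto simp: S_def)
      qed
      then have "measure lborel S \<le> measure lborel ((circ_e -` R \<inter> {a..<a+1}) \<union> {a + 1})"
        using cS Rm by (intro measure_mono_Icc [of _ _ a "a + 1"]) (auto simp: borel_compact)
      also have "\<dots> \<le> measure lborel (circ_e -` R \<inter> {a..<a+1}) + measure lborel {a + 1}"
        using Rm by (intro measure_Un_le_borel) auto
      also have "\<dots> = leb R" using measure_circ_leb_period [OF R, of a] by simp
      finally show ?thesis .
    qed
    then have "2 * L * measure lborel S \<le> 2 * L * leb R" using L0 by (simp add: mult_left_mono)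
    ultimately have "leb K \<le> 2 * L * leb R" by linarith
    then show "leb (W \<inter> g ` carc a l) \<le> 2 * L * leb (carc a l \<inter> (g -` W \<inter> circ)) + \<epsilon>"
      using K(3) by (simp add: R_def)
  qed
  have "leb (W \<inter> g ` carc a l) \<le> (2 * L) * leb (carc a l \<inter> (g -` W \<inter> circ))"
    if "0 \<le> l" "l \<le> 1" "W \<in> sets circ_leb" for a l W
  proof -
    have "carc a l = carc (frac a) l" using carc_shift [of "frac a" "\<lfloor>a\<rfloor>" l] by (simp add: frac_def)
    then show ?thesis using main [of "frac a" l W] that by (simp add: frac_lt_1)
  qed
  then show ?thesis using L0 by (intro exI [of _ "2 * L"]) simp
qed

lemma image_measure_le_preimage_funpow:
  "\<exists>C\<ge>0. \<forall>m a l W. 0 < l \<and> l \<le> 1 \<and> W \<in> sets circ_leb \<longrightarrow>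
    leb (W \<inter> (g ^^ m) ` carc a l) \<le> C ^ m * leb (carc a l \<inter> ((g ^^ m) -` W \<inter> circ))"
proof -
  obtain C where C: "0 \<le> C" "\<forall>a l W. 0 \<le> l \<and> l \<le> 1 \<and> W \<in> sets circ_leb \<longrightarrow>
    leb (W \<inter> g ` carc a l) \<le> C * leb (carc a l \<inter> (g -` W \<inter> circ))"
    using image_measure_le_preimage by (elim exE conjE)
  have "leb (W \<inter> (g ^^ m) ` carc a l) \<le> C ^ m * leb (carc a l \<inter> ((g ^^ m) -` W \<inter> circ))"
    if "0 < l" "l \<le> 1" "W \<in> sets circ_leb" for m a l W
    using that
  proof (induction m arbitrary: a l W)
    case 0
    have "carc a l \<inter> (W \<inter> circ) = W \<inter> carc a l" by auto
    then show ?case by simp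
  next
    case (Suc m)
    obtain a' l' where al: "l \<le> l'" "l' \<le> 1" "g ` carc a l = carc a' l'"
      by (rule image_arc [OF C_lambda lift Suc.prems(1,2), of a])
    define W' where "W' = (g ^^ m) -` W \<inter> circ"
    have W': "W' \<in> sets circ_leb" unfolding W'_def by (rule C_lambda_preserves(1) [OF funpow_C_lambda Suc.prems(3)])
    have "(g ^^ Suc m) ` carc a l = (g ^^ m) ` carc a' l'"
      unfolding al(3) [symmetric] by (simp only: image_comp funpow_Suc_right o_assoc)
    then have "leb (W \<inter> (g ^^ Suc m) ` carc a l) \<le> C ^ m * leb (carc a' l' \<inter> W')"
      using Suc.IH [of l' W a'] al Suc.prems by (simp add: W'_def)
    also have "\<dots> = C ^ m * leb (W' \<inter> g ` carc a l)" by (simp add: al(3) Int_commute)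
    also have "\<dots> \<le> C ^ m * (C * leb (carc a l \<inter> (g -` W' \<inter> circ)))"
      using C(1) C(2) [rule_format, of l W' a] Suc.prems W' by (intro mult_left_mono) auto
    also have "g -` W' \<inter> circ = (g ^^ Suc m) -` W \<inter> circ"
      unfolding W'_def funpow_Suc_right using C_lambdaD(2) [OF C_lambda] by auto
    finally show ?case by (simp only: power_Suc mult_ac)
  qed
  then show ?thesis using C(1) by (intro exI [of _ C]) simp
qed

lemma frac_lift_semiconj: "circ_e (((\<lambda>t. frac (F t)) ^^ n) t) = (g ^^ n) (circ_e t)"
  by (induction n) (auto simp: lift_eq)

lemma frac_lift_measurable: "(\<lambda>t. frac (F t)) \<in> borel_measurable borel"
proof -
  have "F \<in> borel_measurable borel" by (intro borel_measurable_continuous_onI lift_continuous)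
  then show ?thesis unfolding frac_def by measurable
qed

lemma frac_lift_preserves:
  "(\<lambda>t. frac (F t)) \<in> measurable unit_leb unit_leb" "distr unit_leb unit_leb (\<lambda>t. frac (F t)) = unit_leb"
proof -
  define h where "h = (\<lambda>t. frac (F t))"
  have hb: "h \<in> borel_measurable unit_leb" unfolding h_def by (intro measurable_unit_leb frac_lift_measurable)
  show hm: "(\<lambda>t. frac (F t)) \<in> measurable unit_leb unit_leb"
    using hb unfolding h_def unit_leb_def by (intro measurable_restrict_space2) (auto simp: frac_lt_1)
  have idb: "(\<lambda>t. t) \<in> borel_measurable unit_leb" by (rule measurable_unit_leb) simp
  have eq: "distr unit_leb borel h = distr unit_leb borel (\<lambda>t. t)"
  proof (rule measure_eqI_lessThan)
    fix x :: real
    show "emeasure (distr unit_leb borel h) {x<..} < \<infinity>"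
      using hb by (simp add: emeasure_distr less_top [symmetric] unit_leb.emeasure_finite)
    \<comment> \<open>The circle set of the coordinates greater than \<open>x\<close>; the coordinate \<open>0\<close> is added separately because \<open>V\<close> has to be open.\<close>
    define V where "V = circ_e ` ({x<..} \<inter> {0<..<1})"
    define W where "W = (if x < 0 then V \<union> {1} else V)"
    have Vs: "V \<in> sets circ_leb"
    proof (cases "{x<..} \<inter> {0<..<1} = {}")
      case True then show ?thesis by (simp add: V_def)
    next
      case False
      then show ?thesis unfolding V_def by (intro measure_open_pos(1) openin_circ_e_image) auto
    qed
    have "{1} \<in> sets circ_leb" by (intro compact_sets_circ_leb) (auto simp: circ_def)
    then have "V \<union> {1} \<in> sets circ_leb" by (rule sets.Un [OF Vs])
    then have Ws: "W \<in> sets circ_leb" using Vs unfolding W_def by simp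
    have W_iff: "circ_e t \<in> W \<longleftrightarrow> x < t" if t: "t \<in> {0..<1}" for t
    proof (cases "t = 0")
      case True
      have "1 \<notin> V"
      proof
        assume "1 \<in> V"
        then obtain s where "s \<in> {0<..<1}" "circ_e 0 = circ_e s" by (auto simp: V_def)
        then show False using circ_e_inj [of 0 0 s] by auto
      qed
      then show ?thesis using True by (auto simp: W_def)
    next
      case False
      have "circ_e t \<noteq> 1"
      proof
        assume "circ_e t = 1"
        then have "circ_e t = circ_e 0" by simp
        then show False using circ_e_inj [of 0 t 0] t False by auto
      qed
      moreover have "circ_e t \<in> V \<longleftrightarrow> x < t"
      proof
        assume "circ_e t \<in> V"
        then obtain s where s: "x < s" "s \<in> {0<..<1}" "circ_e t = circ_e s" by (auto simp: V_def)
        then show "x < t" using circ_e_inj [of 0 t s] t by auto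
      next
        assume "x < t"
        then show "circ_e t \<in> V" using t False by (auto simp: V_def)
      qed
      ultimately show ?thesis by (auto simp: W_def)
    qed
    have h01: "h t \<in> {0..<1}" for t by (simp add: h_def frac_lt_1)
    have d1: "emeasure (distr unit_leb borel h) {x<..} = emeasure unit_leb (h -` {x<..} \<inter> {0..<1})"
      using hb by (subst emeasure_distr) auto
    have d2: "emeasure (distr unit_leb borel (\<lambda>t. t)) {x<..} = emeasure unit_leb ((\<lambda>t. t) -` {x<..} \<inter> {0..<1})"
      using idb by (subst emeasure_distr) auto
    have "h -` {x<..} \<inter> {0..<1} = circ_e -` (g -` W \<inter> circ) \<inter> {0..<1}"
      using W_iff [OF h01] by (auto simp: h_def lift_eq)
    then have "emeasure unit_leb (h -` {x<..} \<inter> {0..<1}) = emeasure circ_leb (g -` W \<inter> circ)"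
      using emeasure_circ_leb [OF C_lambda_preserves(1) [OF C_lambda Ws]] by (simp add: emeasure_unit_leb)
    also have "\<dots> = emeasure circ_leb W" using C_lambda Ws by (simp add: C_lambda_def)
    also have "\<dots> = emeasure lborel (circ_e -` W \<inter> {0..<1})" by (rule emeasure_circ_leb [OF Ws])
    also have "circ_e -` W \<inter> {0..<1} = {x<..} \<inter> {0..<1}" using W_iff by auto
    also have "emeasure lborel ({x<..} \<inter> {0..<1}) = emeasure unit_leb ((\<lambda>t. t) -` {x<..} \<inter> {0..<1})"
      by (simp add: emeasure_unit_leb)
    finally show "emeasure (distr unit_leb borel h) {x<..} = emeasure (distr unit_leb borel (\<lambda>t. t)) {x<..}"
      by (simp only: d1 d2)
  qed auto
  show "distr unit_leb unit_leb (\<lambda>t. frac (F t)) = unit_leb"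
  proof (rule measure_eqI)
    fix A assume "A \<in> sets (distr unit_leb unit_leb (\<lambda>t. frac (F t)))"
    then have A: "A \<in> sets unit_leb" by simp
    then have Ab: "A \<in> sets borel" "A \<subseteq> {0..<1}" by (auto simp: sets_unit_leb)
    have "emeasure (distr unit_leb unit_leb h) A = emeasure (distr unit_leb borel h) A"
      using hm hb A Ab by (simp add: emeasure_distr h_def)
    also have "\<dots> = emeasure unit_leb A" unfolding eq using idb Ab by (simp add: emeasure_distr Int_absorb2)
    finally show "emeasure (distr unit_leb unit_leb (\<lambda>t. frac (F t))) A = emeasure unit_leb A" by (simp add: h_def)
  qed simp
qed

text \<open>
  An image that is the whole circle remains so, and the sum of the covering times of the
  individual cells works for all of them.
\<close>

lemma leo_imp_common_covering_time:
  assumes "leo g" "0 < N"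
  shows "\<exists>M. \<forall>j\<in>{0..<int N}. (g ^^ M) ` carc (of_int j / N) (1 / N) = circ"
proof -
  have "\<exists>m. (g ^^ m) ` carc (of_int j / N) (1 / N) = circ" for j :: int
  proof -
    define U where "U = circ_e ` {of_int j / N<..<of_int j / N + 1 / real N}"
    have "openin (top_of_set circ) U" "U \<noteq> {}" using assms(2) by (auto simp: U_def intro: openin_circ_e_image)
    then have "\<exists>m\<ge>1. (g ^^ m) ` U = circ" using assms(1) unfolding leo_def by simp
    then obtain m where m: "(g ^^ m) ` U = circ" by blast
    have "U \<subseteq> carc (of_int j / N) (1 / N)" unfolding U_def by (intro image_mono) auto
    then have "circ \<subseteq> (g ^^ m) ` carc (of_int j / N) (1 / N)" unfolding m [symmetric] by (rule image_mono)
    moreover have "(g ^^ m) ` carc (of_int j / N) (1 / N) \<subseteq> circ" by (rule image_subset_circ [OF funpow_C_lambda carc_subset_circ])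
    ultimately show ?thesis by (intro exI [of _ m] equalityI)
  qed
  then have "\<forall>j::int. \<exists>m. (g ^^ m) ` carc (of_int j / N) (1 / N) = circ" by blast
  from choice [OF this] obtain m where m: "\<forall>j::int. (g ^^ m j) ` carc (of_int j / N) (1 / N) = circ" ..
  define M where "M = (\<Sum>j\<in>{0..<int N}. m j)"
  have "(g ^^ M) ` carc (of_int j / N) (1 / N) = circ" if "j \<in> {0..<int N}" for j
  proof -
    have "m j \<le> M" unfolding M_def using that by (intro member_le_sum) auto
    then have "(g ^^ M) ` carc (of_int j / N) (1 / N) = (g ^^ (M - m j)) ` ((g ^^ m j) ` carc (of_int j / N) (1 / N))"
      by (simp flip: funpow_image)
    then show ?thesis using m funpow_circ by simp
  qed
  then show ?thesis by blast
qed

text \<open>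
  A tail set \<open>A\<close> of positive measure is the preimage of \<open>B n\<close> under the \<open>n\<close>-th iterate, and
  \<open>B n\<close> has the measure of \<open>A\<close>. For large \<open>n\<close> the set \<open>B (2 * n)\<close> nearly fills a cell of a fixed
  grid. After \<open>M\<close> further steps this cell covers the circle, so \<open>B (2 * n + M)\<close> nearly fills the
  circle. Hence the measure of \<open>A\<close> is \<open>1\<close>. Even times occur because the interval map has
  \<open>r = 1/2\<close>, and only its square, with \<open>r = 1/4\<close>, reduces the bound on test functions.
\<close>

lemma leo_imp_exact:
  assumes "leo g" shows "exact g"
  unfolding exact_def
proof
  fix A assume "A \<in> (\<Inter>n. {(g ^^ n) -` B \<inter> circ |B. B \<in> sets circ_leb})"
  then have "\<forall>n. \<exists>B. A = (g ^^ n) -` B \<inter> circ \<and> B \<in> sets circ_leb" by blast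
  then obtain B where B: "\<And>n. A = (g ^^ n) -` B n \<inter> circ" "\<And>n. B n \<in> sets circ_leb" by metis
  have A: "A \<in> sets circ_leb" using C_lambda_preserves(1) [OF funpow_C_lambda [of 0] B(2)] B(1) [of 0] by simp
  have lebB: "leb (B n) = leb A" for n
    using C_lambda_preserves(2) [OF funpow_C_lambda B(2), of n] B(1) [of n] by simp
  have B_step: "B n \<inter> circ = (g ^^ m) -` B (n + m) \<inter> circ" for n m
  proof -
    have "z \<in> B n \<longleftrightarrow> (g ^^ m) z \<in> B (n + m)" if "z \<in> circ" for z
    proof -
      have "z \<in> (g ^^ n) ` circ" using that by (simp only: funpow_circ)
      then obtain y where y: "y \<in> circ" "z = (g ^^ n) y" by (elim imageE)
      have "z \<in> B n \<longleftrightarrow> y \<in> A" using B(1) [of n] y by auto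
      also have "\<dots> \<longleftrightarrow> (g ^^ (m + n)) y \<in> B (n + m)" using B(1) [of "n + m"] y by (auto simp: add.commute)
      also have "(g ^^ (m + n)) y = (g ^^ m) z" using y by (simp add: funpow_add)
      finally show ?thesis .
    qed
    then show ?thesis by blast
  qed
  define h where "h = (\<lambda>t. frac (F t))"
  define h2 where "h2 = h \<circ> h"
  have h2n: "h2 ^^ n = h ^^ (2 * n)" for n
    unfolding h2_def by (induction n) (auto simp: fun_eq_iff)
  have pe: "piecewise_expanding h2 (1/4)"
    using piecewise_expanding_comp [OF frac_lift_piecewise_expanding] by (simp add: h2_def h_def)
  have hm: "h \<in> borel_measurable borel" unfolding h_def by (rule frac_lift_measurable)
  have h2m: "h2 \<in> borel_measurable borel" unfolding h2_def by (rule measurable_comp [OF hm hm])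
  have pres: "h2 \<in> measurable unit_leb unit_leb" "distr unit_leb unit_leb h2 = unit_leb"
    using distr_funpow_unit_leb [OF frac_lift_preserves, of 2] by (simp_all add: h2_def h_def numeral_2_eq_2 o_def)
  show "leb A * leb (circ - A) = 0"
  proof (cases "leb A = 0")
    case False
    then have pos: "0 < leb A" by (simp add: zero_less_measure_iff)
    define A' where "A' = circ_e -` A \<inter> {0..<1}"
    define B' where "B' = (\<lambda>n. circ_e -` B (2 * n) \<inter> {0..<1})"
    have A': "A' \<in> sets borel" "A' \<subseteq> {0..<1}" "0 < measure lborel A'"
      using circ_e_vimage_sets [OF A] pos measure_circ_leb_period [OF A, of 0] by (auto simp: A'_def)
    have B': "B' n \<in> sets borel" "B' n \<subseteq> {0..<1}" for n
      using circ_e_vimage_sets [OF B(2)] by (auto simp: B'_def)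
    have AB': "x \<in> A' \<longleftrightarrow> (h2 ^^ n) x \<in> B' n" if "x \<in> {0..<1}" for n x
    proof -
      have "(h2 ^^ n) x \<in> {0..<1}"
      proof (cases n)
        case 0 then show ?thesis using that by simp
      next
        case (Suc k)
        then show ?thesis by (simp add: h2_def h_def frac_lt_1)
      qed
      moreover have "circ_e ((h2 ^^ n) x) = (g ^^ (2 * n)) (circ_e x)"
        unfolding h2n h_def by (rule frac_lift_semiconj)
      moreover have "circ_e x \<in> A \<longleftrightarrow> (g ^^ (2 * n)) (circ_e x) \<in> B (2 * n)" using B(1) [of "2 * n"] by auto
      ultimately show ?thesis using that by (auto simp: A'_def B'_def)
    qed
    have q: "(0::real) \<le> 1/4" "(1/4::real) \<le> 1/4" by simp_all
    obtain N where N: "0 < N" "\<And>\<kappa>. 0 < \<kappa> \<Longrightarrow> \<exists>n0. \<forall>n\<ge>n0. \<exists>j\<in>{0..<int N}. measure lborel (cells N {j} - B' n) \<le> \<kappa>"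
    proof -
      show thesis by (rule tail_set_nearly_full_cell [OF pe h2m q pres A' B' AB']) (assumption, fact that)
    qed
    obtain M where M: "\<forall>j\<in>{0..<int N}. (g ^^ M) ` carc (of_int j / N) (1 / N) = circ"
      using leo_imp_common_covering_time [OF assms N(1)] by (elim exE)
    obtain C where C: "0 \<le> C" "\<forall>m a l W. 0 < l \<and> l \<le> 1 \<and> W \<in> sets circ_leb \<longrightarrow>
      leb (W \<inter> (g ^^ m) ` carc a l) \<le> C ^ m * leb (carc a l \<inter> ((g ^^ m) -` W \<inter> circ))"
      using image_measure_le_preimage_funpow by (elim exE conjE)
    have small: "1 - leb A \<le> C ^ M * \<kappa>" if \<kappa>: "0 < \<kappa>" for \<kappa>
    proof -
      obtain n0 where "\<forall>n\<ge>n0. \<exists>j\<in>{0..<int N}. measure lborel (cells N {j} - B' n) \<le> \<kappa>" using N(2) [OF \<kappa>] by (elim exE)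
      then have "\<exists>j\<in>{0..<int N}. measure lborel (cells N {j} - B' n0) \<le> \<kappa>" by simp
      then obtain n j where j: "j \<in> {0..<int N}" "measure lborel (cells N {j} - B' n) \<le> \<kappa>" by (elim bexE)
      \<comment> \<open>Points that reach \<open>W\<close> after \<open>M\<close> steps lie outside \<open>B (2 * n)\<close>, and there are few of them in the cell.\<close>
      define W where "W = circ - B (2 * n + M)"
      have W: "W \<in> sets circ_leb" using B(2) by (auto simp: W_def)
      define a where "a = of_int j / real N"
      define l where "l = 1 / real N"
      have l: "0 < l" "l \<le> 1" using N(1) by (auto simp: l_def)
      have "0 \<le> j" "j + 1 \<le> int N" using j(1) by auto
      then have "real_of_int 0 \<le> of_int j" "real_of_int (j + 1) \<le> real N" by linarith+
      then have a: "0 \<le> a" "a + l \<le> 1" using N(1) by (auto simp: a_def l_def field_simps)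
      have cell: "cells N {j} = {a..<a + l}"
        unfolding cells_singleton [OF N(1)] a_def l_def by (simp add: add_divide_distrib)
      have "(g ^^ M) ` carc a l = circ" using M j(1) by (simp add: a_def l_def)
      then have "W \<inter> (g ^^ M) ` carc a l = W" by (auto simp: W_def)
      then have "leb W \<le> C ^ M * leb (carc a l \<inter> ((g ^^ M) -` W \<inter> circ))"
        using C(2) [rule_format, of l W M a] l W by simp
      moreover have "leb (carc a l \<inter> ((g ^^ M) -` W \<inter> circ)) \<le> \<kappa>"
      proof -
        define R where "R = carc a l \<inter> ((g ^^ M) -` W \<inter> circ)"
        have R: "R \<in> sets circ_leb" unfolding R_def using C_lambda_preserves(1) [OF funpow_C_lambda W] by auto
        have RB: "R \<inter> B (2 * n) = {}" using B_step [of "2 * n" M] by (auto simp: R_def W_def)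
        have "circ_e -` R \<inter> {a..<a+1} \<subseteq> (cells N {j} - B' n) \<union> {a + l}"
        proof
          fix t assume t: "t \<in> circ_e -` R \<inter> {a..<a+1}"
          then obtain s where s: "s \<in> {a..a+l}" "circ_e t = circ_e s" by (auto simp: R_def)
          have "t \<in> {a..a + l}"
          proof (cases "s = a + 1")
            case True
            then have "circ_e t = circ_e a" using s by simp
            then have "t = a" using circ_e_inj [of a t a] t by auto
            then show ?thesis using l by simp
          next
            case False
            then have "t = s" using circ_e_inj [of a t s] t s l by auto
            then show ?thesis using s by simp
          qed
          moreover have "t \<notin> B' n" using t RB by (auto simp: B'_def)
          ultimately show "t \<in> (cells N {j} - B' n) \<union> {a + l}" using cell by auto
        qed
        then have "measure lborel (circ_e -` R \<inter> {a..<a+1}) \<le> measure lborel ((cells N {j} - B' n) \<union> {a + l})"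
          using circ_e_vimage_sets [OF R] B'(1) N(1) cell l by (intro measure_mono_Icc [of _ _ a "a + l"]) (auto intro: cells_borel)
        also have "\<dots> \<le> measure lborel (cells N {j} - B' n) + measure lborel {a + l}"
          using B'(1) N(1) by (intro measure_Un_le_borel) auto
        finally show ?thesis using j(2) measure_circ_leb_period [OF R, of a] by (simp add: R_def)
      qed
      then have "C ^ M * leb (carc a l \<inter> ((g ^^ M) -` W \<inter> circ)) \<le> C ^ M * \<kappa>"
        using C(1) by (intro mult_left_mono) simp_all
      ultimately have "leb W \<le> C ^ M * \<kappa>" by linarith
      moreover have "leb W = 1 - leb A"
        unfolding W_def using lebB [of "2 * n + M"] B(2) [of "2 * n + M"]
        by (subst circ_leb.finite_measure_Diff) (auto simp: sets_circ_leb)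
      ultimately show ?thesis by simp
    qed
    have "1 - leb A \<le> 0"
    proof (rule field_le_epsilon)
      fix e :: real assume e: "0 < e"
      define \<kappa> where "\<kappa> = e / (C ^ M + 1)"
      have CM: "0 \<le> C ^ M" using C(1) by simp
      then have "0 < \<kappa>" "C ^ M * \<kappa> \<le> e" using e by (auto simp: \<kappa>_def field_simps)
      then show "1 - leb A \<le> 0 + e" using small [of \<kappa>] by linarith
    qed
    moreover have "leb (circ - A) = 1 - leb A"
      using A by (subst circ_leb.finite_measure_Diff) (auto simp: sets_circ_leb)
    ultimately have "leb (circ - A) \<le> 0" by simp
    then show ?thesis by (simp add: measure_le_0_iff)
  qed simp
qed

text \<open>
  The preimages of a periodic arc \<open>A\<close> under the multiples of its period increase and all have
  the measure of \<open>A\<close>. Their union has this measure too, which is neither \<open>0\<close> nor \<open>1\<close>, and it is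
  its own preimage under the multiples of the period. So it is a tail set.
\<close>

lemma exact_imp_no_periodic_arc:
  assumes "exact g" shows "\<not> has_periodic_arc g"
proof
  assume "has_periodic_arc g"
  then obtain A n where A: "is_arc A" "n \<ge> 1" "(g ^^ n) ` A = A"
    by (auto simp: has_periodic_arc_def periodic_arc_def)
  then obtain a b where ab: "a < b" "b < a + 1" "A = circ_e ` {a..b}"
    by (auto simp: is_arc_iff_param arc_param_def)
  have As: "A \<in> sets circ_leb" using ab by simp
  define S where "S = (\<lambda>k. (g ^^ (n * k)) -` A \<inter> circ)"
  have S: "S k \<in> sets circ_leb" "leb (S k) = leb A" for k
    unfolding S_def using C_lambda_preserves [OF funpow_C_lambda As] by blast+
  have "incseq S"
  proof (rule incseq_SucI)
    fix k
    have "(g ^^ (n * Suc k)) z \<in> A" if "(g ^^ (n * k)) z \<in> A" for z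
    proof -
      have "(g ^^ (n * Suc k)) z = (g ^^ n) ((g ^^ (n * k)) z)" by (simp add: funpow_add)
      then show ?thesis using that A(3) by blast
    qed
    then show "S k \<le> S (Suc k)" by (auto simp: S_def)
  qed
  define B where "B = (\<Union>k. S k)"
  have Bs: "B \<in> sets circ_leb" unfolding B_def using S(1) by auto
  have "(\<lambda>k. leb (S k)) \<longlonglongrightarrow> leb B"
    unfolding B_def using S(1) \<open>incseq S\<close> by (intro circ_leb.finite_Lim_measure_incseq) auto
  then have "(\<lambda>k::nat. leb A) \<longlonglongrightarrow> leb B" by (simp only: S(2))
  then have "leb B = leb A" by (simp add: LIMSEQ_const_iff)
  then have lB: "0 < leb B" "leb B < 1" using ab measure_arc [of a b] by auto
  have inv: "(g ^^ (n * m)) -` B \<inter> circ = B" for m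
  proof -
    have "(g ^^ (n * m)) z \<in> B \<longleftrightarrow> z \<in> B" if z: "z \<in> circ" for z
    proof -
      have "(g ^^ (n * m)) z \<in> S k \<longleftrightarrow> z \<in> S (k + m)" for k
        using C_lambdaD(2) [OF funpow_C_lambda z] z by (simp add: S_def funpow_add distrib_left)
      then have "(g ^^ (n * m)) z \<in> B \<longleftrightarrow> (\<exists>k. z \<in> S (k + m))" by (auto simp: B_def)
      also have "\<dots> \<longleftrightarrow> z \<in> B"
        using incseqD [OF \<open>incseq S\<close>] unfolding B_def by (meson UN_iff UNIV_I le_add1 subsetD)
      finally show ?thesis .
    qed
    moreover have "B \<subseteq> circ" by (auto simp: B_def S_def)
    ultimately show ?thesis by blast
  qed
  have "B \<in> (\<Inter>m. {(g ^^ m) -` B' \<inter> circ |B'. B' \<in> sets circ_leb})"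
  proof
    fix m
    \<comment> \<open>The first \<open>m\<close> steps are completed to the multiple \<open>n * m\<close> of the period.\<close>
    define B' where "B' = (g ^^ (n * m - m)) -` B \<inter> circ"
    have "B' \<in> sets circ_leb" unfolding B'_def by (rule C_lambda_preserves(1) [OF funpow_C_lambda Bs])
    moreover have "(g ^^ m) -` B' \<inter> circ = B"
    proof -
      have "m \<le> n * m" using A(2) by simp
      then have eq: "(g ^^ (n * m)) z = (g ^^ (n * m - m)) ((g ^^ m) z)" for z
        using funpow_add [of "n * m - m" m g] by simp
      have "(g ^^ m) -` B' \<inter> circ = (g ^^ (n * m)) -` B \<inter> circ"
        unfolding B'_def using C_lambdaD(2) [OF funpow_C_lambda] by (auto simp: eq)
      then show ?thesis using inv by simp
    qed
    ultimately show "B \<in> {(g ^^ m) -` B' \<inter> circ |B'. B' \<in> sets circ_leb}" by blast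
  qed
  then have "leb B * leb (circ - B) = 0" using assms unfolding exact_def by blast
  moreover have "leb (circ - B) = 1 - leb B"
    using Bs by (subst circ_leb.finite_measure_Diff) (auto simp: sets_circ_leb)
  ultimately show False using lB by simp
qed

lemma exact_iff_no_periodic_arc: "exact g \<longleftrightarrow> \<not> has_periodic_arc g"
  using exact_imp_no_periodic_arc leo_imp_exact no_periodic_arc_imp_leo by blast

end

section \<open>Dependence on the two rotations\<close>

lemma rot_rot: "rot \<alpha> (rot \<beta> z) = rot (\<alpha> + \<beta>) z"
  by (simp add: rot_def circ_e_add mult_ac)

lemma rot_frac [simp]: "rot (frac \<alpha>) = rot \<alpha>"
  by (simp add: rot_def fun_eq_iff)

lemma has_periodic_arc_rot_conj:
  assumes "has_periodic_arc g" "\<And>z. rot \<beta> (g z) = g' (rot \<beta> z)"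
  shows "has_periodic_arc g'"
proof -
  obtain A n where A: "is_arc A" "n \<ge> 1" "\<And>i j. i < j \<Longrightarrow> j < n \<Longrightarrow> (g ^^ i) ` A \<noteq> (g ^^ j) ` A" "(g ^^ n) ` A = A"
    using assms(1) by (auto simp: has_periodic_arc_def periodic_arc_def)
  have "rot \<beta> ((g ^^ m) z) = (g' ^^ m) (rot \<beta> z)" for m z
    by (induction m) (auto simp: assms(2))
  then have conj: "(g' ^^ m) ` (rot \<beta> ` A) = rot \<beta> ` ((g ^^ m) ` A)" for m
    by (auto simp: image_image)
  have inj: "inj (rot \<beta>)" by (auto simp: inj_on_def rot_def)
  obtain a b where ab: "a < b" "b < a + 1" "A = circ_e ` {a..b}"
    using A(1) by (auto simp: is_arc_iff_param arc_param_def)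
  have "A = carc a (b - a)" using ab by simp
  then have "rot \<beta> ` A = carc (a + \<beta>) (b - a)" by (simp only: rot_image_carc)
  also have "\<dots> = circ_e ` {a + \<beta>..b + \<beta>}" by (simp add: algebra_simps)
  finally have "is_arc (rot \<beta> ` A)"
    unfolding is_arc_iff_param arc_param_def using ab by (intro exI [of _ "a + \<beta>"] exI [of _ "b + \<beta>"]) auto
  then have "periodic_arc g' (rot \<beta> ` A) n"
    using A(2-4) inj_image_eq_iff [OF inj] by (auto simp: periodic_arc_def conj)
  then show ?thesis by (auto simp: has_periodic_arc_def)
qed

text \<open>The rotation by \<open>\<beta>\<close> conjugates \<open>T \<alpha> \<beta> f\<close> to \<open>T (\<alpha> + \<beta>) 0 f\<close>.\<close>

lemma has_periodic_arc_T_iff: "has_periodic_arc (T \<alpha> \<beta> f) \<longleftrightarrow> has_periodic_arc (T (\<alpha> + \<beta>) 0 f)"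
proof
  assume "has_periodic_arc (T \<alpha> \<beta> f)"
  then show "has_periodic_arc (T (\<alpha> + \<beta>) 0 f)"
    by (rule has_periodic_arc_rot_conj [where \<beta> = \<beta>]) (simp add: T_def rot_rot add.commute)
next
  assume "has_periodic_arc (T (\<alpha> + \<beta>) 0 f)"
  then show "has_periodic_arc (T \<alpha> \<beta> f)"
    by (rule has_periodic_arc_rot_conj [where \<beta> = "- \<beta>"]) (simp add: T_def rot_rot)
qed

lemma E_iff: "(\<alpha>, \<beta>) \<in> E f \<longleftrightarrow> \<alpha> \<in> {0..<1} \<and> \<beta> \<in> {0..<1} \<and> frac (\<alpha> + \<beta>) \<in> E1 f"
proof -
  have "has_periodic_arc (T \<alpha> \<beta> f) \<longleftrightarrow> has_periodic_arc (T (frac (\<alpha> + \<beta>)) 0 f)"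
    using has_periodic_arc_T_iff [of \<alpha> \<beta> f] by (simp add: T_def)
  then show ?thesis by (auto simp: E_def E1_def frac_lt_1)
qed

lemma E1_eq_E2: "E1 f = E2 f"
  using has_periodic_arc_T_iff [of 0 _ f] by (auto simp: E1_def E2_def)

lemma frac_eqI: "x \<in> {0..<1} \<Longrightarrow> circ_e x = circ_e y \<Longrightarrow> frac y = x"
  using circ_e_inj [of 0 "frac y" x] by (auto simp: frac_lt_1)

lemma E_eq: "E f = {(frac (\<alpha> + \<gamma>), frac (- \<gamma>)) | \<alpha> \<gamma>. \<alpha> \<in> E1 f \<and> \<gamma> \<in> {0..<1}}"
proof (intro equalityI subsetI)
  fix p assume "p \<in> E f"
  then obtain a b where p: "p = (a, b)" and ab: "a \<in> {0..<1}" "b \<in> {0..<1}" "frac (a + b) \<in> E1 f"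
    using E_iff by (metis surj_pair)
  have "frac (frac (a + b) + frac (- b)) = a"
    by (rule frac_eqI [OF ab(1)]) (simp add: circ_e_add circ_e_minus)
  moreover have "frac (- frac (- b)) = b"
    by (rule frac_eqI [OF ab(2)]) (simp add: circ_e_minus)
  moreover have "frac (- b) \<in> {0..<1}" by (simp add: frac_lt_1)
  ultimately show "p \<in> {(frac (\<alpha> + \<gamma>), frac (- \<gamma>)) | \<alpha> \<gamma>. \<alpha> \<in> E1 f \<and> \<gamma> \<in> {0..<1}}"
    unfolding p using ab(3) by (intro CollectI exI [of _ "frac (a + b)"] exI [of _ "frac (- b)"]) simp
next
  fix p assume "p \<in> {(frac (\<alpha> + \<gamma>), frac (- \<gamma>)) | \<alpha> \<gamma>. \<alpha> \<in> E1 f \<and> \<gamma> \<in> {0..<1}}"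
  then obtain \<alpha> \<gamma> where p: "p = (frac (\<alpha> + \<gamma>), frac (- \<gamma>))" and a: "\<alpha> \<in> E1 f" by blast
  have "\<alpha> \<in> {0..<1}" using a by (simp add: E1_def)
  then have "frac (frac (\<alpha> + \<gamma>) + frac (- \<gamma>)) = \<alpha>"
    by (rule frac_eqI) (simp add: circ_e_add circ_e_minus)
  then show "p \<in> E f" unfolding p E_iff using a by (simp add: frac_lt_1)
qed

text \<open>
  Each circle is the graph of \<open>w \<mapsto> circ_e \<alpha> / w\<close>, and \<open>z * w = circ_e \<alpha>\<close> determines the circle
  through \<open>(z, w)\<close>.
\<close>

lemma torus_E_union_of_circles:
  assumes "finite (E1 f)"
  shows "\<exists>\<C>. finite \<C> \<and> disjoint \<C> \<and> (\<forall>C\<in>\<C>. topological_circle C) \<and> torus_e ` E f = \<Union>\<C>"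
proof -
  define Q where "Q = (\<lambda>\<alpha>. {(z, w) \<in> circ \<times> circ. z * w = circ_e \<alpha>})"
  have "topological_circle (Q \<alpha>)" for \<alpha>
  proof -
    have nz: "w \<noteq> 0" if "w \<in> circ" for w using that by (auto simp: circ_def)
    have "circ homeomorphic Q \<alpha>"
    proof (rule homeomorphic_compact [where f = "\<lambda>w. (circ_e \<alpha> / w, w)"])
      show "continuous_on circ (\<lambda>w. (circ_e \<alpha> / w, w))"
        by (intro continuous_intros) (use nz in auto)
      show "(\<lambda>w. (circ_e \<alpha> / w, w)) ` circ = Q \<alpha>"
      proof (intro equalityI subsetI)
        fix p assume "p \<in> (\<lambda>w. (circ_e \<alpha> / w, w)) ` circ"
        then obtain w where w: "w \<in> circ" "p = (circ_e \<alpha> / w, w)" by blast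
        have "circ_e \<alpha> / w \<in> circ" using w(1) circ_e_in_circ [of \<alpha>] by (simp add: circ_def norm_divide)
        then show "p \<in> Q \<alpha>" using w nz [OF w(1)] by (simp add: Q_def)
      next
        fix p assume "p \<in> Q \<alpha>"
        then obtain z w where "p = (z, w)" "z \<in> circ" "w \<in> circ" "z * w = circ_e \<alpha>" by (auto simp: Q_def)
        then show "p \<in> (\<lambda>w. (circ_e \<alpha> / w, w)) ` circ"
          using nz [of w] by (intro image_eqI [of _ _ w]) (auto simp: field_simps)
      qed
    qed (auto simp: inj_on_def)
    then show ?thesis unfolding topological_circle_def by (rule homeomorphic_sym [THEN iffD1])
  qed
  moreover have "disjoint (Q ` E1 f)"
  proof (intro pairwiseI)
    fix X Y assume XY: "X \<in> Q ` E1 f" "Y \<in> Q ` E1 f" "X \<noteq> Y"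
    obtain x where x: "X = Q x" using XY(1) by (elim imageE)
    obtain y where y: "Y = Q y" using XY(2) by (elim imageE)
    have "circ_e x \<noteq> circ_e y" using XY(3) by (auto simp: x y Q_def)
    then show "disjnt X Y" by (auto simp: x y disjnt_def Q_def)
  qed
  moreover have "torus_e ` E f = \<Union>(Q ` E1 f)"
  proof (intro equalityI subsetI)
    fix p assume "p \<in> torus_e ` E f"
    then obtain a b where ab: "(a, b) \<in> E f" "p = (circ_e a, circ_e b)" by (auto simp: torus_e_def)
    then have "frac (a + b) \<in> E1 f" by (simp add: E_iff)
    moreover have "p \<in> Q (frac (a + b))" using ab by (simp add: Q_def circ_e_add)
    ultimately show "p \<in> \<Union>(Q ` E1 f)" by blast
  next
    fix p assume "p \<in> \<Union>(Q ` E1 f)"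
    then obtain \<alpha> z w where p: "\<alpha> \<in> E1 f" "p = (z, w)" "z \<in> circ" "w \<in> circ" "z * w = circ_e \<alpha>" by (auto simp: Q_def)
    obtain a where a: "0 \<le> a" "a < 1" "z = circ_e a" by (rule circ_e_surj [OF p(3)])
    obtain b where b: "0 \<le> b" "b < 1" "w = circ_e b" by (rule circ_e_surj [OF p(4)])
    have "\<alpha> \<in> {0..<1}" using p(1) by (simp add: E1_def)
    then have "frac (a + b) = \<alpha>" by (rule frac_eqI) (use p a b in \<open>simp add: circ_e_add\<close>)
    then have "(a, b) \<in> E f" using p(1) a b by (simp add: E_iff)
    moreover have "p = torus_e (a, b)" using p a b by (simp add: torus_e_def)
    ultimately show "p \<in> torus_e ` E f" by blast
  qed
  ultimately show ?thesis using assms by (intro exI [of _ "Q ` E1 f"]) auto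
qed

theorem theorem10:
  fixes f :: "complex \<Rightarrow> complex"
  assumes "f \<in> C_lambda"
    and "piecewise_monotone f"
    and "piecewise_C2 f"
    and "slope_greater f 2"
  shows "(E1 f = E2 f \<and> finite (E1 f) \<and> finite (E2 f)) \<and>
    (E f = {(frac (\<alpha> + \<gamma>), frac (- \<gamma>)) | \<alpha> \<gamma>. \<alpha> \<in> E1 f \<and> \<gamma> \<in> {0..<1}} \<and>
      (\<exists>\<C>. finite \<C> \<and> disjoint \<C> \<and> (\<forall>C\<in>\<C>. topological_circle C) \<and> torus_e ` E f = \<Union>\<C>)) \<and>
    (\<forall>\<alpha>\<in>{0..<1}. \<forall>\<beta>\<in>{0..<1}.
      (leo (T \<alpha> \<beta> f) \<longleftrightarrow> (\<alpha>, \<beta>) \<notin> E f) \<and>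
      ((\<alpha>, \<beta>) \<notin> E f \<longleftrightarrow> exact (T \<alpha> \<beta> f)))"
proof -
  obtain F Z where f: "expanding_circle_map f F Z"
    using expanding_circle_map_exists [OF assms] by blast
  have fin: "finite (E1 f)" by (rule finite_E1 [OF f])
  have "(leo (T \<alpha> \<beta> f) \<longleftrightarrow> (\<alpha>, \<beta>) \<notin> E f) \<and> ((\<alpha>, \<beta>) \<notin> E f \<longleftrightarrow> exact (T \<alpha> \<beta> f))"
    if "\<alpha> \<in> {0..<1}" "\<beta> \<in> {0..<1}" for \<alpha> \<beta>
  proof -
    interpret expanding_circle_map "T \<alpha> \<beta> f" "\<lambda>t. F (t + \<beta>) + \<alpha>" "rot \<beta> -` Z"
      by (rule expanding_circle_map_T [OF f])
    have "(\<alpha>, \<beta>) \<in> E f \<longleftrightarrow> has_periodic_arc (T \<alpha> \<beta> f)" using that by (simp add: E_def)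
    then show ?thesis using leo_iff_no_periodic_arc exact_iff_no_periodic_arc by simp
  qed
  then show ?thesis
    using fin E1_eq_E2 [of f] E_eq [of f] torus_E_union_of_circles [OF fin] by simp
qed

end
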